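(* Let $a,b$ be complex parameters and put $K_0=\frac{(a,b;q)_\infty}{(q;q)_\infty}$. Then $$\mathrm{U}_{q,\lambda}(a,b;z)=\sum_{n=-\infty}^\infty\frac{(-bq^n\lambda;q)_\infty\;{}_1\phi_1\!\left({b\atop -bq^n\lambda};q;-aq^n\lambda\right)}{(-q^n\lambda;q)_\infty\,\theta_q\!\left(\frac{q^n\lambda}{z}\right)};$$ $$\mathrm{U}_{q,\lambda}(a,b;z)=(a;q)_\infty\sum_{n=-\infty}^\infty\frac{\left(-bq^n\lambda,-\frac{aqz}{q^n\lambda};q\right)_\infty}{(-q^n\lambda;q)_\infty\,\theta_q\!\left(\frac{q^n\lambda}{z}\right)},\qquad |aq|<1;$$ $$\mathrm{U}_{q,\lambda}(a,b;z)=(abz;q)_\infty\sum_{n=-\infty}^\infty\frac{(-aq^n\lambda,-bq^n\lambda;q)_\infty}{(-q^n\lambda;q)_\infty\,\theta_q\!\left(\frac{q^n\lambda}{z}\right)},\qquad |abz|<1;$$ and $$\mathrm{U}_{q,\lambda}(a,b;z)=K_0\sum_{n=-\infty}^\infty\frac{(-bq^{n+1}\lambda;q)_\infty\;{}_1\phi_1\!\left({q/a\atop -bq^{n+1}\lambda};q;-aq^{n+1}\lambda\right)}{\theta_q(q^{n+1}\lambda)}\;\frac{q^n\lambda}{q^n\lambda+z}.$$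
   Context: Throughout $0<q<1$; $(a;q)_\infty=\prod_{n\ge0}(1-aq^n)$, $(a;q)_n=(a;q)_\infty/(aq^n;q)_\infty$, and $(a_1,\dots,a_k;q)_n=\prod_j(a_j;q)_n$ (also for $n=\infty$). The basic hypergeometric series is $${}_r\phi_s\!\left({a_1,\ldots,a_r\atop b_1,\ldots,b_s};q;x\right)=\sum_{n=0}^\infty\frac{(a_1,\ldots,a_r;q)_n}{(b_1,\ldots,b_s,q;q)_n}\left((-1)^nq^{\binom n2}\right)^{1+s-r}x^n,$$ extended by analytic continuation in $x$ when $r=s+1$. Let $\theta_q(\tau)=(q,-\tau,-q/\tau;q)_\infty=\sum_{n=-\infty}^\infty q^{\binom n2}\tau^n$. Here $\lambda$ is a free nonzero complex parameter with $\lambda\notin\{-q^n:n\in\mathbb{Z}\}$, and $z\in\mathbb{C}\setminus\{-q^n\lambda:n\in\mathbb{Z}\}$. The function $\mathrm{U}_{q,\lambda}$, the discrete $q$-Borel-Laplace resummation of the divergent series ${}_2\phi_0(a,b;-;q;z)$, is defined by $$\mathrm{U}_{q,\lambda}(a,b;z)=\sum_{n=-\infty}^\infty\frac{{}_2\phi_1\!\left({a,b\atop 0};q;-q^n\lambda\right)}{\theta_q\!\left(\frac{q^n\lambda}{z}\right)}.$$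
   Formalization: The 2nd and 4th identities are claimed only when their right-hand series converges (proved for |a|<1, resp. |a|,|b|<1; at a=1 the printed claims fail); the 1st and 4th assume -bq^nλ≠1 for all integers n, and the 4th a≠0, so that the 1φ1 is defined. *)

theory Defs
  imports "HOL-Complex_Analysis.Complex_Analysis"
begin

definition qpoch_inf :: "complex \<Rightarrow> real \<Rightarrow> complex" where
  "qpoch_inf a q = (\<Prod>n. 1 - a * of_real q ^ n)"

text \<open>
  The finite symbol is the quotient \<open>(a;q)\<^sub>\<infinity> / (a q\<^sup>n;q)\<^sub>\<infinity>\<close> with the common factors
  cancelled, so that it is also meaningful when that quotient reads \<open>0 / 0\<close>,
  i.e. for \<open>a = q\<^bsup>-m\<^esup>\<close> with \<open>m \<ge> n\<close>; see \<open>qpoch_eq_quotient\<close>.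
\<close>

definition qpoch :: "complex \<Rightarrow> real \<Rightarrow> nat \<Rightarrow> complex" where
  "qpoch a q n = (\<Prod>k<n. 1 - a * of_real q ^ k)"

lemma qpoch_eq_quotient:
  assumes q: "0 < q" "q < 1" and nz: "qpoch_inf (a * of_real q ^ n) q \<noteq> 0"
  shows "qpoch a q n = qpoch_inf a q / qpoch_inf (a * of_real q ^ n) q"
proof -
  let ?f = "\<lambda>k. 1 - a * of_real q ^ k :: complex"
  have "summable (\<lambda>k. norm (- a) * q ^ k)"
    using q by (intro summable_mult summable_geometric) auto
  then have "summable (\<lambda>k. norm (- a * of_real q ^ k))"
    using q by (simp add: norm_mult norm_power)
  then have "abs_convergent_prod (\<lambda>k. 1 + (- a * of_real q ^ k))"
    by (intro summable_imp_abs_convergent_prod) simp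
  then have conv: "convergent_prod ?f"
    using abs_convergent_prod_imp_convergent_prod by fastforce
  have shift: "qpoch_inf (a * of_real q ^ n) q = (\<Prod>k. ?f (k + n))"
    by (simp add: qpoch_inf_def power_add mult_ac)
  have "qpoch_inf a q = qpoch a q n * qpoch_inf (a * of_real q ^ n) q"
  proof (cases "\<forall>k<n. ?f k \<noteq> 0")
    case True
    then show ?thesis
      using prodinf_split_initial_segment[OF conv, of n]
      unfolding shift by (simp add: qpoch_inf_def qpoch_def)
  next
    case False
    then obtain k where k: "k < n" "?f k = 0"
      by blast
    have "qpoch a q n = 0"
      unfolding qpoch_def using k by (intro prod_zero) auto
    moreover have "qpoch_inf a q = 0"
      unfolding qpoch_inf_def using k conv
      by (metis convergent_prod_has_prod has_prod_zeroI has_prod_unique)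
    ultimately show ?thesis
      by simp
  qed
  then show ?thesis
    using nz by simp
qed

definition theta_q :: "real \<Rightarrow> complex \<Rightarrow> complex" where
  "theta_q q \<tau> = qpoch_inf (of_real q) q * qpoch_inf (- \<tau>) q * qpoch_inf (- of_real q / \<tau>) q"

definition basic_hyp_term ::
    "complex list \<Rightarrow> complex list \<Rightarrow> real \<Rightarrow> complex \<Rightarrow> nat \<Rightarrow> complex" where
  "basic_hyp_term as bs q x n =
     (\<Prod>a\<leftarrow>as. qpoch a q n) / ((\<Prod>b\<leftarrow>bs. qpoch b q n) * qpoch (of_real q) q n)
     * ((-1) ^ n * of_real q ^ (n choose 2)) powi (1 + int (length bs) - int (length as))
     * x ^ n"

definition basic_hyp_series ::
    "complex list \<Rightarrow> complex list \<Rightarrow> real \<Rightarrow> complex \<Rightarrow> complex" where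
  "basic_hyp_series as bs q x = (\<Sum>n. basic_hyp_term as bs q x n)"

text \<open>
  For \<open>r = s + 1\<close> the series converges for \<open>|x| < 1\<close>, and its sum continues analytically to
  the connected open set \<open>\<complex> - {q\<^bsup>-k\<^esup> | k \<ge> 0}\<close>. This set contains the unit disc, so the
  continuation is uniquely determined on it. At the excluded points (in general poles) the
  value below is unspecified.
\<close>

definition basic_hyp_domain :: "real \<Rightarrow> complex set" where
  "basic_hyp_domain q = - range (\<lambda>k::nat. 1 / of_real q ^ k)"

definition basic_hyp ::
    "complex list \<Rightarrow> complex list \<Rightarrow> real \<Rightarrow> complex \<Rightarrow> complex" where
  "basic_hyp as bs q x =
     (if length as = length bs + 1 then
        (SOME f. f holomorphic_on basic_hyp_domain q \<and>
                 (\<forall>y. norm y < 1 \<longrightarrow> f y = basic_hyp_series as bs q y)) x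
      else basic_hyp_series as bs q x)"

text \<open>
  The argument \<open>l\<close> is the resummation direction \<open>\<lambda>\<close> (in Isabelle \<open>\<lambda>\<close> is reserved for abstraction).
\<close>

definition U_term ::
    "real \<Rightarrow> complex \<Rightarrow> complex \<Rightarrow> complex \<Rightarrow> complex \<Rightarrow> int \<Rightarrow> complex" where
  "U_term q l a b z n =
     basic_hyp [a, b] [0] q (- (of_real q powi n) * l) / theta_q q (of_real q powi n * l / z)"

definition U_q ::
    "real \<Rightarrow> complex \<Rightarrow> complex \<Rightarrow> complex \<Rightarrow> complex \<Rightarrow> complex" where
  "U_q q l a b z = (\<Sum>\<^sub>\<infinity>n\<in>UNIV. U_term q l a b z n)"

end

theory Submission
  imports Defs
begin

text \<open>
  Write \<open>x\<^sub>n = q\<^sup>n \<lambda>\<close>, let \<open>F(x)\<close> be the continuation of \<open>2phi1(a,b;0;q;-x)\<close>, and let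
  \<open>W\<^sub>z(x) = 1/\<theta>(x/z)\<close>, so that \<open>U(z)\<close> is the sum of \<open>F(x\<^sub>n) W\<^sub>z(x\<^sub>n)\<close> over all integers \<open>n\<close>. Heine's
  transformation gives \<open>F(x) = G(x)/(-x;q)\<^sub>\<infinity>\<close> with \<open>G\<close> entire (\<open>heine\<close>, \<open>basic_hyp_2phi1\<close>); this is
  the first formula, term by term.

  The weight satisfies \<open>W\<^sub>z(qx) = (x/z) W\<^sub>z(x)\<close>. Shifting the summation index therefore turns
  multiplication by \<open>z\<close> into the operator \<open>X: f(x) \<mapsto> x f(qx)\<close> acting on the summand, and replacing
  \<open>z\<close> by \<open>qz\<close> into \<open>f(x) \<mapsto> f(qx)\<close>. The next two formulas are pointwise expansions of \<open>F\<close> read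
  in this way:

  \<^item> \<open>F = (abX;q)\<^sub>\<infinity> H\<close> with \<open>H(x) = (-ax,-bx;q)\<^sub>\<infinity>/(-x;q)\<^sub>\<infinity>\<close> (\<open>G_symmetric_expansion\<close>) becomes the
    formula with the prefactor \<open>(abz;q)\<^sub>\<infinity>\<close>;
  \<^item> \<open>F(x) = (a;q)\<^sub>\<infinity> \<Sum> a\<^sup>k/(q;q)\<^sub>k h(q\<^sup>kx)\<close> with \<open>h(x) = (-bx;q)\<^sub>\<infinity>/(-x;q)\<^sub>\<infinity>\<close>
    (\<open>F_geometric_expansion\<close>) becomes the formula with the prefactor \<open>(a;q)\<^sub>\<infinity>\<close>.

  For the last formula and \<open>|a|, |b| < 1\<close>, the function \<open>F\<close> is a series of the fractions
  \<open>1/(1 + q\<^sup>m x)\<close>, so it suffices to resum \<open>1/(1 + x)\<close>. That yields an Appell--Lerch sum, whose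
  symmetry (\<open>lerch_symmetric\<close>) exchanges the poles in \<open>\<lambda>\<close> for poles in \<open>z\<close>. The symmetry follows from
  Jacobi's triple product, which in turn is the case \<open>b = 1\<close> of the formula with prefactor \<open>(a;q)\<^sub>\<infinity>\<close>.

  Interchanging the sums needs \<open>|a| < 1\<close> for the prefactor \<open>(a;q)\<^sub>\<infinity>\<close> and \<open>|a|, |b| < 1\<close> for the last
  formula. The theorem asserts the former for \<open>|aq| < 1\<close> and the latter for all \<open>a \<noteq> 0\<close>, off the excluded
  values of \<open>b\<close>, as soon as the right-hand side converges. The gap is closed by descent: a contiguous
  relation expresses \<open>U(a;z)\<close> through \<open>U(aq;z)\<close> and \<open>U(aq;qz)\<close> (\<open>U_contiguous\<close>), convergence for \<open>a\<close>
  implies convergence for \<open>aq\<close>, and the series obey the same relation (\<open>U_descent\<close>).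
\<close>

section \<open>Sums over naturals, integers and pairs\<close>

lemma summable_on_dominated:
  fixes f :: "'a \<Rightarrow> complex" and g :: "'a \<Rightarrow> real"
  assumes "g summable_on A" "\<And>x. x \<in> A \<Longrightarrow> norm (f x) \<le> g x"
  shows "f summable_on A"
  using Infinite_Sum.abs_summable_on_comparison_test'[OF assms] summable_on_iff_abs_summable_on_complex by blast

lemma summable_on_norm_complex:
  fixes f :: "'a \<Rightarrow> complex"
  assumes "f summable_on A"
  shows "(\<lambda>x. norm (f x)) summable_on A"
  using assms summable_on_iff_abs_summable_on_complex by blast

lemma summable_on_product_real:
  fixes u :: "'a \<Rightarrow> real" and v :: "'b \<Rightarrow> real"
  assumes u: "u summable_on A" "\<And>x. x \<in> A \<Longrightarrow> u x \<ge> 0"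
      and v: "v summable_on B" "\<And>x. x \<in> B \<Longrightarrow> v x \<ge> 0"
  shows "(\<lambda>(x, y). u x * v y) summable_on A \<times> B"
proof (rule summable_on_SigmaI)
  show "((\<lambda>y. case (x, y) of (x, y) \<Rightarrow> u x * v y) has_sum u x * infsum v B) B" for x
    using has_sum_cmult_right[OF has_sum_infsum[OF v(1)], of "u x"] by simp
  show "(\<lambda>x. u x * infsum v B) summable_on A"
    by (intro summable_on_cmult_left u(1))
qed (use u v in auto)

lemma summable_on_product_dominated:
  fixes f :: "'a \<Rightarrow> 'b \<Rightarrow> complex"
  assumes u: "u summable_on A" "\<And>x. x \<in> A \<Longrightarrow> u x \<ge> 0"
      and v: "v summable_on B" "\<And>x. x \<in> B \<Longrightarrow> v x \<ge> 0"
      and le: "\<And>x y. x \<in> A \<Longrightarrow> y \<in> B \<Longrightarrow> norm (f x y) \<le> u x * v y"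
  shows "(\<lambda>(x, y). f x y) summable_on A \<times> B"
  by (rule summable_on_dominated[OF summable_on_product_real[OF u v]]) (auto intro: le)

lemma infsum_triangle:
  fixes f :: "nat \<Rightarrow> nat \<Rightarrow> complex"
  assumes "(\<lambda>(i, k). f i k) summable_on UNIV \<times> UNIV"
  shows "(\<lambda>s. \<Sum>k\<le>s. f (s - k) k) summable_on UNIV"
    and "(\<Sum>\<^sub>\<infinity>s. \<Sum>k\<le>s. f (s - k) k) = (\<Sum>\<^sub>\<infinity>k. \<Sum>\<^sub>\<infinity>i. f i k)"
proof -
  let ?T = "Sigma (UNIV :: nat set) (\<lambda>s. {..s})"
  have bij: "bij_betw (\<lambda>(s, k). (s - k, k)) ?T (UNIV \<times> UNIV)"
    by (rule bij_betw_byWitness[where f' = "\<lambda>(i, k). (i + k, k)"]) auto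
  have sm: "(\<lambda>(s, k). f (s - k) k) summable_on ?T"
    using summable_on_reindex_bij_betw[OF bij, of "\<lambda>(i, k). f i k"] assms
    by (simp add: case_prod_unfold)
  show "(\<lambda>s. \<Sum>k\<le>s. f (s - k) k) summable_on UNIV"
    using summable_on_Sigma_banach[OF sm] by simp
  have "(\<Sum>\<^sub>\<infinity>s. \<Sum>k\<le>s. f (s - k) k) = (\<Sum>\<^sub>\<infinity>(s, k)\<in>?T. f (s - k) k)"
    using infsum_Sigma'_banach[OF sm] by simp
  also have "\<dots> = (\<Sum>\<^sub>\<infinity>(i, k)\<in>UNIV \<times> UNIV. f i k)"
    using infsum_reindex_bij_betw[OF bij, of "\<lambda>(i, k). f i k"] by (simp add: case_prod_unfold)
  also have "\<dots> = (\<Sum>\<^sub>\<infinity>i. \<Sum>\<^sub>\<infinity>k. f i k)"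
    using infsum_Sigma'_banach[OF assms] by simp
  also have "\<dots> = (\<Sum>\<^sub>\<infinity>k. \<Sum>\<^sub>\<infinity>i. f i k)"
    by (rule infsum_swap_banach[OF assms])
  finally show "(\<Sum>\<^sub>\<infinity>s. \<Sum>k\<le>s. f (s - k) k) = (\<Sum>\<^sub>\<infinity>k. \<Sum>\<^sub>\<infinity>i. f i k)" .
qed

lemma norm_summable_imp_infsum_nat:
  fixes f :: "nat \<Rightarrow> complex"
  assumes "summable (\<lambda>n. norm (f n))" "f sums S"
  shows "f summable_on UNIV" "infsum f UNIV = S"
  using norm_summable_imp_has_sum[OF assms] by (auto simp: has_sum_iff)

lemma summable_on_int:
  fixes f :: "int \<Rightarrow> 'a :: banach"
  assumes "(\<lambda>n. f (int n)) summable_on UNIV" "(\<lambda>n. f (- int n)) summable_on UNIV"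
  shows "f summable_on UNIV"
proof -
  have "f summable_on range int"
    using assms(1) by (subst summable_on_reindex) (auto simp: o_def)
  moreover from assms(2) have "f summable_on range (\<lambda>n. - int n)"
    using assms(2) by (subst summable_on_reindex) (auto simp: o_def inj_on_def)
  hence "f summable_on (range (\<lambda>n. - int n) - range int)"
    by (rule summable_on_subset_banach) auto
  ultimately have "f summable_on (range int \<union> (range (\<lambda>n. - int n) - range int))"
    by (intro summable_on_Un_disjoint) auto
  moreover have "range int \<union> (range (\<lambda>n. - int n) - range int) = UNIV"
  proof -
    have "n \<in> range int \<union> range (\<lambda>n. - int n)" for n :: int
      by (cases n rule: int_cases2) auto
    thus ?thesis by blast
  qed
  ultimately show ?thesis by simp
qed

lemma infsum_int_shift: "(\<Sum>\<^sub>\<infinity>n. f (n + m)) = (\<Sum>\<^sub>\<infinity>n::int. f n)"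
  by (rule infsum_reindex_bij_witness[of _ "\<lambda>n. n - m" "\<lambda>n. n + m"]) auto

lemma summable_on_int_shift:
  "(\<lambda>n. f (n + m)) summable_on UNIV \<longleftrightarrow> (f :: int \<Rightarrow> complex) summable_on UNIV"
  by (rule summable_on_reindex_bij_witness[of _ "\<lambda>n. n - m" "\<lambda>n. n + m"]) auto

text \<open>
  At most geometric growth towards \<open>-\<infinity>\<close>, and boundedness towards \<open>+\<infinity>\<close>. Both survive products,
  sums and right shifts, and the Gaussian decay of the theta weight beats them.
\<close>

definition left_geometric :: "(int \<Rightarrow> complex) \<Rightarrow> bool" where
  "left_geometric f \<longleftrightarrow> (\<exists>C R. C \<ge> 0 \<and> R \<ge> 1 \<and> (\<forall>n. norm (f n) \<le> C * R ^ nat (- n)))"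

lemma left_geometricI:
  assumes "C \<ge> 0" "R \<ge> 1" "\<And>n. norm (f n) \<le> C * R ^ nat (- n)"
  shows "left_geometric f"
  using assms unfolding left_geometric_def by blast

lemma left_geometricE:
  assumes "left_geometric f"
  obtains C R where "C \<ge> 0" "R \<ge> 1" "\<And>n. norm (f n) \<le> C * R ^ nat (- n)"
  using assms unfolding left_geometric_def by blast

lemma left_geometric_mono:
  fixes R :: real
  assumes "C \<ge> 0" "R \<ge> 1" "norm (x :: complex) \<le> C * R ^ nat (- n)" "C \<le> D" "R \<le> S" "m \<le> n"
  shows "norm x \<le> D * S ^ nat (- m)"
proof -
  have "R ^ nat (- n) \<le> S ^ nat (- n)" using assms by (intro power_mono) auto
  also have "\<dots> \<le> S ^ nat (- m)" using assms by (intro power_increasing) auto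
  finally have "C * R ^ nat (- n) \<le> D * S ^ nat (- m)" using assms by (intro mult_mono) auto
  thus ?thesis using assms(3) by linarith
qed

lemma left_geometric_const: "left_geometric (\<lambda>_. c)"
  by (rule left_geometricI[of "norm c" 1]) auto

lemma left_geometric_add:
  assumes "left_geometric f" "left_geometric g" shows "left_geometric (\<lambda>n. f n + g n)"
proof -
  obtain C R where 1: "C \<ge> 0" "R \<ge> 1" "\<And>n. norm (f n) \<le> C * R ^ nat (- n)"
    using left_geometricE[OF assms(1)] by metis
  obtain D S where 2: "D \<ge> 0" "S \<ge> 1" "\<And>n. norm (g n) \<le> D * S ^ nat (- n)"
    using left_geometricE[OF assms(2)] by metis
  show ?thesis
  proof (rule left_geometricI[of "C + D" "max R S"])
    fix n
    have "norm (f n) \<le> C * max R S ^ nat (- n)" "norm (g n) \<le> D * max R S ^ nat (- n)"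
      using left_geometric_mono[OF 1] left_geometric_mono[OF 2] by auto
    thus "norm (f n + g n) \<le> (C + D) * max R S ^ nat (- n)"
      unfolding distrib_right by (rule norm_triangle_mono)
  qed (use 1 2 in auto)
qed

lemma left_geometric_mult:
  assumes "left_geometric f" "left_geometric g" shows "left_geometric (\<lambda>n. f n * g n)"
proof -
  obtain C R where 1: "C \<ge> 0" "R \<ge> 1" "\<And>n. norm (f n) \<le> C * R ^ nat (- n)"
    using left_geometricE[OF assms(1)] by metis
  obtain D S where 2: "D \<ge> 0" "S \<ge> 1" "\<And>n. norm (g n) \<le> D * S ^ nat (- n)"
    using left_geometricE[OF assms(2)] by metis
  show ?thesis
  proof (rule left_geometricI[of "C * D" "R * S"])
    fix n
    have "norm (f n) * norm (g n) \<le> (C * R ^ nat (- n)) * (D * S ^ nat (- n))"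
      using 1 2 by (intro mult_mono) auto
    thus "norm (f n * g n) \<le> C * D * (R * S) ^ nat (- n)"
      by (simp add: norm_mult power_mult_distrib mult_ac)
    have "1 * 1 \<le> R * S" using 1 2 by (intro mult_mono) auto
    thus "1 \<le> R * S" by simp
  qed (use 1 2 in auto)
qed

lemma left_geometric_shift:
  assumes "left_geometric f" shows "left_geometric (\<lambda>n. f (n + int k))"
proof -
  obtain C R where 1: "C \<ge> 0" "R \<ge> 1" "\<And>n. norm (f n) \<le> C * R ^ nat (- n)"
    using left_geometricE[OF assms(1)] by metis
  show ?thesis
    by (rule left_geometricI[of C R]) (use left_geometric_mono[OF 1] 1 in auto)
qed

text \<open>
  The shear \<open>(n,k) \<mapsto> (n + k, k)\<close> of \<open>\<int> \<times> \<nat>\<close> is how index shifts in a bilateral sum are combined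
  with the power series expansion of a factor.
\<close>

lemma summable_on_double_shift:
  fixes f :: "int \<Rightarrow> nat \<Rightarrow> complex"
  shows "(\<lambda>(n, k). f (n + int k) k) summable_on UNIV \<times> UNIV \<longleftrightarrow> (\<lambda>(n, k). f n k) summable_on UNIV \<times> UNIV"
  by (rule summable_on_reindex_bij_witness[of _ "\<lambda>(n, k). (n - int k, k)" "\<lambda>(n, k). (n + int k, k)"]) auto

lemma has_sum_diff_complex:
  fixes f g :: "'a \<Rightarrow> complex"
  assumes "(f has_sum a) A" "(g has_sum b) A"
  shows "((\<lambda>x. f x - g x) has_sum (a - b)) A"
  using has_sum_add[OF assms(1) has_sum_uminusI[OF assms(2)]] by simp

lemma summable_on_diff_complex:
  fixes f g :: "'a \<Rightarrow> complex"
  assumes "f summable_on A" "g summable_on A"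
  shows "(\<lambda>x. f x - g x) summable_on A"
  using has_sum_diff_complex[OF has_sum_infsum[OF assms(1)] has_sum_infsum[OF assms(2)]]
  by (rule has_sum_imp_summable)

lemma infsum_diff_complex:
  fixes f g :: "'a \<Rightarrow> complex"
  assumes "f summable_on A" "g summable_on A"
  shows "(\<Sum>\<^sub>\<infinity>x\<in>A. f x - g x) = infsum f A - infsum g A"
  using has_sum_diff_complex[OF has_sum_infsum[OF assms(1)] has_sum_infsum[OF assms(2)]]
  by (rule infsumI)

lemma infsum_double_shift:
  fixes f :: "int \<Rightarrow> nat \<Rightarrow> complex"
  assumes "(\<lambda>(n, k). f n k) summable_on UNIV \<times> UNIV"
  shows "(\<Sum>\<^sub>\<infinity>n. \<Sum>\<^sub>\<infinity>k. f (n + int k) k) = (\<Sum>\<^sub>\<infinity>n. \<Sum>\<^sub>\<infinity>k. f n k)"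
proof -
  have "(\<Sum>\<^sub>\<infinity>n. \<Sum>\<^sub>\<infinity>k. f (n + int k) k) = (\<Sum>\<^sub>\<infinity>(n, k)\<in>UNIV \<times> UNIV. f (n + int k) k)"
    by (rule infsum_Sigma'_banach) (use assms summable_on_double_shift in blast)
  also have "\<dots> = (\<Sum>\<^sub>\<infinity>(n, k)\<in>UNIV \<times> UNIV. f n k)"
    by (rule infsum_reindex_bij_witness[of _ "\<lambda>(n, k). (n - int k, k)" "\<lambda>(n, k). (n + int k, k)"]) auto
  also have "\<dots> = (\<Sum>\<^sub>\<infinity>n. \<Sum>\<^sub>\<infinity>k. f n k)"
    by (rule infsum_Sigma'_banach[symmetric]) (use assms in auto)
  finally show ?thesis .
qed

lemma has_sum_nat_shift:
  fixes f :: "nat \<Rightarrow> complex"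
  assumes "(f has_sum S) UNIV"
  shows "((\<lambda>j. f (Suc j)) has_sum (S - f 0)) UNIV"
proof -
  have "(f has_sum (S - f 0)) (range Suc)"
  proof -
    have "(f has_sum (S - f 0)) (UNIV - {0})"
      using has_sum_finite[of "{0}" f] by (intro has_sum_Diff[OF assms]) auto
    moreover have "UNIV - {0} = range Suc" by (auto simp: image_iff) (metis not0_implies_Suc)
    ultimately show ?thesis by simp
  qed
  thus ?thesis by (subst (asm) has_sum_reindex) (auto simp: o_def)
qed

text \<open>
  Contiguous relations compare one series with another one whose index is shifted by one.
\<close>

lemma has_sum_nat_Suc_shift:
  fixes f g r :: "nat \<Rightarrow> complex"
  assumes f: "(f has_sum A) UNIV" and g: "(g has_sum B) UNIV" and r: "(r has_sum C) UNIV"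
    and zero: "f 0 = g 0" and step: "\<And>j. f (Suc j) = g (Suc j) - r j"
  shows "A = B - C"
proof -
  have "((\<lambda>j. f (Suc j)) has_sum (A - f 0)) UNIV" by (rule has_sum_nat_shift[OF f])
  moreover have "((\<lambda>j. g (Suc j) - r j) has_sum (B - g 0 - C)) UNIV"
    by (intro has_sum_diff_complex has_sum_nat_shift g r)
  ultimately have "A - f 0 = B - g 0 - C" using has_sum_unique unfolding step by blast
  thus ?thesis using zero by simp
qed

lemma infsum_eq_suminf:
  fixes f :: "nat \<Rightarrow> complex"
  assumes "f summable_on UNIV" shows "infsum f UNIV = suminf f"
  using has_sum_imp_sums[OF has_sum_infsum[OF assms]] by (rule sums_unique)

lemma holomorphic_on_entire_series:
  fixes f :: "nat \<Rightarrow> complex \<Rightarrow> complex"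
  assumes hol: "\<And>n. f n holomorphic_on UNIV"
    and bd: "\<And>R. \<exists>M. summable M \<and> (\<forall>n x. norm x \<le> R \<longrightarrow> norm (f n x) \<le> M n)"
  shows "(\<lambda>x. \<Sum>n. f n x) holomorphic_on UNIV"
proof (rule holomorphic_uniform_sequence[where f = "\<lambda>N x. \<Sum>n<N. f n x"])
  fix x :: complex
  obtain M where M: "summable M" "\<And>n y. norm y \<le> norm x + 1 \<Longrightarrow> norm (f n y) \<le> M n"
    using bd by blast
  have "norm y \<le> norm x + 1" if "y \<in> cball x 1" for y
    using that norm_triangle_sub[of y x] by (simp add: dist_norm norm_minus_commute)
  hence "uniform_limit (cball x 1) (\<lambda>N x. \<Sum>n<N. f n x) (\<lambda>x. \<Sum>n. f n x) sequentially"
    by (intro Weierstrass_m_test[OF M(2) M(1)]) auto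
  thus "\<exists>d>0. cball x d \<subseteq> UNIV \<and> uniform_limit (cball x d) (\<lambda>N x. \<Sum>n<N. f n x) (\<lambda>x. \<Sum>n. f n x) sequentially"
    by (intro exI[of _ 1]) auto
qed (auto intro!: holomorphic_intros hol)

lemma isCont_power_series_0:
  fixes c :: "nat \<Rightarrow> complex"
  assumes "r > 0" "\<And>y. norm y < r \<Longrightarrow> summable (\<lambda>n. c n * y ^ n)"
  shows "isCont (\<lambda>y. \<Sum>n. c n * y ^ n) 0"
proof -
  have "summable (\<lambda>n. c n * (of_real (r/2)) ^ n)" using assms by (intro assms(2)) auto
  thus ?thesis by (rule isCont_powser) (use assms in auto)
qed

section \<open>Shifted factorials\<close>

locale q_base =
  fixes q :: real
  assumes q_pos: "0 < q" and q_lt_1: "q < 1"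
begin

abbreviation Q :: complex where "Q \<equiv> of_real q"
abbreviation pinf :: "complex \<Rightarrow> complex" where "pinf a \<equiv> qpoch_inf a q"
abbreviation pfin :: "complex \<Rightarrow> nat \<Rightarrow> complex" where "pfin a n \<equiv> qpoch a q n"

lemma Q_nz [simp]: "Q \<noteq> 0" using q_pos by simp
lemma norm_Q [simp]: "norm Q = q" using q_pos by simp
lemma Q_pow_ne_1: "Q ^ Suc n \<noteq> 1"
proof
  assume "Q ^ Suc n = 1"
  hence "norm (Q ^ Suc n) = 1" by (metis norm_one)
  hence "q ^ Suc n = 1" by (metis norm_Q norm_power)
  moreover have "q ^ Suc n < 1"
    using q_pos q_lt_1 power_Suc_less_one by blast
  ultimately show False by simp
qed

lemma q_pow_le_1: "q ^ n \<le> 1" using q_pos q_lt_1 by (simp add: power_le_one)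

lemma norm_mult_Q_pow_le: "norm (x * Q ^ k) \<le> norm x"
  using q_pow_le_1[of k] q_pos by (simp add: norm_mult norm_power mult_left_le)

lemma q_pow_LIMSEQ: "(\<lambda>n. Q ^ n) \<longlonglongrightarrow> 0"
  using q_pos q_lt_1 by (intro LIMSEQ_power_zero) simp

lemma exists_small_power: "\<exists>N. norm (a * Q ^ N) < 1"
proof -
  have "(\<lambda>N. norm (a * Q ^ N)) \<longlonglongrightarrow> norm (a * 0)" by (intro tendsto_intros q_pow_LIMSEQ)
  hence "eventually (\<lambda>N. norm (a * Q ^ N) < 1) sequentially" by (intro order_tendstoD) auto
  thus ?thesis by (auto simp: eventually_sequentially)
qed

lemma pfin_0 [simp]: "pfin a 0 = 1" by (simp add: qpoch_def)
lemma pfin_Suc: "pfin a (Suc n) = pfin a n * (1 - a * Q ^ n)" by (simp add: qpoch_def)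
lemma pfin_Suc_left: "pfin a (Suc n) = (1 - a) * pfin (a * Q) n"
  by (simp add: qpoch_def prod.lessThan_Suc_shift mult_ac del: prod.lessThan_Suc)
lemma pfin_add: "pfin a (m + n) = pfin a m * pfin (a * Q ^ m) n"
  by (induction n) (simp_all add: pfin_Suc power_add mult_ac)
lemma pfin_zero [simp]: "pfin 0 n = 1" by (simp add: qpoch_def)

lemma pfin_Q_nz [simp]: "pfin Q n \<noteq> 0"
  unfolding qpoch_def using Q_pow_ne_1 by (auto simp: prod_zero_iff)

lemma convergent_prod_pinf: "convergent_prod (\<lambda>k. 1 - a * Q ^ k)"
proof -
  have "summable (\<lambda>k. norm (- a) * q ^ k)"
    using q_pos q_lt_1 by (intro summable_mult summable_geometric) auto
  then have "summable (\<lambda>k. norm (- a * Q ^ k))"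
    using q_pos by (simp add: norm_mult norm_power)
  then have "abs_convergent_prod (\<lambda>k. 1 + (- a * Q ^ k))"
    by (intro summable_imp_abs_convergent_prod) simp
  then show ?thesis
    using abs_convergent_prod_imp_convergent_prod by fastforce
qed

lemma pfin_LIMSEQ: "(\<lambda>n. pfin a n) \<longlonglongrightarrow> pinf a"
  using convergent_prod_LIMSEQ[OF convergent_prod_pinf[of a]]
  unfolding qpoch_def qpoch_inf_def by (simp add: LIMSEQ_lessThan_iff_atMost)

lemma pinf_split: "pinf a = pfin a n * pinf (a * Q ^ n)"
proof -
  have "(\<lambda>m. pfin a (m + n)) \<longlonglongrightarrow> pinf a"
    by (rule LIMSEQ_ignore_initial_segment[OF pfin_LIMSEQ])
  moreover have "(\<lambda>m. pfin a (m + n)) \<longlonglongrightarrow> pfin a n * pinf (a * Q ^ n)"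
    unfolding add.commute[of _ n] pfin_add by (intro tendsto_intros pfin_LIMSEQ)
  ultimately show ?thesis by (rule LIMSEQ_unique)
qed

lemma pinf_step: "pinf a = (1 - a) * pinf (a * Q)"
  using pinf_split[of a 1] by (simp add: qpoch_def)

lemma pinf_eq_0_iff: "pinf a = 0 \<longleftrightarrow> (\<exists>k. a * Q ^ k = 1)"
proof
  assume "pinf a = 0"
  hence "(\<lambda>k. 1 - a * Q ^ k) has_prod 0"
    using convergent_prod_has_prod[OF convergent_prod_pinf[of a]] by (simp add: qpoch_inf_def)
  thus "\<exists>k. a * Q ^ k = 1" by (auto simp: has_prod_0_iff)
next
  assume "\<exists>k. a * Q ^ k = 1"
  then obtain k where "a * Q ^ k = 1" by blast
  thus "pinf a = 0"
    using pinf_split[of a "Suc k"] by (simp add: pfin_Suc)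
qed

lemma pinf_zero [simp]: "pinf 0 = 1" using pfin_LIMSEQ[of 0] by (simp add: LIMSEQ_const_iff)

lemma pinf_nz_small:
  assumes "norm a < 1" shows "pinf a \<noteq> 0"
proof
  assume "pinf a = 0"
  then obtain k where "a * Q ^ k = 1" by (auto simp: pinf_eq_0_iff)
  thus False using norm_mult_Q_pow_le[of a k] assms by simp
qed

lemma pinf_Q_nz [simp]: "pinf Q \<noteq> 0" by (rule pinf_nz_small) (use q_pos q_lt_1 in simp)

lemma pfin_bounded: "\<exists>C>0. \<forall>n. norm (pfin a n) \<le> C"
  using convergent_imp_Bseq[OF convergentI[OF pfin_LIMSEQ[of a]]] by (auto simp: Bseq_def)

lemma pfin_Q_inverse_bounded: "\<exists>C>0. \<forall>n. norm (1 / pfin Q n) \<le> C"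
proof -
  have "(\<lambda>n. 1 / pfin Q n) \<longlonglongrightarrow> 1 / pinf Q"
    by (intro tendsto_intros pfin_LIMSEQ) simp
  hence "Bseq (\<lambda>n. 1 / pfin Q n)" by (intro convergent_imp_Bseq convergentI)
  thus ?thesis by (auto simp: Bseq_def)
qed

text \<open>
  A first order \<open>q\<close>-difference equation with linear coefficients determines its solution from
  the value at the origin. The sequence \<open>u\<close> holds the values of the solution at \<open>y q\<^sup>n\<close>.
\<close>

lemma first_order_q_difference:
  assumes rec: "\<And>n. (1 - c * Q ^ n) * u n = (1 - b * Q ^ n) * u (Suc n)"
    and lim: "u \<longlonglongrightarrow> L"
  shows "pinf c * u 0 = pinf b * L"
proof -
  have *: "pfin c n * u 0 = pfin b n * u n" for n
  proof (induction n)
    case (Suc n)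
    have "pfin c (Suc n) * u 0 = (1 - c * Q ^ n) * (pfin c n * u 0)" by (simp add: pfin_Suc)
    also have "\<dots> = pfin b n * ((1 - c * Q ^ n) * u n)" by (simp add: Suc)
    also have "\<dots> = pfin b (Suc n) * u (Suc n)" unfolding rec by (simp add: pfin_Suc)
    finally show ?case .
  qed auto
  have "(\<lambda>n. pfin c n * u 0) \<longlonglongrightarrow> pinf c * u 0" by (intro tendsto_intros pfin_LIMSEQ)
  moreover have "(\<lambda>n. pfin c n * u 0) \<longlonglongrightarrow> pinf b * L"
    unfolding * by (intro tendsto_intros pfin_LIMSEQ lim)
  ultimately show ?thesis by (rule LIMSEQ_unique)
qed

subsection \<open>The expansions of Euler and of the binomial theorem\<close>

lemma zero_choose_two [simp]: "(0::nat) choose 2 = 0"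
  by (simp add: numeral_2_eq_2)

lemma choose_two_Suc: "Suc n choose 2 = (n choose 2) + n"
  by (simp add: numeral_2_eq_2)

lemma choose_two_add: "(i + k) choose 2 = (i choose 2) + (k choose 2) + i * k"
proof (induction i)
  case (Suc i)
  have "Suc i + k choose 2 = (i + k choose 2) + (i + k)"
    using choose_two_Suc[of "i + k"] by simp
  thus ?case using Suc choose_two_Suc[of i] by simp
qed (simp add: numeral_2_eq_2)

lemma summable_gauss:
  fixes r :: real
  shows "summable (\<lambda>n. q ^ (n choose 2) * r ^ n)"
proof -
  have "summable (\<lambda>n. norm (q ^ (n choose 2) * r ^ n))"
  proof (cases "r = 0")
    case False
    have lim: "(\<lambda>n. q ^ n * \<bar>r\<bar>) \<longlonglongrightarrow> 0 * \<bar>r\<bar>"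
      using q_pos q_lt_1 by (intro tendsto_intros LIMSEQ_power_zero) simp
    hence "eventually (\<lambda>n. q ^ n * \<bar>r\<bar> < 1/2) sequentially"
      by (intro order_tendstoD) auto
    then obtain N where N: "\<And>n. n \<ge> N \<Longrightarrow> q ^ n * \<bar>r\<bar> < 1/2"
      by (auto simp: eventually_sequentially)
    show ?thesis
    proof (rule summable_ratio_test[of "1/2" N])
      fix n assume "n \<ge> N"
      have "norm (q ^ (Suc n choose 2) * r ^ Suc n) =
        (q ^ n * \<bar>r\<bar>) * norm (q ^ (n choose 2) * r ^ n)"
        using q_pos by (simp add: choose_two_Suc power_add norm_mult norm_power mult_ac abs_mult power_abs)
      also have "\<dots> \<le> 1/2 * norm (q ^ (n choose 2) * r ^ n)"
        using N[OF \<open>n \<ge> N\<close>] by (intro mult_right_mono) auto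
      finally show "norm (norm (q ^ (Suc n choose 2) * r ^ Suc n)) \<le>
          1/2 * norm (norm (q ^ (n choose 2) * r ^ n))" by simp
    qed simp
  next
    case True
    have "(\<lambda>n. norm (q ^ (n choose 2) * r ^ n)) = (\<lambda>n. if n = 0 then 1 else 0)"
      using True by (auto simp: fun_eq_iff power_0_left)
    thus ?thesis by simp
  qed
  thus ?thesis by (rule summable_norm_cancel)
qed

lemma euler_summable: "summable (\<lambda>n. norm (Q ^ (n choose 2) * y ^ n / pfin Q n))"
proof -
  obtain C where C: "C > 0" "\<And>n. norm (1 / pfin Q n) \<le> C"
    using pfin_Q_inverse_bounded by blast
  show ?thesis
  proof (rule summable_comparison_test'[where g = "\<lambda>n. C * (q ^ (n choose 2) * norm y ^ n)"])
    show "summable (\<lambda>n. C * (q ^ (n choose 2) * norm y ^ n))"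
      by (intro summable_mult summable_gauss)
    fix n :: nat
    have "norm (Q ^ (n choose 2) * y ^ n / pfin Q n)
        = norm (1 / pfin Q n) * (q ^ (n choose 2) * norm y ^ n)"
      using q_pos by (simp add: norm_mult norm_divide norm_power)
    also have "\<dots> \<le> C * (q ^ (n choose 2) * norm y ^ n)"
      using C q_pos by (intro mult_right_mono) auto
    finally show "norm (norm (Q ^ (n choose 2) * y ^ n / pfin Q n)) \<le> C * (q ^ (n choose 2) * norm y ^ n)"
      by simp
  qed
qed

lemma power_series_along_q:
  fixes c :: "nat \<Rightarrow> complex"
  assumes "r > 0" "\<And>y. norm y < r \<Longrightarrow> summable (\<lambda>n. c n * y ^ n)"
  shows "(\<lambda>N. \<Sum>n. c n * (y * Q ^ N) ^ n) \<longlonglongrightarrow> c 0"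
proof -
  have "(\<lambda>N. y * Q ^ N) \<longlonglongrightarrow> y * 0" by (intro tendsto_intros q_pow_LIMSEQ)
  hence "(\<lambda>N. \<Sum>n. c n * (y * Q ^ N) ^ n) \<longlonglongrightarrow> (\<Sum>n. c n * 0 ^ n)"
    using isCont_tendsto_compose[OF isCont_power_series_0[OF assms]] by simp
  thus ?thesis by simp
qed

text \<open>
  The recurrence of the coefficients says that \<open>f(y) = \<Sum> c\<^sub>n y\<^sup>n\<close> satisfies
  \<open>(1 - Ay) f(y) = (1 - By) f(qy)\<close>. Euler's expansion (\<open>A = 0\<close>), the \<open>q\<close>-binomial theorem (\<open>A = 1\<close>) and
  the normalisation of a partial fraction expansion below (\<open>y = 1\<close>) are all of this form.
\<close>

lemma q_difference_power_series:
  assumes rec: "\<And>n. c (Suc n) * (1 - Q ^ Suc n) = c n * (A - B * Q ^ n)"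
    and sm: "summable (\<lambda>n. norm (c n * y ^ n))"
  shows "pinf (A * y) * (\<Sum>n. c n * y ^ n) = pinf (B * y) * c 0"
proof (cases "y = 0")
  case False
  define f where "f w = (\<Sum>n. c n * w ^ n)" for w
  have sm': "summable (\<lambda>n. c n * w ^ n)" if "norm w \<le> norm y" for w
  proof (rule summable_comparison_test'[OF sm])
    show "norm (c n * w ^ n) \<le> norm (c n * y ^ n)" for n
      using that by (simp add: norm_mult norm_power mult_left_mono power_mono)
  qed
  have sf: "(\<lambda>n. c n * w ^ n) sums f w" if "norm w \<le> norm y" for w
    unfolding f_def by (rule summable_sums[OF sm'[OF that]])
  have eq: "(1 - A * w) * f w = (1 - B * w) * f (w * Q)" if w: "norm w \<le> norm y" for w
  proof -
    have wQ: "norm (w * Q) \<le> norm y" using w norm_mult_Q_pow_le[of w 1] by simp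
    have step: "c (Suc n) * w ^ Suc n - c (Suc n) * (w * Q) ^ Suc n
        = A * w * (c n * w ^ n) - B * w * (c n * (w * Q) ^ n)" for n
    proof -
      have "c (Suc n) * w ^ Suc n - c (Suc n) * (w * Q) ^ Suc n = c (Suc n) * (1 - Q ^ Suc n) * w ^ Suc n"
        by (simp add: algebra_simps)
      also have "\<dots> = A * w * (c n * w ^ n) - B * w * (c n * (w * Q) ^ n)"
        unfolding rec by (simp add: algebra_simps)
      finally show ?thesis .
    qed
    have "(\<lambda>n. c n * w ^ n - c n * (w * Q) ^ n) sums (f w - f (w * Q))"
      by (intro sums_diff sf w wQ)
    hence "(\<lambda>n. c (Suc n) * w ^ Suc n - c (Suc n) * (w * Q) ^ Suc n) sums (f w - f (w * Q))"
      using sums_Suc_iff[of "\<lambda>n. c n * w ^ n - c n * (w * Q) ^ n" "f w - f (w * Q)"] by simp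
    hence "(\<lambda>n. A * w * (c n * w ^ n) - B * w * (c n * (w * Q) ^ n)) sums (f w - f (w * Q))"
      unfolding step .
    moreover have "(\<lambda>n. A * w * (c n * w ^ n) - B * w * (c n * (w * Q) ^ n)) sums
        (A * w * f w - B * w * f (w * Q))"
      by (intro sums_mult sums_diff sf w wQ)
    ultimately have "f w - f (w * Q) = A * w * f w - B * w * f (w * Q)" by (rule sums_unique2)
    thus ?thesis by (simp add: algebra_simps)
  qed
  have lim: "(\<lambda>N. f (y * Q ^ N)) \<longlonglongrightarrow> c 0"
    unfolding f_def using False by (intro power_series_along_q[of "norm y"] sm') auto
  have "pinf (A * y) * f (y * Q ^ 0) = pinf (B * y) * c 0"
  proof (rule first_order_q_difference[OF _ lim])
    fix n show "(1 - A * y * Q ^ n) * f (y * Q ^ n) = (1 - B * y * Q ^ n) * f (y * Q ^ Suc n)"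
      using eq[OF norm_mult_Q_pow_le[of y n]] by (simp add: mult_ac)
  qed
  thus ?thesis by (simp add: f_def)
qed simp

lemma euler_sums: "(\<lambda>n. Q ^ (n choose 2) * y ^ n / pfin Q n) sums pinf (- y)"
proof -
  define c where "c n = Q ^ (n choose 2) / pfin Q n" for n
  have sm: "summable (\<lambda>n. norm (c n * y ^ n))" using euler_summable[of y] by (simp add: c_def)
  have "pinf (0 * y) * (\<Sum>n. c n * y ^ n) = pinf (- 1 * y) * c 0"
  proof (rule q_difference_power_series[OF _ sm])
    show "c (Suc n) * (1 - Q ^ Suc n) = c n * (0 - - 1 * Q ^ n)" for n
      using Q_pow_ne_1[of n] by (simp add: c_def pfin_Suc choose_two_Suc power_add)
  qed
  hence "(\<Sum>n. c n * y ^ n) = pinf (- y)" by (simp add: c_def)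
  with summable_sums[OF summable_norm_cancel[OF sm]] show ?thesis by (simp add: c_def)
qed

lemma binomial_summable:
  assumes "norm y < 1"
  shows "summable (\<lambda>n. norm (pfin b n / pfin Q n * y ^ n))"
proof -
  obtain C where C: "C > 0" "\<And>n. norm (1 / pfin Q n) \<le> C"
    using pfin_Q_inverse_bounded by blast
  obtain D where D: "D > 0" "\<And>n. norm (pfin b n) \<le> D"
    using pfin_bounded by blast
  show ?thesis
  proof (rule summable_comparison_test'[where g = "\<lambda>n. D * C * norm y ^ n"])
    show "summable (\<lambda>n. D * C * norm y ^ n)"
      using assms by (intro summable_mult summable_geometric) auto
    fix n :: nat
    have "norm (pfin b n / pfin Q n * y ^ n) = norm (pfin b n) * norm (1 / pfin Q n) * norm y ^ n"
      by (simp add: norm_mult norm_divide norm_power)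
    also have "\<dots> \<le> D * C * norm y ^ n"
      using C D by (intro mult_right_mono mult_mono) (auto intro: less_imp_le)
    finally show "norm (norm (pfin b n / pfin Q n * y ^ n)) \<le> D * C * norm y ^ n" by simp
  qed
qed

lemma binomial_sums:
  assumes y: "norm y < 1"
  shows "(\<lambda>n. pfin b n / pfin Q n * y ^ n) sums (pinf (b * y) / pinf y)"
proof -
  define c where "c n = pfin b n / pfin Q n" for n
  have sm: "summable (\<lambda>n. norm (c n * y ^ n))" using binomial_summable[OF y] by (simp add: c_def)
  have "pinf (1 * y) * (\<Sum>n. c n * y ^ n) = pinf (b * y) * c 0"
  proof (rule q_difference_power_series[OF _ sm])
    show "c (Suc n) * (1 - Q ^ Suc n) = c n * (1 - b * Q ^ n)" for n
      using Q_pow_ne_1[of n] by (simp add: c_def pfin_Suc)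
  qed
  hence "(\<Sum>n. c n * y ^ n) = pinf (b * y) / pinf y"
    using pinf_nz_small[OF y] by (simp add: c_def field_simps)
  with summable_sums[OF summable_norm_cancel[OF sm]] show ?thesis by (simp add: c_def)
qed

lemmas euler_infsum = norm_summable_imp_infsum_nat[OF euler_summable euler_sums]
lemmas binomial_infsum = norm_summable_imp_infsum_nat[OF binomial_summable binomial_sums]

section \<open>The entire numerator of the Heine series\<close>

text \<open>
  A form of the \<open>q\<close>-Vandermonde sum. With \<open>P\<^sub>s(b)\<close> the left-hand side times \<open>(q;q)\<^sub>s\<close>, the Pascal rule for
  Gaussian binomial coefficients pairs neighbouring terms so that \<open>P\<^sub>s\<^sub>+\<^sub>1(b) = (1 - b) P\<^sub>s(bq)\<close>.
\<close>

lemma finite_gauss_sum: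
  "(\<Sum>k\<le>s. Q ^ (k choose 2) * (- b) ^ k * pfin (- x) k * pfin (- (b * x * Q ^ k)) (s - k)
       / (pfin Q k * pfin Q (s - k))) = pfin b s / pfin Q s"
proof (induction s arbitrary: b)
  case (Suc s b)
  \<comment> \<open>\<open>B\<close> is the Gaussian binomial coefficient, \<open>A\<close> its weight in the sum\<close>
  define B where "B s k = pfin Q s / (pfin Q k * pfin Q (s - k))" for s k :: nat
  define A where "A b s k = Q ^ (k choose 2) * (- b) ^ k * pfin (- x) k * pfin (- (b * x * Q ^ k)) (s - k)"
    for b s and k :: nat
  have IH: "(\<Sum>k\<le>s. B s k * A b s k) = pfin b s" for b
  proof -
    have "(\<Sum>k\<le>s. B s k * A b s k) = pfin Q s * (\<Sum>k\<le>s. A b s k / (pfin Q k * pfin Q (s - k)))"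
      unfolding sum_distrib_left B_def by (intro sum.cong) auto
    thus ?thesis using Suc[of b] by (simp add: A_def)
  qed
  have pascal: "B (Suc s) (Suc k) = Q ^ Suc k * B s (Suc k) + B s k" if "Suc k \<le> s" for k
  proof -
    obtain d where d: "s = Suc k + d" using le_Suc_ex[OF \<open>Suc k \<le> s\<close>] by blast
    have nz: "1 - Q * Q ^ d \<noteq> 0" "1 - Q * Q ^ k \<noteq> 0"
      using Q_pow_ne_1[of d] Q_pow_ne_1[of k] by auto
    have 1: "1 - Q * Q ^ s = Q ^ Suc k * (1 - Q * Q ^ d) + (1 - Q * Q ^ k)"
      by (simp add: d power_add algebra_simps)
    have "B (Suc s) (Suc k) = pfin Q s * (1 - Q * Q ^ s) / (pfin Q k * (1 - Q * Q ^ k) * (pfin Q d * (1 - Q * Q ^ d)))"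
      by (simp add: B_def d pfin_Suc)
    also have "\<dots> = pfin Q s * (Q ^ Suc k * (1 - Q * Q ^ d)) / (pfin Q k * (1 - Q * Q ^ k) * (pfin Q d * (1 - Q * Q ^ d)))
       + pfin Q s * (1 - Q * Q ^ k) / (pfin Q k * (1 - Q * Q ^ k) * (pfin Q d * (1 - Q * Q ^ d)))"
      unfolding 1 by (simp add: distrib_left add_divide_distrib)
    also have "pfin Q s * (Q ^ Suc k * (1 - Q * Q ^ d)) / (pfin Q k * (1 - Q * Q ^ k) * (pfin Q d * (1 - Q * Q ^ d)))
        = Q ^ Suc k * B s (Suc k)"
      using nz by (simp add: B_def d pfin_Suc mult_ac)
    also have "pfin Q s * (1 - Q * Q ^ k) / (pfin Q k * (1 - Q * Q ^ k) * (pfin Q d * (1 - Q * Q ^ d))) = B s k"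
      using nz by (simp add: B_def d pfin_Suc)
    finally show ?thesis .
  qed
  have B0: "B n 0 = 1" "B n n = 1" for n by (simp_all add: B_def)
  have shift1: "Q ^ k * A b (Suc s) k + A b (Suc s) (Suc k) = (1 - b) * A (b * Q) s k" if "k \<le> s" for k
  proof -
    obtain d where d: "s = k + d" using le_Suc_ex[OF \<open>k \<le> s\<close>] by blast
    have 1: "A b (Suc s) k = Q ^ (k choose 2) * (- b) ^ k * pfin (- x) k *
        ((1 + b * x * Q ^ k) * pfin (- (b * Q * x * Q ^ k)) d)"
      by (simp add: A_def d pfin_Suc_left mult_ac)
    have 2: "A b (Suc s) (Suc k) = Q ^ (k choose 2) * Q ^ k * ((- b) ^ k * (- b)) * (pfin (- x) k * (1 + x * Q ^ k))
         * pfin (- (b * Q * x * Q ^ k)) d"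
      by (simp add: A_def d pfin_Suc choose_two_Suc power_add mult_ac)
    have 3: "A (b * Q) s k = Q ^ (k choose 2) * ((- b) ^ k * Q ^ k) * pfin (- x) k * pfin (- (b * Q * x * Q ^ k)) d"
    proof -
      have "(- (b * Q)) ^ k = (- b) ^ k * Q ^ k" by (metis minus_mult_left power_mult_distrib)
      thus ?thesis by (simp add: A_def d)
    qed
    show ?thesis unfolding 1 2 3 by (simp add: algebra_simps)
  qed
  have "(\<Sum>k\<le>Suc s. B (Suc s) k * A b (Suc s) k)
      = A b (Suc s) 0 + (\<Sum>k<s. B (Suc s) (Suc k) * A b (Suc s) (Suc k)) + A b (Suc s) (Suc s)"
  proof -
    have "(\<Sum>k\<le>Suc s. B (Suc s) k * A b (Suc s) k) =
        (\<Sum>k\<le>s. B (Suc s) k * A b (Suc s) k) + A b (Suc s) (Suc s)" by (simp add: B0)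
    also have "{..s} = {..<Suc s}" by auto
    also have "(\<Sum>k<Suc s. B (Suc s) k * A b (Suc s) k) = A b (Suc s) 0 + (\<Sum>k<s. B (Suc s) (Suc k) * A b (Suc s) (Suc k))"
      by (simp add: sum.lessThan_Suc_shift B0 del: sum.lessThan_Suc)
    finally show ?thesis .
  qed
  also have "(\<Sum>k<s. B (Suc s) (Suc k) * A b (Suc s) (Suc k)) =
     (\<Sum>k<s. Q ^ Suc k * B s (Suc k) * A b (Suc s) (Suc k)) + (\<Sum>k<s. B s k * A b (Suc s) (Suc k))"
    unfolding sum.distrib[symmetric] by (intro sum.cong) (auto simp: pascal algebra_simps)
  also have "A b (Suc s) 0 + ((\<Sum>k<s. Q ^ Suc k * B s (Suc k) * A b (Suc s) (Suc k)) + (\<Sum>k<s. B s k * A b (Suc s) (Suc k))) + A b (Suc s) (Suc s)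
    = (\<Sum>k<Suc s. Q ^ k * B s k * A b (Suc s) k) + (\<Sum>k<Suc s. B s k * A b (Suc s) (Suc k))"
    by (subst (1) sum.lessThan_Suc_shift) (simp add: B0)
  also have "\<dots> = (\<Sum>k\<le>s. B s k * (Q ^ k * A b (Suc s) k + A b (Suc s) (Suc k)))"
    unfolding sum.distrib[symmetric] lessThan_Suc_atMost by (intro sum.cong) (auto simp: algebra_simps)
  also have "\<dots> = (\<Sum>k\<le>s. (1 - b) * (B s k * A (b * Q) s k))"
    by (intro sum.cong) (auto simp: shift1)
  also have "\<dots> = (1 - b) * pfin (b * Q) s"
    unfolding sum_distrib_left[symmetric] IH ..
  also have "\<dots> = pfin b (Suc s)" by (simp add: pfin_Suc_left)
  finally have "(\<Sum>k\<le>Suc s. B (Suc s) k * A b (Suc s) k) = pfin b (Suc s)" .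
  moreover have "(\<Sum>k\<le>Suc s. B (Suc s) k * A b (Suc s) k) =
     pfin Q (Suc s) * (\<Sum>k\<le>Suc s. A b (Suc s) k / (pfin Q k * pfin Q (Suc s - k)))"
    unfolding sum_distrib_left B_def by (intro sum.cong) auto
  ultimately have "pfin Q (Suc s) * (\<Sum>k\<le>Suc s. A b (Suc s) k / (pfin Q k * pfin Q (Suc s - k))) = pfin b (Suc s)"
    by metis
  hence "(\<Sum>k\<le>Suc s. A b (Suc s) k / (pfin Q k * pfin Q (Suc s - k))) = pfin b (Suc s) / pfin Q (Suc s)"
    by (simp add: eq_divide_eq mult.commute)
  thus ?case by (simp add: A_def)
qed simp

text \<open>
  The case \<open>x = 0\<close>: the finite \<open>q\<close>-binomial theorem.
\<close>

corollary finite_binomial: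
  "(\<Sum>k\<le>s. Q ^ (k choose 2) * (- a) ^ k / (pfin Q k * pfin Q (s - k))) = pfin a s / pfin Q s"
  using finite_gauss_sum[of a 0 s] by simp

subsection \<open>Bounds for infinite products and for the numerator\<close>

lemma pinf_bounded: "\<exists>C>0. \<forall>y. norm y \<le> R \<longrightarrow> norm (pinf y) \<le> C"
proof -
  let ?C = "\<Sum>n. norm (Q ^ (n choose 2) * (of_real \<bar>R\<bar>) ^ n / pfin Q n)"
  have "norm (pinf y) \<le> ?C" if "norm y \<le> R" for y
  proof -
    have eq: "pinf y = (\<Sum>n. Q ^ (n choose 2) * (- y) ^ n / pfin Q n)"
      using sums_unique[OF euler_sums[of "- y"]] by simp
    have "norm (pinf y) \<le> (\<Sum>n. norm (Q ^ (n choose 2) * (- y) ^ n / pfin Q n))"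
      unfolding eq by (rule summable_norm[OF euler_summable])
    also have "\<dots> \<le> ?C"
    proof (intro suminf_le euler_summable)
      fix n
      have "norm y ^ n \<le> \<bar>R\<bar> ^ n" using that by (intro power_mono) auto
      thus "norm (Q ^ (n choose 2) * (- y) ^ n / pfin Q n)
         \<le> norm (Q ^ (n choose 2) * (of_real \<bar>R\<bar>) ^ n / pfin Q n)"
        using q_pos by (simp add: norm_mult norm_divide norm_power divide_right_mono mult_left_mono)
    qed
    finally show ?thesis .
  qed
  moreover have "?C \<le> \<bar>?C\<bar> + 1" "\<bar>?C\<bar> + 1 > 0" by linarith+
  ultimately show ?thesis by (meson order_trans)
qed

lemma pinf_orbit_bounded: "\<exists>C>0. \<forall>n. norm (pinf (y * Q ^ n)) \<le> C"
proof -
  obtain C where "C > 0" "\<And>w. norm w \<le> norm y \<Longrightarrow> norm (pinf w) \<le> C"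
    using pinf_bounded by blast
  with norm_mult_Q_pow_le[of y] show ?thesis by blast
qed

lemma summable_gauss_on:
  assumes "r \<ge> 0" shows "(\<lambda>n. q ^ (n choose 2) * r ^ n) summable_on UNIV"
  using summable_gauss[of r] assms q_pos
  by (subst summable_on_UNIV_nonneg_real_iff) auto

lemma summable_geometric_on:
  assumes "0 \<le> r" "r < 1" shows "(\<lambda>n. r ^ n :: real) summable_on UNIV"
  using summable_geometric[of r] assms by (subst summable_on_UNIV_nonneg_real_iff) auto

text \<open>
  These are the terms of \<open>1phi1(b;-bx;q;-ax)\<close> multiplied by \<open>(-bx;q)\<^sub>\<infinity>\<close>, which cancels their poles in \<open>x\<close>.
\<close>

definition G_term :: "complex \<Rightarrow> complex \<Rightarrow> complex \<Rightarrow> nat \<Rightarrow> complex" where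
  "G_term a b x n = pfin b n / pfin Q n * Q ^ (n choose 2) * (a * x) ^ n * pinf (- b * x * Q ^ n)"

definition G :: "complex \<Rightarrow> complex \<Rightarrow> complex \<Rightarrow> complex" where
  "G a b x = (\<Sum>\<^sub>\<infinity>n. G_term a b x n)"

lemma G_term_bound:
  "\<exists>C>0. \<forall>x n. norm x \<le> R \<longrightarrow> norm (G_term a b x n) \<le> C * (q ^ (n choose 2) * (norm a * \<bar>R\<bar>) ^ n)"
proof -
  obtain C where C: "C > 0" "\<And>n. norm (1 / pfin Q n) \<le> C"
    using pfin_Q_inverse_bounded by blast
  obtain D where D: "D > 0" "\<And>n. norm (pfin b n) \<le> D"
    using pfin_bounded by blast
  obtain E where E: "E > 0" "\<And>w. norm w \<le> norm b * \<bar>R\<bar> \<Longrightarrow> norm (pinf w) \<le> E"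
    using pinf_bounded by blast
  have "norm (G_term a b x n) \<le> D * C * E * (q ^ (n choose 2) * (norm a * \<bar>R\<bar>) ^ n)" if x: "norm x \<le> R" for x n
  proof -
    have "norm (b * x * Q ^ n) \<le> norm b * \<bar>R\<bar> * 1"
      unfolding norm_mult norm_power norm_Q
      using x q_pow_le_1[of n] q_pos by (intro mult_mono) auto
    hence e: "norm (pinf (- b * x * Q ^ n)) \<le> E" by (intro E) simp
    have p: "norm (a * x) ^ n \<le> (norm a * \<bar>R\<bar>) ^ n"
      using x by (intro power_mono) (auto simp: norm_mult intro!: mult_left_mono)
    have "norm (G_term a b x n) = norm (pfin b n) * norm (1 / pfin Q n) * norm (pinf (- b * x * Q ^ n))
        * (q ^ (n choose 2) * norm (a * x) ^ n)"
      using q_pos by (simp add: G_term_def norm_mult norm_divide norm_power)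
    also have "\<dots> \<le> D * C * E * (q ^ (n choose 2) * (norm a * \<bar>R\<bar>) ^ n)"
      using C D e p q_pos E(1) by (intro mult_mono) (auto intro: less_imp_le)
    finally show ?thesis .
  qed
  thus ?thesis using C(1) D(1) E(1) by (intro exI[of _ "D * C * E"]) auto
qed

lemma G_term_summable: "G_term a b x summable_on UNIV"
proof -
  obtain C where C: "\<And>n. norm (G_term a b x n) \<le> C * (q ^ (n choose 2) * (norm a * \<bar>norm x\<bar>) ^ n)"
    using G_term_bound[of "norm x" a b] by blast
  show ?thesis
    by (rule summable_on_dominated[OF summable_on_cmult_right[OF summable_gauss_on] C]) auto
qed

subsection \<open>Heine's transformation\<close>

text \<open>
  Expand \<open>(a;q)\<^sub>n\<close> by the finite binomial theorem and sum over \<open>n - k\<close> first: each inner sum is a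
  \<open>q\<close>-binomial series.
\<close>

lemma heine:
  assumes x: "norm x < 1"
  shows "((\<lambda>n. pfin a n * pfin b n / pfin Q n * (- x) ^ n) has_sum (G a b x / pinf (- x))) UNIV"
proof -
  define f where "f i k = Q ^ (k choose 2) * (- a) ^ k / (pfin Q k * pfin Q i) * pfin b (i + k) * (- x) ^ (i + k)" for i k
  obtain C where C: "C > 0" "\<And>n. norm (1 / pfin Q n) \<le> C"
    using pfin_Q_inverse_bounded by blast
  obtain D where D: "D > 0" "\<And>n. norm (pfin b n) \<le> D"
    using pfin_bounded by blast
  have "(\<lambda>(i, k). f i k) summable_on UNIV \<times> UNIV"
  proof (rule summable_on_product_dominated)
    show "(\<lambda>i. D * C * norm x ^ i) summable_on UNIV"
      using x by (intro summable_on_cmult_right summable_geometric_on) auto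
    show "(\<lambda>k. C * (q ^ (k choose 2) * norm (a * x) ^ k)) summable_on UNIV"
      by (intro summable_on_cmult_right summable_gauss_on) auto
    show "norm (f i k) \<le> (D * C * norm x ^ i) * (C * (q ^ (k choose 2) * norm (a * x) ^ k))" for i k
    proof -
      have "norm (f i k) = norm (pfin b (i + k)) * norm (1 / pfin Q i) * norm (1 / pfin Q k) *
           (norm x ^ i * (q ^ (k choose 2) * norm (a * x) ^ k))"
        using q_pos by (simp add: f_def norm_mult norm_divide norm_power power_add power_mult_distrib mult_ac)
      also have "\<dots> \<le> D * C * C * (norm x ^ i * (q ^ (k choose 2) * norm (a * x) ^ k))"
        using C D q_pos by (intro mult_right_mono mult_mono) (auto intro: less_imp_le)
      finally show ?thesis by (simp add: mult_ac)
    qed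
  qed (use C D q_pos in auto)
  note sm = this
  have sum1: "(\<Sum>k\<le>s. f (s - k) k) = pfin a s * pfin b s / pfin Q s * (- x) ^ s" for s
  proof -
    have "(\<Sum>k\<le>s. f (s - k) k) = (\<Sum>k\<le>s. Q ^ (k choose 2) * (- a) ^ k / (pfin Q k * pfin Q (s - k))) * (pfin b s * (- x) ^ s)"
      unfolding sum_distrib_right by (intro sum.cong) (auto simp: f_def)
    thus ?thesis by (simp add: finite_binomial)
  qed
  have sum2: "(\<Sum>\<^sub>\<infinity>i. f i k) = G_term a b x k / pinf (- x)" for k
  proof -
    have "(\<Sum>\<^sub>\<infinity>i. f i k) = (\<Sum>\<^sub>\<infinity>i. (Q ^ (k choose 2) * (a * x) ^ k / pfin Q k * pfin b k) *
       (pfin (b * Q ^ k) i / pfin Q i * (- x) ^ i))"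
    proof (intro infsum_cong)
      fix i :: nat
      have "(- a) ^ k * (- x) ^ k = (a * x) ^ k" by (metis minus_mult_minus power_mult_distrib)
      thus "f i k = (Q ^ (k choose 2) * (a * x) ^ k / pfin Q k * pfin b k) * (pfin (b * Q ^ k) i / pfin Q i * (- x) ^ i)"
        by (simp add: f_def add.commute[of i] pfin_add power_add mult_ac)
    qed
    also have "\<dots> = (Q ^ (k choose 2) * (a * x) ^ k / pfin Q k * pfin b k) * (pinf (b * Q ^ k * (- x)) / pinf (- x))"
      unfolding infsum_cmult_right' using x by (subst binomial_infsum) auto
    finally show ?thesis by (simp add: G_term_def mult_ac)
  qed
  have "(\<lambda>s. pfin a s * pfin b s / pfin Q s * (- x) ^ s) summable_on UNIV"
    using infsum_triangle(1)[OF sm] unfolding sum1 .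
  moreover have "(\<Sum>\<^sub>\<infinity>s. pfin a s * pfin b s / pfin Q s * (- x) ^ s) = (\<Sum>\<^sub>\<infinity>k. G_term a b x k / pinf (- x))"
    using infsum_triangle(2)[OF sm] unfolding sum1 sum2 .
  moreover have "\<dots> = G a b x / pinf (- x)"
    unfolding G_def divide_inverse by (rule infsum_cmult_left')
  ultimately show ?thesis by (simp add: has_sum_iff)
qed

subsection \<open>A symmetric expansion\<close>

definition G_sym_term where
  "G_sym_term a b x k = Q ^ (k * (k - 1)) * (- a * b * x) ^ k * pfin (- x) k / pfin Q k
     * pinf (- a * x * Q ^ k) * pinf (- b * x * Q ^ k)"

lemma two_choose_two: "2 * (k choose 2) = k * (k - 1)"
proof (induction k)
  case (Suc k)
  thus ?case by (cases k) (simp_all add: choose_two_Suc)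
qed simp

text \<open>
  Expand \<open>(-axq\<^sup>k;q)\<^sub>\<infinity>\<close> by Euler and collect the powers of \<open>a\<close>; the coefficient of \<open>a\<^sup>s\<close> is evaluated by
  \<open>finite_gauss_sum\<close>, because \<open>(-bxq\<^sup>k;q)\<^sub>\<infinity> = (-bxq\<^sup>k;q)\<^sub>s\<^sub>-\<^sub>k (-bxq\<^sup>s;q)\<^sub>\<infinity>\<close>. The right-hand side is visibly
  symmetric in \<open>a\<close> and \<open>b\<close>, which the definition of \<open>G\<close> hides.
\<close>

lemma G_symmetric_expansion: "(G_sym_term a b x has_sum G a b x) UNIV"
proof -
  define f where "f i k = Q ^ ((i + k) choose 2) * (a * x) ^ (i + k) / (pfin Q i * pfin Q k)
     * (Q ^ (k choose 2) * (- b) ^ k * pfin (- x) k * pinf (- b * x * Q ^ k))" for i k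
  obtain C where C: "C > 0" "\<And>n. norm (1 / pfin Q n) \<le> C"
    using pfin_Q_inverse_bounded by blast
  obtain D where D: "D > 0" "\<And>n. norm (pfin (- x) n) \<le> D"
    using pfin_bounded by blast
  obtain E where E: "E > 0" "\<And>n. norm (pinf (- b * x * Q ^ n)) \<le> E"
    using pinf_orbit_bounded by blast
  have "(\<lambda>(i, k). f i k) summable_on UNIV \<times> UNIV"
  proof (rule summable_on_product_dominated)
    show "(\<lambda>i. C * C * D * E * (q ^ (i choose 2) * norm (a * x) ^ i)) summable_on UNIV"
      by (intro summable_on_cmult_right summable_gauss_on) auto
    show "(\<lambda>k. q ^ (k choose 2) * norm (a * x * b) ^ k) summable_on UNIV"
      by (intro summable_gauss_on) auto
    show "norm (f i k) \<le> (C * C * D * E * (q ^ (i choose 2) * norm (a * x) ^ i)) *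
            (q ^ (k choose 2) * norm (a * x * b) ^ k)" for i k
    proof -
      have "norm (f i k) = norm (1 / pfin Q i) * norm (1 / pfin Q k) * norm (pfin (- x) k) *
          norm (pinf (- b * x * Q ^ k)) * (q ^ ((i + k) choose 2) * q ^ (k choose 2)) *
            (norm (a * x) ^ i * norm (a * x * b) ^ k)"
        using q_pos by (simp add: f_def norm_mult norm_divide norm_power power_add power_mult_distrib)
      also have "\<dots> \<le> C * C * D * E * (q ^ (i choose 2) * q ^ (k choose 2)) *
            (norm (a * x) ^ i * norm (a * x * b) ^ k)"
      proof (intro mult_right_mono mult_mono)
        show "q ^ (i + k choose 2) \<le> q ^ (i choose 2)"
          using q_pos q_lt_1 by (intro power_decreasing) (auto simp: choose_two_add)
      qed (use C D E q_pos in \<open>auto intro: less_imp_le\<close>)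
      finally show ?thesis by (simp add: mult_ac)
    qed
  qed (use C D E q_pos in auto)
  note sm = this
  have sum1: "(\<Sum>k\<le>s. f (s - k) k) = G_term a b x s" for s
  proof -
    have "(\<Sum>k\<le>s. f (s - k) k) = (\<Sum>k\<le>s. Q ^ (k choose 2) * (- b) ^ k * pfin (- x) k * pfin (- (b * x * Q ^ k)) (s - k)
       / (pfin Q k * pfin Q (s - k))) * (Q ^ (s choose 2) * (a * x) ^ s * pinf (- b * x * Q ^ s))"
      unfolding sum_distrib_right
    proof (intro sum.cong)
      fix k assume "k \<in> {..s}"
      hence "pinf (- b * x * Q ^ k) = pfin (- (b * x * Q ^ k)) (s - k) * pinf (- b * x * Q ^ s)"
        using pinf_split[of "- b * x * Q ^ k" "s - k"] by (simp add: mult.assoc flip: power_add)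
      thus "f (s - k) k = Q ^ (k choose 2) * (- b) ^ k * pfin (- x) k * pfin (- (b * x * Q ^ k)) (s - k)
       / (pfin Q k * pfin Q (s - k)) * (Q ^ (s choose 2) * (a * x) ^ s * pinf (- b * x * Q ^ s))"
        using \<open>k \<in> {..s}\<close> by (simp add: f_def mult_ac)
    qed simp
    thus ?thesis by (simp add: finite_gauss_sum G_term_def)
  qed
  have sum2: "(\<Sum>\<^sub>\<infinity>i. f i k) = G_sym_term a b x k" for k
  proof -
    have "(\<Sum>\<^sub>\<infinity>i. f i k) = (\<Sum>\<^sub>\<infinity>i. (Q ^ (k * (k - 1)) * (- a * b * x) ^ k * pfin (- x) k / pfin Q k
         * pinf (- b * x * Q ^ k)) * (Q ^ (i choose 2) * (a * x * Q ^ k) ^ i / pfin Q i))"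
    proof (intro infsum_cong)
      fix i :: nat
      have "(- a * b * x) ^ k = a ^ k * x ^ k * (- b) ^ k" by (simp flip: power_mult_distrib add: mult_ac)
      moreover have "Q ^ (k * (k - 1)) = Q ^ (k choose 2) * Q ^ (k choose 2)"
        unfolding two_choose_two[symmetric] by (simp add: mult_2 power_add)
      moreover have "(Q ^ k) ^ i = Q ^ (i * k)" by (simp add: power_mult[symmetric] mult.commute)
      ultimately show "f i k = (Q ^ (k * (k - 1)) * (- a * b * x) ^ k * pfin (- x) k / pfin Q k
         * pinf (- b * x * Q ^ k)) * (Q ^ (i choose 2) * (a * x * Q ^ k) ^ i / pfin Q i)"
        by (simp add: f_def choose_two_add power_add power_mult_distrib mult_ac)
    qed
    also have "\<dots> = G_sym_term a b x k"
      unfolding infsum_cmult_right' by (subst euler_infsum) (simp add: G_sym_term_def mult_ac)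
    finally show ?thesis .
  qed
  have "G_sym_term a b x summable_on UNIV"
  proof -
    have "(\<lambda>(k, i). f i k) summable_on UNIV \<times> UNIV"
      using summable_on_swap[of "\<lambda>(i, k). f i k" UNIV UNIV] sm by (simp add: case_prod_unfold)
    from summable_on_Sigma_banach[OF this] show ?thesis unfolding sum2 .
  qed
  moreover have "G a b x = infsum (G_sym_term a b x) UNIV"
    using infsum_triangle(2)[OF sm] unfolding sum1 sum2 G_def .
  ultimately show ?thesis by (simp add: has_sum_iff)
qed

lemma G_commute: "G a b x = G b a x"
proof -
  have "G_sym_term a b x = G_sym_term b a x" by (simp add: G_sym_term_def fun_eq_iff mult_ac)
  thus ?thesis using G_symmetric_expansion[of a b x] G_symmetric_expansion[of b a x] has_sum_unique by metis
qed

subsection \<open>An expansion in powers of a\<close>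

text \<open>
  Expand \<open>(-bxq\<^sup>k;q)\<^sub>\<infinity>\<close> by Euler and sum over \<open>k\<close> by the \<open>q\<close>-binomial theorem. This gives the series for
  \<open>G b a\<close>, so the symmetry of \<open>G\<close> finishes the argument.
\<close>

lemma G_geometric_expansion:
  assumes a: "norm a < 1"
  shows "((\<lambda>k. a ^ k / pfin Q k * pfin (- x) k * pinf (- b * x * Q ^ k)) has_sum (G a b x / pinf a)) UNIV"
proof -
  define f where "f k s = a ^ k / pfin Q k * pfin (- x) k * (Q ^ (s choose 2) * (b * x * Q ^ k) ^ s / pfin Q s)" for k s
  obtain C where C: "C > 0" "\<And>n. norm (1 / pfin Q n) \<le> C"
    using pfin_Q_inverse_bounded by blast
  obtain D where D: "D > 0" "\<And>n. norm (pfin (- x) n) \<le> D"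
    using pfin_bounded by blast
  have "(\<lambda>(k, s). f k s) summable_on UNIV \<times> UNIV"
  proof (rule summable_on_product_dominated)
    show "(\<lambda>k. C * C * D * norm a ^ k) summable_on UNIV"
      using a by (intro summable_on_cmult_right summable_geometric_on) auto
    show "(\<lambda>s. q ^ (s choose 2) * norm (b * x) ^ s) summable_on UNIV"
      by (intro summable_gauss_on) auto
    show "norm (f k s) \<le> (C * C * D * norm a ^ k) * (q ^ (s choose 2) * norm (b * x) ^ s)" for k s
    proof -
      have "norm (b * x * Q ^ k) ^ s \<le> norm (b * x) ^ s"
        by (intro power_mono norm_mult_Q_pow_le) auto
      moreover have "norm (f k s) = norm (1 / pfin Q k) * norm (1 / pfin Q s) * norm (pfin (- x) k) *
           norm a ^ k * (q ^ (s choose 2) * norm (b * x * Q ^ k) ^ s)"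
        using q_pos by (simp add: f_def norm_mult norm_divide norm_power)
      ultimately show ?thesis
        using C D q_pos by (auto intro!: mult_mono mult_right_mono intro: less_imp_le)
    qed
  qed (use C D q_pos in auto)
  note sm = this
  have sum1: "(\<Sum>\<^sub>\<infinity>s. f k s) = a ^ k / pfin Q k * pfin (- x) k * pinf (- b * x * Q ^ k)" for k
    unfolding f_def infsum_cmult_right' by (subst euler_infsum) simp
  have sum2: "(\<Sum>\<^sub>\<infinity>k. f k s) = G_term b a x s / pinf a" for s
  proof -
    have na: "norm (a * Q ^ s) < 1" using norm_mult_Q_pow_le[of a s] a by simp
    have "(\<Sum>\<^sub>\<infinity>k. f k s) = (\<Sum>\<^sub>\<infinity>k. (Q ^ (s choose 2) * (b * x) ^ s / pfin Q s) *
           (pfin (- x) k / pfin Q k * (a * Q ^ s) ^ k))"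
    proof (intro infsum_cong)
      fix k :: nat
      have "(Q ^ k) ^ s = (Q ^ s) ^ k" by (simp flip: power_mult add: mult.commute)
      thus "f k s = (Q ^ (s choose 2) * (b * x) ^ s / pfin Q s) *
           (pfin (- x) k / pfin Q k * (a * Q ^ s) ^ k)"
        by (simp add: f_def power_mult_distrib mult_ac)
    qed
    also have "\<dots> = (Q ^ (s choose 2) * (b * x) ^ s / pfin Q s) * (pinf (- x * (a * Q ^ s)) / pinf (a * Q ^ s))"
      unfolding infsum_cmult_right' using na by (subst binomial_infsum) auto
    also have "\<dots> = G_term b a x s / pinf a"
    proof -
      have "pinf a \<noteq> 0" "pinf (a * Q ^ s) \<noteq> 0" using pinf_nz_small[OF a] pinf_nz_small[OF na] by auto
      thus ?thesis using pinf_split[of a s] by (simp add: G_term_def field_simps)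
    qed
    finally show ?thesis .
  qed
  have "(\<lambda>k. a ^ k / pfin Q k * pfin (- x) k * pinf (- b * x * Q ^ k)) summable_on UNIV"
    using summable_on_Sigma_banach[OF sm] unfolding sum1 .
  moreover have "(\<Sum>\<^sub>\<infinity>k. a ^ k / pfin Q k * pfin (- x) k * pinf (- b * x * Q ^ k)) = (\<Sum>\<^sub>\<infinity>s. G_term b a x s / pinf a)"
    using infsum_swap_banach[OF sm] unfolding sum1 sum2 .
  moreover have "\<dots> = G b a x / pinf a"
    unfolding G_def divide_inverse by (rule infsum_cmult_left')
  ultimately show ?thesis by (simp add: has_sum_iff G_commute[of a b])
qed

section \<open>Analytic continuation of the Heine series\<close>

lemma pinf_holomorphic_UNIV: "pinf holomorphic_on UNIV"
proof -
  have "(\<lambda>y. \<Sum>n. Q ^ (n choose 2) * (- y) ^ n / pfin Q n) holomorphic_on UNIV"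
  proof (rule holomorphic_on_entire_series)
    fix R :: real
    have "norm (Q ^ (n choose 2) * (- x) ^ n / pfin Q n) \<le>
        norm (Q ^ (n choose 2) * (of_real \<bar>R\<bar>) ^ n / pfin Q n)" if "norm x \<le> R" for n x
    proof -
      have "norm x ^ n \<le> \<bar>R\<bar> ^ n" using that by (intro power_mono) auto
      thus ?thesis
        using q_pos by (simp add: norm_mult norm_divide norm_power divide_right_mono mult_left_mono)
    qed
    thus "\<exists>M. summable M \<and> (\<forall>n x. norm x \<le> R \<longrightarrow> norm (Q ^ (n choose 2) * (- x) ^ n / pfin Q n) \<le> M n)"
      using euler_summable[of "of_real \<bar>R\<bar>"] by blast
  qed (auto intro!: holomorphic_intros)
  moreover have "pinf = (\<lambda>y. \<Sum>n. Q ^ (n choose 2) * (- y) ^ n / pfin Q n)"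
    using sums_unique[OF euler_sums] by (metis add.inverse_inverse)
  ultimately show ?thesis by simp
qed

lemma holomorphic_on_pinf [holomorphic_intros]:
  assumes "f holomorphic_on A" shows "(\<lambda>x. pinf (f x)) holomorphic_on A"
  using holomorphic_on_compose_gen[OF assms pinf_holomorphic_UNIV] by (simp add: o_def)

lemma continuous_on_pinf: "continuous_on UNIV pinf"
  using pinf_holomorphic_UNIV by (rule holomorphic_on_imp_continuous_on)

lemma G_holomorphic_UNIV: "G a b holomorphic_on UNIV"
proof -
  have "(\<lambda>x. \<Sum>n. G_term a b x n) holomorphic_on UNIV"
  proof (rule holomorphic_on_entire_series)
    fix R :: real
    obtain C where "\<And>x n. norm x \<le> R \<Longrightarrow> norm (G_term a b x n) \<le> C * (q ^ (n choose 2) * (norm a * \<bar>R\<bar>) ^ n)"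
      using G_term_bound by blast
    moreover have "summable (\<lambda>n. C * (q ^ (n choose 2) * (norm a * \<bar>R\<bar>) ^ n))"
      by (intro summable_mult summable_gauss)
    ultimately show "\<exists>M. summable M \<and> (\<forall>n x. norm x \<le> R \<longrightarrow> norm (G_term a b x n) \<le> M n)"
      by (intro exI[of _ "\<lambda>n. C * (q ^ (n choose 2) * (norm a * \<bar>R\<bar>) ^ n)"]) auto
  qed (auto intro!: holomorphic_intros simp: G_term_def)
  moreover have "G a b = (\<lambda>x. \<Sum>n. G_term a b x n)"
    unfolding G_def by (intro ext infsum_eq_suminf G_term_summable)
  ultimately show ?thesis by simp
qed

lemma holomorphic_on_G [holomorphic_intros]:
  assumes "f holomorphic_on A" shows "(\<lambda>x. G a b (f x)) holomorphic_on A"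
  using holomorphic_on_compose_gen[OF assms G_holomorphic_UNIV] by (simp add: o_def)

lemma basic_hyp_domain_eq: "basic_hyp_domain q = {y. pinf y \<noteq> 0}"
proof -
  have "y \<in> range (\<lambda>k::nat. 1 / Q ^ k) \<longleftrightarrow> (\<exists>k. y * Q ^ k = 1)" for y
    using q_pos by (simp add: image_iff eq_divide_eq)
  thus ?thesis unfolding basic_hyp_domain_def by (auto simp: pinf_eq_0_iff)
qed

lemma open_basic_hyp_domain: "open (basic_hyp_domain q)"
proof -
  have "closed {y. pinf y = 0}"
    by (intro closed_Collect_eq continuous_on_pinf continuous_intros)
  moreover have "basic_hyp_domain q = - {y. pinf y = 0}" by (auto simp: basic_hyp_domain_eq)
  ultimately show ?thesis by (simp add: open_Compl)
qed

lemma connected_basic_hyp_domain: "connected (basic_hyp_domain q)"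
  unfolding basic_hyp_domain_def
  by (intro path_connected_imp_connected path_connected_complement_countable) auto

text \<open>
  The continuation of \<open>2phi1(a,b;0;q;-x)\<close>; at zeros of the denominator the value is the default \<open>0\<close>.
\<close>

definition F :: "complex \<Rightarrow> complex \<Rightarrow> complex \<Rightarrow> complex" where
  "F a b x = G a b x / pinf (- x)"

lemma F_commute: "F a b x = F b a x" by (simp add: F_def G_commute[of a b])

text \<open>
  The quotient \<open>G(-y)/(y;q)\<^sub>\<infinity>\<close> shows that a continuation exists. Any two agree, since the domain is
  the complement of a countable set and hence connected.
\<close>

lemma basic_hyp_2phi1:
  assumes y: "pinf y \<noteq> 0"
  shows "basic_hyp [a, b] [0] q y = F a b (- y)"
proof -
  define f0 where "f0 y = F a b (- y)" for y
  define P where "P f \<longleftrightarrow> f holomorphic_on basic_hyp_domain q \<and>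
      (\<forall>y. norm y < 1 \<longrightarrow> f y = basic_hyp_series [a, b] [0] q y)" for f
  have hol: "f0 holomorphic_on basic_hyp_domain q"
    unfolding f0_def F_def by (intro holomorphic_intros) (auto simp: basic_hyp_domain_eq)
  have ser: "f0 y = basic_hyp_series [a, b] [0] q y" if "norm y < 1" for y
  proof -
    have "(\<lambda>n. pfin a n * pfin b n / pfin Q n * y ^ n) sums f0 y"
      using has_sum_imp_sums[OF heine[of "- y" a b]] that by (simp add: f0_def F_def)
    hence "f0 y = (\<Sum>n. pfin a n * pfin b n / pfin Q n * y ^ n)" by (rule sums_unique)
    thus ?thesis by (simp add: basic_hyp_series_def basic_hyp_term_def)
  qed
  have "P f0" using hol ser by (simp add: P_def)
  hence some: "P (SOME f. P f)" by (rule someI[of P])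
  define g where "g = (SOME f. P f)"
  have g: "g holomorphic_on basic_hyp_domain q" "\<And>y. norm y < 1 \<Longrightarrow> g y = basic_hyp_series [a, b] [0] q y"
    using some unfolding g_def[symmetric] by (auto simp: P_def)
  have "g y = f0 y"
  proof (rule analytic_continuation_open[of "ball 0 1" "basic_hyp_domain q" g f0])
    show "ball 0 1 \<subseteq> basic_hyp_domain q"
      using pinf_nz_small by (auto simp: basic_hyp_domain_eq)
    show "y \<in> basic_hyp_domain q" using y by (simp add: basic_hyp_domain_eq)
  qed (use hol g ser in \<open>auto intro: connected_basic_hyp_domain open_basic_hyp_domain\<close>)
  moreover have "basic_hyp [a, b] [0] q y = g y"
    by (simp add: basic_hyp_def P_def g_def)
  ultimately show ?thesis by (simp add: f0_def)
qed

lemma pinf_times_1phi1: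
  assumes c: "\<And>k. c * Q ^ k \<noteq> 1"
    and S: "((\<lambda>n. pfin b n / pfin Q n * Q ^ (n choose 2) * (- y) ^ n * pinf (c * Q ^ n)) has_sum S) UNIV"
  shows "pinf c * basic_hyp [b] [c] q y = S"
proof -
  have nz: "pinf c \<noteq> 0" using c by (auto simp: pinf_eq_0_iff)
  have "(\<lambda>n. 1 / pinf c * (pfin b n / pfin Q n * Q ^ (n choose 2) * (- y) ^ n * pinf (c * Q ^ n)))
     sums (1 / pinf c * S)"
    by (intro sums_mult has_sum_imp_sums S)
  moreover have "1 / pinf c * (pfin b n / pfin Q n * Q ^ (n choose 2) * (- y) ^ n * pinf (c * Q ^ n))
     = basic_hyp_term [b] [c] q y n" for n
  proof -
    have "pfin c n \<noteq> 0" "pinf (c * Q ^ n) \<noteq> 0" using pinf_split[of c n] nz by auto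
    moreover have "(- y) ^ n = (- 1) ^ n * y ^ n" by (metis power_minus)
    ultimately show ?thesis using nz unfolding pinf_split[of c n]
      by (simp add: basic_hyp_term_def field_simps)
  qed
  ultimately have "basic_hyp_series [b] [c] q y = S / pinf c"
    unfolding basic_hyp_series_def by (simp add: sums_iff)
  thus ?thesis using nz by (simp add: basic_hyp_def)
qed

lemma pinf_times_1phi1_eq_G:
  assumes "\<And>k. - b * x * Q ^ k \<noteq> 1"
  shows "pinf (- b * x) * basic_hyp [b] [- b * x] q (- a * x) = G a b x"
proof (rule pinf_times_1phi1)
  show "- b * x * Q ^ k \<noteq> 1" for k by (rule assms)
  have "(G_term a b x has_sum G a b x) UNIV"
    unfolding G_def by (rule has_sum_infsum[OF G_term_summable])
  thus "((\<lambda>n. pfin b n / pfin Q n * Q ^ (n choose 2) * (- (- a * x)) ^ n * pinf (- b * x * Q ^ n)) has_sum G a b x) UNIV"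
    by (simp add: G_term_def[abs_def])
qed

subsection \<open>A contiguous relation\<close>

text \<open>
  Comparison of the coefficients of \<open>(-x)\<^sup>n\<close>: with \<open>c\<close> and \<open>e\<close> the coefficients for \<open>a\<close> and \<open>aq\<close>, the
  combination \<open>t\<close> collects the terms without a factor \<open>x\<close>, and \<open>s\<close> the terms with one.
\<close>

lemma F_contiguous_small:
  assumes x: "norm x < 1"
  shows "F a b x = (1 - a) * F (a * Q) b x + a * (1 + a * Q * x) * F (a * Q) b (x * Q)
           - a ^ 2 * b * Q * x * F (a * Q) b (x * Q ^ 2)"
proof -
  define c where "c n = pfin a n * pfin b n / pfin Q n" for n
  define e where "e n = pfin (a * Q) n * pfin b n / pfin Q n" for n
  define t where "t n = c n - (1 - a) * e n - a * Q ^ n * e n" for n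
  define s where "s n = a ^ 2 * Q * Q ^ n * e n - a ^ 2 * b * Q * (Q ^ n) ^ 2 * e n" for n
  have small: "norm (x * Q ^ k) < 1" for k using norm_mult_Q_pow_le[of x k] x by simp
  have sc: "(\<lambda>n. c n * (- x) ^ n) sums F a b x"
    unfolding F_def c_def by (intro has_sum_imp_sums heine x)
  have se: "(\<lambda>n. e n * (- x) ^ n * (Q ^ k) ^ n) sums F (a * Q) b (x * Q ^ k)" for k
  proof -
    have "(- (x * Q ^ k)) ^ n = (- x) ^ n * (Q ^ k) ^ n" for n
      by (simp flip: power_mult_distrib)
    thus ?thesis using has_sum_imp_sums[OF heine[OF small[of k], of "a * Q" b]]
      by (simp add: F_def e_def mult_ac)
  qed
  have st: "(\<lambda>n. t n * (- x) ^ n) sums (F a b x - (1 - a) * F (a * Q) b x - a * F (a * Q) b (x * Q))"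
  proof -
    have "(\<lambda>n. c n * (- x) ^ n - (1 - a) * (e n * (- x) ^ n * (Q ^ 0) ^ n) - a * (e n * (- x) ^ n * (Q ^ 1) ^ n))
       sums (F a b x - (1 - a) * F (a * Q) b (x * Q ^ 0) - a * F (a * Q) b (x * Q ^ 1))"
      by (intro sums_diff sums_mult sc se)
    thus ?thesis by (simp add: t_def algebra_simps)
  qed
  have "(\<lambda>n. a ^ 2 * Q * (e n * (- x) ^ n * (Q ^ 1) ^ n) - a ^ 2 * b * Q * (e n * (- x) ^ n * (Q ^ 2) ^ n))
      sums (a ^ 2 * Q * F (a * Q) b (x * Q ^ 1) - a ^ 2 * b * Q * F (a * Q) b (x * Q ^ 2))"
    by (intro sums_diff sums_mult se)
  hence ss: "(\<lambda>n. x * (s n * (- x) ^ n))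
      sums (x * (a ^ 2 * Q * F (a * Q) b (x * Q) - a ^ 2 * b * Q * F (a * Q) b (x * Q ^ 2)))"
    by (intro sums_mult) (simp add: s_def algebra_simps flip: power_mult)
  have rel: "t (Suc n) = - s n" for n
  proof -
    define K where "K = pfin (a * Q) n * pfin b n / pfin Q n"
    have nz: "1 - Q * Q ^ n \<noteq> 0" using Q_pow_ne_1[of n] by simp
    have c': "c (Suc n) = K * ((1 - a) * (1 - b * Q ^ n)) / (1 - Q * Q ^ n)"
      unfolding c_def K_def pfin_Suc_left[of a] pfin_Suc[of b] pfin_Suc[of Q]
      by (simp add: field_simps)
    have e': "e (Suc n) = K * ((1 - a * (Q * Q ^ n)) * (1 - b * Q ^ n)) / (1 - Q * Q ^ n)"
      unfolding e_def K_def pfin_Suc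
      by (simp add: field_simps)
    have "t (Suc n) = K * (1 - b * Q ^ n) * ((1 - a) - (1 - a) * (1 - a * (Q * Q ^ n))
         - a * (Q * Q ^ n) * (1 - a * (Q * Q ^ n))) / (1 - Q * Q ^ n)"
      unfolding t_def c' e' by (simp add: diff_divide_distrib[symmetric] algebra_simps)
    also have "(1 - a) - (1 - a) * (1 - a * (Q * Q ^ n)) - a * (Q * Q ^ n) * (1 - a * (Q * Q ^ n))
       = - (a ^ 2 * (Q * Q ^ n)) * (1 - Q * Q ^ n)"
      by (simp add: algebra_simps power2_eq_square)
    also have "K * (1 - b * Q ^ n) * (- (a ^ 2 * (Q * Q ^ n)) * (1 - Q * Q ^ n)) / (1 - Q * Q ^ n) =
       - (K * (1 - b * Q ^ n) * (a ^ 2 * (Q * Q ^ n)))"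
      using nz by simp
    also have "\<dots> = - s n"
      unfolding s_def K_def e_def[symmetric] by (simp add: algebra_simps power2_eq_square)
    finally show ?thesis .
  qed
  have "t 0 = 0" by (simp add: t_def c_def e_def)
  moreover have "t (Suc n) * (- x) ^ Suc n = x * (s n * (- x) ^ n)" for n
    by (simp add: rel mult_ac)
  ultimately have "(\<lambda>n. t n * (- x) ^ n)
      sums (x * (a ^ 2 * Q * F (a * Q) b (x * Q) - a ^ 2 * b * Q * F (a * Q) b (x * Q ^ 2)))"
    using ss sums_Suc_iff[of "\<lambda>n. t n * (- x) ^ n"] by simp
  from sums_unique2[OF st this] show ?thesis by (simp add: algebra_simps power2_eq_square)
qed

lemma F_contiguous:
  assumes nz: "pinf (- x) \<noteq> 0"
  shows "F a b x = (1 - a) * F (a * Q) b x + a * (1 + a * Q * x) * F (a * Q) b (x * Q)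
           - a ^ 2 * b * Q * x * F (a * Q) b (x * Q ^ 2)"
proof (rule analytic_continuation_open[of "ball 0 1" "uminus ` basic_hyp_domain q" "F a b"
    "\<lambda>x. (1 - a) * F (a * Q) b x + a * (1 + a * Q * x) * F (a * Q) b (x * Q)
           - a ^ 2 * b * Q * x * F (a * Q) b (x * Q ^ 2)"])
  have D: "uminus ` basic_hyp_domain q = {x. pinf (- x) \<noteq> 0}"
    by (auto simp: basic_hyp_domain_eq image_iff) (metis minus_minus)
  show "open (uminus ` basic_hyp_domain q)"
    by (rule open_negations[OF open_basic_hyp_domain])
  show "connected (uminus ` basic_hyp_domain q)"
    by (intro connected_continuous_image connected_basic_hyp_domain continuous_intros)
  show "ball 0 1 \<subseteq> uminus ` basic_hyp_domain q"
    unfolding D using pinf_nz_small by auto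
  have shift: "pinf (- (x * Q ^ k)) \<noteq> 0" if "pinf (- x) \<noteq> 0" for x k
    using pinf_split[of "- x" k] that by auto
  show "F a b holomorphic_on uminus ` basic_hyp_domain q"
    unfolding F_def[abs_def] by (intro holomorphic_intros) (auto simp: D)
  show "(\<lambda>x. (1 - a) * F (a * Q) b x + a * (1 + a * Q * x) * F (a * Q) b (x * Q)
           - a ^ 2 * b * Q * x * F (a * Q) b (x * Q ^ 2)) holomorphic_on uminus ` basic_hyp_domain q"
    unfolding F_def using shift[of _ 1] shift[of _ 2] by (intro holomorphic_intros) (auto simp: D)
  show "x \<in> uminus ` basic_hyp_domain q" using nz by (simp add: D)
  show "F a b w = (1 - a) * F (a * Q) b w + a * (1 + a * Q * w) * F (a * Q) b (w * Q)
           - a ^ 2 * b * Q * w * F (a * Q) b (w * Q ^ 2)" if "w \<in> ball 0 1" for w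
    by (rule F_contiguous_small) (use that in simp)
qed auto

lemma F_geometric_expansion:
  assumes a: "norm a < 1" and nz: "pinf (- x) \<noteq> 0"
  shows "((\<lambda>k. a ^ k / pfin Q k * (pinf (- b * (x * Q ^ k)) / pinf (- (x * Q ^ k)))) has_sum (F a b x / pinf a)) UNIV"
proof -
  have "((\<lambda>k. a ^ k / pfin Q k * pfin (- x) k * pinf (- b * x * Q ^ k) / pinf (- x)) has_sum
      (G a b x / pinf a) / pinf (- x)) UNIV"
    by (intro has_sum_divide_const G_geometric_expansion a)
  moreover have "a ^ k / pfin Q k * pfin (- x) k * pinf (- b * x * Q ^ k) / pinf (- x)
      = a ^ k / pfin Q k * (pinf (- b * (x * Q ^ k)) / pinf (- (x * Q ^ k)))" for k
    using nz pinf_split[of "- x" k] by (auto simp: mult_ac)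
  ultimately show ?thesis by (simp add: F_def mult_ac)
qed

section \<open>Bilateral sums along a spiral\<close>

definition X :: "complex \<Rightarrow> int \<Rightarrow> complex" where "X l n = Q powi n * l"

definition W :: "complex \<Rightarrow> complex \<Rightarrow> complex" where "W z x = 1 / theta_q q (x / z)"

text \<open>
  The coefficients of the theta series.
\<close>

definition theta_coeff :: "int \<Rightarrow> real" where "theta_coeff n = q powi (n * (n - 1) div 2)"

text \<open>
  The parameters for which \<open>(-l;q)\<^sub>\<infinity>\<close> and \<open>\<theta>(l)\<close>, and the same values along the whole orbit, are nonzero.
\<close>

definition off_spiral :: "complex \<Rightarrow> bool" where
  "off_spiral l \<longleftrightarrow> l \<noteq> 0 \<and> (\<forall>n::int. l \<noteq> - (Q powi n))"

lemma q_nz [simp]: "q \<noteq> 0" using q_pos by simp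

lemma X_zero [simp]: "X l 0 = l" by (simp add: X_def)
lemma X_add: "X l (n + m) = X (X l n) m" by (simp add: X_def power_int_add mult_ac)
lemma X_add_nat: "X l (n + int k) = X l n * Q ^ k" by (simp add: X_def power_int_add mult_ac)
lemma X_Suc: "X l (n + 1) = X l n * Q" by (simp add: X_def power_int_add mult_ac)
lemma X_pred: "X l (n - 1) = X l n / Q" by (simp add: X_def power_int_diff)
lemma X_nz [simp]: "X l n = 0 \<longleftrightarrow> l = 0" by (simp add: X_def)

lemma off_spiral_nz: "off_spiral l \<Longrightarrow> l \<noteq> 0" by (simp add: off_spiral_def)

lemma off_spiral_X: "off_spiral (X l n) \<longleftrightarrow> off_spiral l"
proof -
  have "off_spiral (X l n)" if "off_spiral l" for l n
  proof -
    have "X l n \<noteq> - (Q powi m)" for m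
    proof
      assume "X l n = - (Q powi m)"
      hence "l = - (Q powi (m - n))" by (simp add: X_def power_int_diff field_simps)
      thus False using that by (auto simp: off_spiral_def)
    qed
    thus ?thesis using that by (simp add: off_spiral_def)
  qed
  from this[of l n] this[of "X l n" "- n"] show ?thesis
    using X_add[of l n "- n"] by auto
qed

lemma off_spiral_inverse: "off_spiral (a / b) \<longleftrightarrow> off_spiral (b / a)"
proof -
  have "off_spiral (b / a)" if "off_spiral (a / b)" for a b
  proof -
    have nz: "a \<noteq> 0" "b \<noteq> 0" using off_spiral_nz[OF that] by auto
    have "b / a \<noteq> - (Q powi n)" for n
    proof
      assume "b / a = - (Q powi n)"
      hence "a / b = - (Q powi (- n))" using nz by (simp add: power_int_minus field_simps)
      thus False using that by (auto simp: off_spiral_def)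
    qed
    thus ?thesis using nz by (simp add: off_spiral_def)
  qed
  thus ?thesis by blast
qed

lemma off_spiral_pinf_nz: "off_spiral l \<Longrightarrow> pinf (- l) \<noteq> 0"
proof
  assume *: "off_spiral l" "pinf (- l) = 0"
  then obtain k where "- l * Q ^ k = 1" by (auto simp: pinf_eq_0_iff)
  hence "l * Q ^ k = - 1" by (metis minus_minus mult_minus_left)
  hence "l = - (Q powi (- int k))" by (simp add: power_int_minus field_simps)
  thus False using * by (auto simp: off_spiral_def)
qed

lemma off_spiral_one_plus: "off_spiral l \<Longrightarrow> 1 + l \<noteq> 0"
proof
  assume *: "off_spiral l" "1 + l = 0"
  hence "l = - (Q powi 0)" by (simp add: add_eq_0_iff)
  thus False using * unfolding off_spiral_def by metis
qed

lemma theta_nz: "off_spiral t \<Longrightarrow> theta_q q t \<noteq> 0"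
proof -
  assume t: "off_spiral t"
  have "pinf (- Q / t) \<noteq> 0"
  proof
    assume "pinf (- Q / t) = 0"
    then obtain k where "- Q / t * Q ^ k = 1" by (auto simp: pinf_eq_0_iff)
    hence "t = - (Q powi (int (Suc k)))" using off_spiral_nz[OF t]
      by (simp add: field_simps power_int_add del: of_nat_Suc)
    thus False using t by (auto simp: off_spiral_def)
  qed
  thus ?thesis using off_spiral_pinf_nz[OF t] by (simp add: theta_q_def)
qed

lemma theta_shift:
  assumes t: "t \<noteq> 0"
  shows "theta_q q (t * Q) * t = theta_q q t"
proof -
  have 1: "pinf (- t) = (1 + t) * pinf (- (t * Q))" by (subst pinf_step) simp
  have 2: "pinf (- Q / (t * Q)) = (1 + 1 / t) * pinf (- Q / t)" by (subst pinf_step) simp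
  show ?thesis
    unfolding theta_q_def 1 2 using t by (simp add: field_simps)
qed

lemma W_shift:
  assumes "x \<noteq> 0" "z \<noteq> 0"
  shows "W z (x * Q) = x / z * W z x"
proof -
  have "theta_q q (x / z) = theta_q q (x * Q / z) * (x / z)"
    using theta_shift[of "x / z"] assms by simp
  thus ?thesis unfolding W_def using assms by simp
qed

lemma W_scale: "W (z * Q) (x * Q) = W z x" by (simp add: W_def)

text \<open>
  Since \<open>W\<^sub>z(x)\<close> depends on \<open>x/z\<close> only, passing from \<open>z\<close> to \<open>qz\<close> is a shift of \<open>x\<close>.
\<close>

lemma W_shift_base:
  assumes "x \<noteq> 0" "z \<noteq> 0"
  shows "x * W (z * Q) x = z * Q * W z x"
  using W_shift[of x "z * Q"] assms by (simp add: W_scale field_simps)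

lemma W_shift_pow:
  assumes "x \<noteq> 0" "z \<noteq> 0"
  shows "W z (x * Q ^ k) = Q ^ (k choose 2) * (x / z) ^ k * W z x"
proof (induction k)
  case (Suc k)
  have "W z (x * Q ^ Suc k) = x * Q ^ k / z * W z (x * Q ^ k)"
    using W_shift[of "x * Q ^ k" z] assms by (simp add: mult_ac)
  thus ?case by (simp add: Suc choose_two_Suc power_add)
qed simp

subsection \<open>The theta weight\<close>

lemma triangular_Suc: "(n + 1) * n div 2 = n * (n - 1) div 2 + (n :: int)"
proof -
  have "(n + 1) * n = n * (n - 1) + n * 2" by (simp add: algebra_simps)
  thus ?thesis by (simp add: div_mult_self1)
qed

lemma theta_coeff_0 [simp]: "theta_coeff 0 = 1" by (simp add: theta_coeff_def)
lemma theta_coeff_pos [simp]: "theta_coeff n > 0" using q_pos by (simp add: theta_coeff_def)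
lemma theta_coeff_nonneg [simp]: "theta_coeff n \<ge> 0" using q_pos by (simp add: theta_coeff_def)
lemma theta_coeff_Suc: "theta_coeff (n + 1) = theta_coeff n * q powi n"
  using triangular_Suc[of n] by (simp add: theta_coeff_def power_int_add)
lemma theta_coeff_nat: "theta_coeff (int n) = q ^ (n choose 2)"
proof (induction n)
  case (Suc n)
  thus ?case using theta_coeff_Suc[of "int n"] by (simp add: choose_two_Suc power_add add.commute)
qed simp
lemma theta_coeff_reflect: "theta_coeff (1 - n) = theta_coeff n"
proof -
  have "(1 - n) * (1 - n - 1) = n * (n - 1)" by (simp add: algebra_simps)
  thus ?thesis by (simp add: theta_coeff_def)
qed
lemma theta_coeff_uminus: "theta_coeff (- n) = theta_coeff n * q powi n"
  using theta_coeff_reflect[of "n + 1"] by (simp add: theta_coeff_Suc)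
lemma theta_coeff_neg_nat: "theta_coeff (- int n) = q ^ (n choose 2) * q ^ n"
  by (simp add: theta_coeff_uminus theta_coeff_nat)

lemma theta_coeff_add: "theta_coeff (n + m) = theta_coeff n * theta_coeff m * q powi (n * m)"
proof (induction m rule: int_induct[where k = 0])
  case (step1 m)
  have "theta_coeff (n + (m + 1)) = theta_coeff (n + m) * q powi (n + m)"
    using theta_coeff_Suc[of "n + m"] by (simp add: add.assoc)
  also have "\<dots> = theta_coeff n * theta_coeff (m + 1) * q powi (n * (m + 1))"
    by (simp add: step1 theta_coeff_Suc power_int_add distrib_left mult_ac)
  finally show ?case .
next
  case (step2 m)
  have "theta_coeff (n + m) = theta_coeff (n + (m - 1)) * q powi (n + (m - 1))"
    using theta_coeff_Suc[of "n + (m - 1)"] by simp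
  moreover have "theta_coeff m = theta_coeff (m - 1) * q powi (m - 1)"
    using theta_coeff_Suc[of "m - 1"] by simp
  ultimately have "theta_coeff (n + (m - 1)) * q powi (n + (m - 1)) = theta_coeff n * (theta_coeff (m - 1) * q powi (m - 1)) * q powi (n * m)"
    using step2 by simp
  also have "\<dots> = (theta_coeff n * theta_coeff (m - 1) * q powi (n * (m - 1))) * q powi (n + (m - 1))"
    by (simp add: power_int_add power_int_diff right_diff_distrib mult_ac)
  finally show ?case by simp
qed simp

lemma W_X:
  assumes "l \<noteq> 0" "z \<noteq> 0"
  shows "W z (X l n) = of_real (theta_coeff n) * (l / z) powi n * W z l"
proof (induction n rule: int_induct[where k = 0])
  case (step1 n)
  have "W z (X l (n + 1)) = X l n / z * W z (X l n)"
    unfolding X_Suc using assms by (intro W_shift) auto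
  also have "\<dots> = X l n / z * (of_real (theta_coeff n) * (l / z) powi n * W z l)"
    by (simp only: step1)
  also have "\<dots> = of_real (theta_coeff (n + 1)) * (l / z) powi (n + 1) * W z l"
    using assms by (simp add: theta_coeff_Suc power_int_add X_def mult_ac)
  finally show ?case .
next
  case (step2 n)
  have 1: "theta_coeff n = theta_coeff (n - 1) * q powi (n - 1)" using theta_coeff_Suc[of "n - 1"] by simp
  have 2: "(l / z) powi n = (l / z) powi (n - 1) * (l / z)"
    using assms power_int_add[of "l / z" "n - 1" 1] by simp
  have "X l (n - 1) / z * W z (X l (n - 1)) = W z (X l (n - 1) * Q)"
    using assms by (intro W_shift[symmetric]) auto
  also have "X l (n - 1) * Q = X l n" by (simp add: X_pred)
  also have "W z (X l n) = of_real (theta_coeff n) * (l / z) powi n * W z l" by (rule step2)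
  also have "\<dots> = X l (n - 1) / z * (of_real (theta_coeff (n - 1)) * (l / z) powi (n - 1) * W z l)"
    unfolding 1 2 by (simp add: X_def mult_ac)
  finally show ?case using assms by simp
qed (simp add: X_def)

lemma theta_coeff_summable:
  assumes r: "r > 0" and R: "R \<ge> 0"
  shows "(\<lambda>n. theta_coeff n * r powi n * R ^ nat (- n)) summable_on UNIV"
proof (rule summable_on_int)
  have "(\<lambda>n. theta_coeff (int n) * r powi (int n) * R ^ nat (- int n)) = (\<lambda>n. q ^ (n choose 2) * r ^ n)"
    by (simp add: theta_coeff_nat)
  thus "(\<lambda>n. theta_coeff (int n) * r powi (int n) * R ^ nat (- int n)) summable_on UNIV"
    using summable_gauss_on[of r] r by simp
  have "(\<lambda>n. theta_coeff (- int n) * r powi (- int n) * R ^ nat (- (- int n))) = (\<lambda>n. q ^ (n choose 2) * (q / r * R) ^ n)"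
    by (simp add: fun_eq_iff theta_coeff_neg_nat power_int_minus power_mult_distrib power_divide divide_inverse power_inverse)
  thus "(\<lambda>n. theta_coeff (- int n) * r powi (- int n) * R ^ nat (- (- int n))) summable_on UNIV"
    using summable_gauss_on[of "q / r * R"] r R q_pos by simp
qed

lemma W_norm_summable:
  assumes "l \<noteq> 0" "z \<noteq> 0" "R \<ge> 0"
  shows "(\<lambda>n. norm (W z (X l n)) * R ^ nat (- n)) summable_on UNIV"
proof -
  have "(\<lambda>n. norm (W z l) * (theta_coeff n * norm (l / z) powi n * R ^ nat (- n))) summable_on UNIV"
    using assms by (intro summable_on_cmult_right theta_coeff_summable) auto
  thus ?thesis
    using assms by (simp add: W_X norm_mult norm_power_int norm_divide less_imp_le mult_ac)
qed

lemma W_summable: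
  assumes "l \<noteq> 0" "z \<noteq> 0" "left_geometric f"
  shows "(\<lambda>n. f n * W z (X l n)) summable_on UNIV"
proof -
  obtain C R where 1: "C \<ge> 0" "R \<ge> 1" "\<And>n. norm (f n) \<le> C * R ^ nat (- n)"
    using left_geometricE[OF assms(3)] by metis
  show ?thesis
  proof (rule summable_on_dominated)
    show "(\<lambda>n. C * (norm (W z (X l n)) * R ^ nat (- n))) summable_on UNIV"
      using assms 1 by (intro summable_on_cmult_right W_norm_summable) auto
    show "norm (f n * W z (X l n)) \<le> C * (norm (W z (X l n)) * R ^ nat (- n))" for n
      using mult_right_mono[OF 1(3)[of n], of "norm (W z (X l n))"] by (simp add: norm_mult mult_ac)
  qed
qed

subsection \<open>Growth along the spiral\<close>

lemma X_left_geometric: "left_geometric (X l)"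
proof (rule left_geometricI[of "norm l" "1 / q"])
  show "1 \<le> 1 / q" using q_pos q_lt_1 by simp
  fix n :: int
  have "norm (X l n) = norm l * q powi n" by (simp add: X_def norm_mult norm_power_int less_imp_le q_pos)
  also have "q powi n \<le> (1 / q) ^ nat (- n)"
  proof (cases "n \<ge> 0")
    case True
    thus ?thesis using q_pow_le_1[of "nat n"] by (simp add: power_int_def)
  next
    case False
    thus ?thesis by (simp add: power_int_def power_divide inverse_eq_divide)
  qed
  finally show "norm (X l n) \<le> norm l * (1 / q) ^ nat (- n)"
    by (simp add: mult_left_mono)
qed auto

text \<open>
  The orbit avoids \<open>-1\<close> and accumulates only at \<open>0\<close> and \<open>\<infinity>\<close>.
\<close>

lemma one_plus_X_bounded_below:
  assumes "off_spiral l"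
  shows "\<exists>C>0. \<forall>n. norm (1 / (1 + X l n)) \<le> C"
proof -
  have "(\<lambda>n. 1 / (1 + l * Q ^ n)) \<longlonglongrightarrow> 1 / (1 + l * 0)"
    by (intro tendsto_intros q_pow_LIMSEQ) simp
  hence "Bseq (\<lambda>n. 1 / (1 + l * Q ^ n))" by (intro convergent_imp_Bseq convergentI)
  then obtain C where C: "C > 0" "\<And>n. norm (1 / (1 + l * Q ^ n)) \<le> C" by (auto simp: Bseq_def)
  have "(\<lambda>n. Q ^ n / (Q ^ n + l)) \<longlonglongrightarrow> 0 / (0 + l)"
    using assms by (intro tendsto_intros q_pow_LIMSEQ) (simp add: off_spiral_def)
  hence "Bseq (\<lambda>n. Q ^ n / (Q ^ n + l))" by (intro convergent_imp_Bseq convergentI)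
  then obtain D where D: "D > 0" "\<And>n. norm (Q ^ n / (Q ^ n + l)) \<le> D" by (auto simp: Bseq_def)
  have "norm (1 / (1 + X l n)) \<le> C + D" for n
  proof (cases n rule: int_cases2)
    case (nonneg k)
    thus ?thesis using C(2)[of k] D(1) by (simp add: X_def mult_ac)
  next
    case (nonpos k)
    have "Q ^ k * (1 + X l n) = Q ^ k + l" by (simp add: X_def nonpos power_int_minus field_simps)
    hence "1 / (1 + X l n) = Q ^ k / (Q ^ k + l)"
      by (metis Q_nz mult_divide_mult_cancel_left power_not_zero mult.right_neutral)
    thus ?thesis using D(2)[of k] C(1) by simp
  qed
  thus ?thesis using C(1) D(1) by (intro exI[of _ "C + D"]) auto
qed

definition pinf_ratio :: "complex \<Rightarrow> complex \<Rightarrow> complex" where "pinf_ratio b x = pinf (- b * x) / pinf (- x)"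

lemma pinf_ratio_step:
  assumes "off_spiral x"
  shows "(1 + x) * pinf_ratio b x = (1 + b * x) * pinf_ratio b (x * Q)"
proof -
  have 1: "pinf (- x) = (1 + x) * pinf (- (x * Q))" by (subst pinf_step) simp
  have 2: "pinf (- b * x) = (1 + b * x) * pinf (- b * (x * Q))" by (subst pinf_step) (simp add: mult_ac)
  show ?thesis
    unfolding pinf_ratio_def 1 2 using off_spiral_one_plus[OF assms] by simp
qed

text \<open>
  Going one step to the left multiplies by \<open>(1 + bx)/(1 + x) = b + (1 - b)/(1 + x)\<close>, which is bounded.
\<close>

lemma pinf_ratio_left_geometric:
  assumes l: "off_spiral l"
  shows "left_geometric (\<lambda>n. pinf_ratio b (X l n))"
proof -
  obtain C where C: "C > 0" "\<And>n. norm (1 / (1 + X l n)) \<le> C"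
    using one_plus_X_bounded_below[OF l] by blast
  obtain D where D: "D > 0" "\<And>n. norm (pfin (- l) n) \<le> D" using pfin_bounded by blast
  obtain E where E: "E > 0" "\<And>n. norm (pinf (- b * l * Q ^ n)) \<le> E" using pinf_orbit_bounded by blast
  define M where "M = E * D * norm (1 / pinf (- l))"
  define R where "R = 1 + norm b + norm (1 - b) * C"
  have M: "M \<ge> 0" using D E by (simp add: M_def)
  have R: "R \<ge> 1" using C by (simp add: R_def)
  have pos: "norm (pinf_ratio b (X l (int n))) \<le> M" for n
  proof -
    have "pinf_ratio b (X l (int n)) = pinf (- b * l * Q ^ n) * pfin (- l) n * (1 / pinf (- l))"
      using pinf_split[of "- l" n] off_spiral_pinf_nz[OF l] by (auto simp: pinf_ratio_def X_def mult_ac)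
    hence "norm (pinf_ratio b (X l (int n))) =
        norm (pinf (- b * l * Q ^ n)) * norm (pfin (- l) n) * norm (1 / pinf (- l))"
      by (simp only: norm_mult)
    also have "\<dots> \<le> E * D * norm (1 / pinf (- l))"
      using D E by (intro mult_right_mono mult_mono) (auto intro: less_imp_le)
    finally show ?thesis unfolding M_def .
  qed
  have neg: "norm (pinf_ratio b (X l (- int n))) \<le> M * R ^ n" for n
  proof (induction n)
    case (Suc n)
    define x where "x = X l (- int (Suc n))"
    have x: "off_spiral x" using l by (simp add: x_def off_spiral_X)
    have "x * Q = X l (- int n)" using X_Suc[of l "- int (Suc n)"] by (simp add: x_def)
    hence "pinf_ratio b x = (1 + b * x) / (1 + x) * pinf_ratio b (X l (- int n))"
      using pinf_ratio_step[OF x, of b] off_spiral_one_plus[OF x] by (simp add: field_simps)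
    also have "(1 + b * x) / (1 + x) = b + (1 - b) * (1 / (1 + x))"
      using off_spiral_one_plus[OF x] by (simp add: field_simps)
    finally have eq: "norm (pinf_ratio b x) = norm (b + (1 - b) * (1 / (1 + x))) * norm (pinf_ratio b (X l (- int n)))"
      by (simp add: norm_mult)
    have "norm (b + (1 - b) * (1 / (1 + x))) \<le> norm b + norm (1 - b) * C"
      using C(2)[of "- int (Suc n)"] unfolding x_def[symmetric]
      by (intro norm_triangle_mono) (auto simp only: norm_mult intro!: mult_left_mono norm_ge_zero)
    also have "\<dots> \<le> R" by (simp add: R_def)
    finally have "norm (pinf_ratio b x) \<le> R * (M * R ^ n)"
      unfolding eq using Suc R by (intro mult_mono) auto
    thus ?case by (simp add: x_def mult_ac)
  qed (use pos[of 0] in simp)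
  show ?thesis
  proof (rule left_geometricI[OF M R])
    show "norm (pinf_ratio b (X l n)) \<le> M * R ^ nat (- n)" for n
      by (cases n rule: int_cases2) (use pos neg in auto)
  qed
qed

text \<open>
  For \<open>|a| < 1\<close> this follows from the expansion of \<open>F\<close> in powers of \<open>a\<close>. The contiguous relation carries
  the bound from \<open>aq\<close> to \<open>a\<close>, because \<open>x\<^sub>n\<close> itself has geometric growth.
\<close>

lemma F_left_geometric:
  assumes l: "off_spiral l"
  shows "left_geometric (\<lambda>n. F a b (X l n))"
proof -
  have small: "left_geometric (\<lambda>n. F a b (X l n))" if a: "norm a < 1" for a
  proof -
    obtain C R where 1: "C \<ge> 0" "R \<ge> 1" "\<And>n. norm (pinf_ratio b (X l n)) \<le> C * R ^ nat (- n)"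
      using left_geometricE[OF pinf_ratio_left_geometric[OF l]] by metis
    obtain D where D: "D > 0" "\<And>n. norm (1 / pfin Q n) \<le> D" using pfin_Q_inverse_bounded by blast
    have sg: "(\<lambda>k. norm a ^ k) summable_on UNIV" using a by (intro summable_geometric_on) auto
    define S where "S = (\<Sum>\<^sub>\<infinity>k. norm a ^ k)"
    have S: "S \<ge> 0" unfolding S_def by (intro infsum_nonneg) auto
    show ?thesis
    proof (rule left_geometricI[of "norm (pinf a) * (D * C * S)" R])
      fix n
      have x: "pinf (- X l n) \<noteq> 0" using l by (intro off_spiral_pinf_nz) (simp add: off_spiral_X)
      have hs: "((\<lambda>k. a ^ k / pfin Q k * pinf_ratio b (X l (n + int k))) has_sum (F a b (X l n) / pinf a)) UNIV"
        using F_geometric_expansion[OF a x, of b] by (simp add: pinf_ratio_def X_add_nat)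
      have "norm (F a b (X l n) / pinf a) \<le> (\<Sum>\<^sub>\<infinity>k. D * C * R ^ nat (- n) * norm a ^ k)"
      proof (rule norm_infsum_le[OF hs has_sum_infsum])
        show "(\<lambda>k. D * C * R ^ nat (- n) * norm a ^ k) summable_on UNIV"
          by (intro summable_on_cmult_right sg)
        fix k :: nat
        have "norm (pinf_ratio b (X l (n + int k))) \<le> C * R ^ nat (- n)"
          by (rule left_geometric_mono[OF 1]) auto
        hence "norm (1 / pfin Q k) * norm (pinf_ratio b (X l (n + int k))) \<le> D * (C * R ^ nat (- n))"
          using D by (intro mult_mono) auto
        hence "norm (1 / pfin Q k) * norm (pinf_ratio b (X l (n + int k))) * norm a ^ k \<le> D * (C * R ^ nat (- n)) * norm a ^ k"
          by (intro mult_right_mono) auto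
        thus "norm (a ^ k / pfin Q k * pinf_ratio b (X l (n + int k))) \<le> D * C * R ^ nat (- n) * norm a ^ k"
          by (simp add: norm_mult norm_divide norm_power mult_ac)
      qed
      also have "\<dots> = D * C * S * R ^ nat (- n)"
        unfolding infsum_cmult_right' S_def by simp
      finally have "norm (pinf a) * norm (F a b (X l n) / pinf a) \<le> norm (pinf a) * (D * C * S * R ^ nat (- n))"
        by (intro mult_left_mono) auto
      moreover have "norm (pinf a) * norm (F a b (X l n) / pinf a) = norm (F a b (X l n))"
        using pinf_nz_small[OF a] by (simp add: norm_divide)
      ultimately show "norm (F a b (X l n)) \<le> norm (pinf a) * (D * C * S) * R ^ nat (- n)"
        by (simp add: mult_ac)
    qed (use 1 D S in auto)
  qed
  have "norm (a * Q ^ N) < 1 \<Longrightarrow> left_geometric (\<lambda>n. F a b (X l n))" for N a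
  proof (induction N arbitrary: a)
    case (Suc N)
    have IH: "left_geometric (\<lambda>n. F (a * Q) b (X l n))"
      using Suc.prems by (intro Suc.IH) (simp add: mult_ac)
    have "left_geometric (\<lambda>n. (1 - a) * F (a * Q) b (X l n)
       + (a + a * a * Q * X l n) * F (a * Q) b (X l (n + int 1))
       + (- (a ^ 2 * b * Q) * X l n) * F (a * Q) b (X l (n + int 2)))"
      by (intro left_geometric_add left_geometric_mult left_geometric_const X_left_geometric IH
            left_geometric_shift[OF IH])
    moreover have "F a b (X l n) = (1 - a) * F (a * Q) b (X l n)
       + (a + a * a * Q * X l n) * F (a * Q) b (X l (n + int 1))
       + (- (a ^ 2 * b * Q) * X l n) * F (a * Q) b (X l (n + int 2))" for n
      unfolding X_add_nat using l
      by (subst F_contiguous) (auto intro!: off_spiral_pinf_nz simp: off_spiral_X algebra_simps)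
    ultimately show ?case by simp
  qed (use small in simp)
  with exists_small_power[of a] show ?thesis by blast
qed

section \<open>The resummed function\<close>

definition U :: "complex \<Rightarrow> complex \<Rightarrow> complex \<Rightarrow> complex \<Rightarrow> complex" where
  "U l a b z = (\<Sum>\<^sub>\<infinity>n. F a b (X l n) * W z (X l n))"

lemma U_commute: "U l a b z = U l b a z"
  unfolding U_def F_commute[of a b] ..

lemma U_term_eq:
  assumes "off_spiral l"
  shows "U_term q l a b z n = F a b (X l n) * W z (X l n)"
proof -
  have "pinf (- X l n) \<noteq> 0" using assms by (intro off_spiral_pinf_nz) (simp add: off_spiral_X)
  thus ?thesis using basic_hyp_2phi1[of "- X l n" a b]
    by (simp add: U_term_def W_def X_def)
qed

lemma U_summable:
  assumes "off_spiral l" "z \<noteq> 0"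
  shows "(\<lambda>n. F a b (X l n) * W z (X l n)) summable_on UNIV"
  using assms by (intro W_summable F_left_geometric) (auto simp: off_spiral_def)

lemma U_q_eq:
  assumes "off_spiral l"
  shows "U_q q l a b z = U l a b z"
  unfolding U_q_def U_def by (intro infsum_cong U_term_eq assms)

subsection \<open>The symmetric bilateral series\<close>

definition sym_term where
  "sym_term l a b z n = pinf (- a * X l n) * pinf (- b * X l n) / (pinf (- X l n) * theta_q q (X l n / z))"

text \<open>
  To the left the theta weight cancels the Gaussian growth of the products exactly: the quotient of
  neighbouring terms tends to \<open>abz\<close>.
\<close>

lemma sym_term_summable:
  assumes l: "off_spiral l" and z: "z \<noteq> 0" and abz: "norm (a * b * z) < 1"
  shows "sym_term l a b z summable_on UNIV"
proof (rule summable_on_int)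
  have nz: "l \<noteq> 0" using l by (simp add: off_spiral_def)
  obtain A where A: "A > 0" "\<And>n. norm (pinf (- a * l * Q ^ n)) \<le> A" using pinf_orbit_bounded by blast
  obtain B where B: "B > 0" "\<And>n. norm (pinf (- b * l * Q ^ n)) \<le> B" using pinf_orbit_bounded by blast
  obtain D where D: "D > 0" "\<And>n. norm (pfin (- l) n) \<le> D" using pfin_bounded by blast
  have "(\<lambda>n. norm (W z (X l n)) * 1 ^ nat (- n)) summable_on UNIV"
    using nz z by (intro W_norm_summable) auto
  hence "(\<lambda>n. norm (W z (X l n))) summable_on UNIV" by simp
  hence "(\<lambda>n. norm (W z (X l n))) summable_on range int"
    by (rule summable_on_subset_banach) auto
  hence sW: "(\<lambda>n. norm (W z (X l (int n)))) summable_on UNIV"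
    by (subst (asm) summable_on_reindex) (auto simp: o_def)
  show "(\<lambda>n. sym_term l a b z (int n)) summable_on UNIV"
  proof (rule summable_on_dominated)
    show "(\<lambda>n. A * B * D * norm (1 / pinf (- l)) * norm (W z (X l (int n)))) summable_on UNIV"
      by (intro summable_on_cmult_right sW)
    fix n :: nat
    have "sym_term l a b z (int n) = pinf (- a * l * Q ^ n) * pinf (- b * l * Q ^ n) * pfin (- l) n
        * (1 / pinf (- l)) * W z (X l (int n))"
      using pinf_split[of "- l" n] off_spiral_pinf_nz[OF l]
      by (auto simp: sym_term_def X_def W_def mult_ac)
    hence "norm (sym_term l a b z (int n)) = norm (pinf (- a * l * Q ^ n)) * norm (pinf (- b * l * Q ^ n)) * norm (pfin (- l) n)
        * norm (1 / pinf (- l)) * norm (W z (X l (int n)))"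
      by (simp only: norm_mult)
    also have "\<dots> \<le> A * B * D * norm (1 / pinf (- l)) * norm (W z (X l (int n)))"
      using A B D by (intro mult_right_mono mult_mono) (auto intro: less_imp_le)
    finally show "norm (sym_term l a b z (int n)) \<le> A * B * D * norm (1 / pinf (- l)) * norm (W z (X l (int n)))" .
  qed
  \<comment> \<open>\<open>u n\<close> is the reciprocal of the point of the orbit with index \<open>-(n + 1)\<close>. In this variable the
    quotient \<open>\<rho> n\<close> of two neighbouring terms is continuous at \<open>0\<close>.\<close>
  define u where "u n = Q ^ Suc n / l" for n
  define \<rho> where "\<rho> n = (u n + a) * (u n + b) * z / (u n + 1)" for n
  have step: "sym_term l a b z (- int (Suc n)) = \<rho> n * sym_term l a b z (- int n)" for n
  proof -
    define x where "x = X l (- int (Suc n))"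
    have x: "off_spiral x" using l by (simp add: x_def off_spiral_X)
    have x0: "x \<noteq> 0" "1 + x \<noteq> 0" using off_spiral_nz[OF x] off_spiral_one_plus[OF x] by auto
    have xQ: "X l (- int n) = x * Q" using X_Suc[of l "- int (Suc n)"] by (simp add: x_def)
    have ux: "u n = 1 / x" by (simp add: u_def x_def X_def power_int_minus field_simps del: of_nat_Suc)
    have "\<rho> n = (1 + a * x) * (1 + b * x) / (1 + x) * (z / x)"
    proof -
      have "(1 / x + a) * (1 / x + b) / (1 / x + 1) = (1 + a * x) * (1 + b * x) / ((1 + x) * x)"
      proof -
        have "1 / x + c = (1 + c * x) / x" for c using x0 by (simp add: field_simps)
        from this[of a] this[of b] this[of 1] show ?thesis using x0 by simp
      qed
      hence "\<rho> n = (1 + a * x) * (1 + b * x) / ((1 + x) * x) * z"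
        unfolding \<rho>_def ux by (metis times_divide_eq_left)
      thus ?thesis by simp
    qed
    moreover have st: "pinf (- c * x) = (1 + c * x) * pinf (- c * (x * Q))" for c
      by (subst pinf_step) (simp add: mult_ac)
    moreover from st[of 1] have "pinf (- x) = (1 + x) * pinf (- (x * Q))" by simp
    moreover have "W z x = z / x * W z (x * Q)"
      using W_shift[of x z] x0 z by (simp add: field_simps)
    moreover have "sym_term l a b z (- int (Suc n)) = pinf (- a * x) * pinf (- b * x) / pinf (- x) * W z x"
      by (simp add: sym_term_def W_def x_def)
    moreover have "sym_term l a b z (- int n) = pinf (- a * (x * Q)) * pinf (- b * (x * Q)) / pinf (- (x * Q)) * W z (x * Q)"
      by (simp add: sym_term_def W_def xQ)
    ultimately show ?thesis by (simp add: mult_ac)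
  qed
  have "u \<longlonglongrightarrow> 0 / l"
    unfolding u_def using nz by (intro tendsto_divide tendsto_const LIMSEQ_Suc[OF q_pow_LIMSEQ])
  hence "\<rho> \<longlonglongrightarrow> (0 / l + a) * (0 / l + b) * z / (0 / l + 1)"
    unfolding \<rho>_def by (intro tendsto_intros) auto
  hence "(\<lambda>n. norm (\<rho> n)) \<longlonglongrightarrow> norm (a * b * z)" by (intro tendsto_norm) simp
  moreover obtain c where c: "norm (a * b * z) < c" "c < 1" using dense abz by blast
  ultimately have "eventually (\<lambda>n. norm (\<rho> n) < c) sequentially" by (intro order_tendstoD) auto
  then obtain N where N: "\<And>n. n \<ge> N \<Longrightarrow> norm (\<rho> n) < c" by (auto simp: eventually_sequentially)
  have "summable (\<lambda>n. norm (sym_term l a b z (- int n)))"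
  proof (rule summable_ratio_test[of c N])
    fix n assume "n \<ge> N"
    thus "norm (norm (sym_term l a b z (- int (Suc n)))) \<le> c * norm (norm (sym_term l a b z (- int n)))"
      unfolding step using N[of n] by (simp add: norm_mult mult_right_mono)
  qed (use c in simp)
  thus "(\<lambda>n. sym_term l a b z (- int n)) summable_on UNIV"
    by (rule norm_summable_imp_summable_on)
qed

text \<open>
  Expand \<open>(abz;q)\<^sub>\<infinity>\<close> by Euler. After the shift \<open>n \<mapsto> n + k\<close>, the factor \<open>z\<^sup>k\<close> is absorbed by the weight, and
  the sum over \<open>k\<close> becomes the symmetric expansion of \<open>F\<close> at \<open>x\<^sub>n\<close>.
\<close>

theorem U_eq_symmetric_series:
  assumes l: "off_spiral l" and z: "z \<noteq> 0" and abz: "norm (a * b * z) < 1"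
  shows "U l a b z = pinf (a * b * z) * infsum (sym_term l a b z) UNIV"
proof -
  have nz: "l \<noteq> 0" using l by (simp add: off_spiral_def)
  define e where "e k = Q ^ (k choose 2) * (- (a * b * z)) ^ k / pfin Q k" for k
  define f where "f n k = e k * sym_term l a b z n" for n k
  have e: "e summable_on UNIV" "infsum e UNIV = pinf (a * b * z)"
    using euler_infsum[of "- (a * b * z)"] by (auto simp: e_def[abs_def])
  have sm: "(\<lambda>(n, k). f n k) summable_on UNIV \<times> UNIV"
    by (rule summable_on_product_dominated[OF
          summable_on_norm_complex[OF sym_term_summable[OF assms]] _ summable_on_norm_complex[OF e(1)]])
       (auto simp: f_def norm_mult mult_ac)
  have "(\<Sum>\<^sub>\<infinity>n. \<Sum>\<^sub>\<infinity>k. f n k) = pinf (a * b * z) * infsum (sym_term l a b z) UNIV"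
    unfolding f_def infsum_cmult_left' infsum_cmult_right' e ..
  moreover have "(\<Sum>\<^sub>\<infinity>k. f (n + int k) k) = F a b (X l n) * W z (X l n)" for n
  proof -
    define x where "x = X l n"
    have x: "off_spiral x" using l by (simp add: x_def off_spiral_X)
    have px: "pinf (- x) \<noteq> 0" by (rule off_spiral_pinf_nz[OF x])
    have "f (n + int k) k = G_sym_term a b x k * (1 / pinf (- x) * W z x)" for k
    proof -
      have 1: "f (n + int k) k = e k * (pinf (- a * x * Q ^ k) * pinf (- b * x * Q ^ k) / pinf (- x * Q ^ k) * W z (x * Q ^ k))"
        by (simp add: f_def sym_term_def X_add_nat W_def x_def mult_ac)
      have 2: "W z (x * Q ^ k) = Q ^ (k choose 2) * (x / z) ^ k * W z x"
        using off_spiral_nz[OF x] z by (intro W_shift_pow)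
      have 3: "1 / pinf (- x * Q ^ k) = pfin (- x) k / pinf (- x)"
        using pinf_split[of "- x" k] px by auto
      have 4: "Q ^ (k * (k - 1)) = Q ^ (k choose 2) * Q ^ (k choose 2)"
        unfolding two_choose_two[symmetric] by (simp add: mult_2 power_add)
      have 5: "(- a * b * x) ^ k = (- (a * b * z)) ^ k * (x / z) ^ k"
        unfolding power_mult_distrib[symmetric] using z by (simp add: mult_ac)
      have "f (n + int k) k = e k * (pinf (- a * x * Q ^ k) * pinf (- b * x * Q ^ k) * (1 / pinf (- x * Q ^ k)) * W z (x * Q ^ k))"
        unfolding 1 by simp
      thus ?thesis unfolding 2 3 G_sym_term_def 4 5 e_def by (simp add: mult_ac)
    qed
    hence "(\<Sum>\<^sub>\<infinity>k. f (n + int k) k) = infsum (G_sym_term a b x) UNIV * (1 / pinf (- x) * W z x)"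
      by (simp only: infsum_cmult_left')
    also have "infsum (G_sym_term a b x) UNIV = G a b x"
      using G_symmetric_expansion by (simp add: has_sum_iff)
    finally show ?thesis by (simp add: F_def x_def)
  qed
  ultimately show ?thesis
    using infsum_double_shift[OF sm] by (simp add: U_def)
qed

subsection \<open>The nonsymmetric bilateral series\<close>

definition asym_term where
  "asym_term l a b z n = pinf_ratio b (X l n) * pinf (- (a * Q * z / X l n)) * W z (X l n)"

lemma W_shift_back:
  assumes "x \<noteq> 0" "z \<noteq> 0"
  shows "W z (x / Q ^ k) = Q ^ (k choose 2) * (Q * z / x) ^ k * W z x"
proof (induction k)
  case (Suc k)
  have "W z (x / Q ^ k) = x / Q ^ Suc k / z * W z (x / Q ^ Suc k)"
    using W_shift[of "x / Q ^ Suc k" z] assms by simp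
  hence "W z (x / Q ^ Suc k) = Q * z / x * Q ^ k * W z (x / Q ^ k)"
    using assms by (simp add: field_simps)
  thus ?case by (simp add: Suc choose_two_Suc power_add mult_ac)
qed simp

text \<open>
  Insert the expansion of \<open>F\<close> in powers of \<open>a\<close> and shift \<open>n \<mapsto> n - k\<close>. The sum over \<open>k\<close> of
  \<open>a\<^sup>k W\<^sub>z(q\<^sup>-\<^sup>k x)/(q;q)\<^sub>k\<close> is Euler's series for \<open>(-aqz/x;q)\<^sub>\<infinity> W\<^sub>z(x)\<close>.
\<close>

lemma U_eq_asymmetric_series_small:
  assumes l: "off_spiral l" and z: "z \<noteq> 0" and a: "norm a < 1"
  shows "asym_term l a b z summable_on UNIV"
    and "U l a b z = pinf a * infsum (asym_term l a b z) UNIV"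
proof -
  have nz: "l \<noteq> 0" using l by (simp add: off_spiral_def)
  define f where "f n k = a ^ k / pfin Q k * pinf_ratio b (X l n) * W z (X l (n - int k))" for n k
  obtain C R where 1: "C \<ge> 0" "R \<ge> 1" "\<And>n. norm (pinf_ratio b (X l n)) \<le> C * R ^ nat (- n)"
    using left_geometricE[OF pinf_ratio_left_geometric[OF l]] by metis
  obtain D where D: "D > 0" "\<And>n. norm (1 / pfin Q n) \<le> D" using pfin_Q_inverse_bounded by blast
  have "(\<lambda>(n, k). f (n + int k) k) summable_on UNIV \<times> UNIV"
  proof (rule summable_on_product_dominated)
    show "(\<lambda>n. norm (W z (X l n)) * R ^ nat (- n)) summable_on UNIV"
      using nz z 1 by (intro W_norm_summable) auto
    show "(\<lambda>k. D * C * norm a ^ k) summable_on UNIV"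
      using a by (intro summable_on_cmult_right summable_geometric_on) auto
    fix n k
    have "norm (pinf_ratio b (X l (n + int k))) \<le> C * R ^ nat (- n)"
      by (rule left_geometric_mono[OF 1]) auto
    hence "norm (1 / pfin Q k) * norm (pinf_ratio b (X l (n + int k))) \<le> D * (C * R ^ nat (- n))"
      using D by (intro mult_mono) auto
    hence "norm (1 / pfin Q k) * norm (pinf_ratio b (X l (n + int k))) * (norm a ^ k * norm (W z (X l n)))
        \<le> D * (C * R ^ nat (- n)) * (norm a ^ k * norm (W z (X l n)))"
      by (intro mult_right_mono) auto
    thus "norm (f (n + int k) k) \<le> norm (W z (X l n)) * R ^ nat (- n) * (D * C * norm a ^ k)"
      by (simp add: f_def norm_mult norm_divide norm_power mult_ac)
  qed (use 1 D in auto)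
  hence sm: "(\<lambda>(n, k). f n k) summable_on UNIV \<times> UNIV" using summable_on_double_shift by blast
  have inner: "(\<Sum>\<^sub>\<infinity>k. f n k) = asym_term l a b z n" for n
  proof -
    define x where "x = X l n"
    have x0: "x \<noteq> 0" using nz by (simp add: x_def)
    have "f n k = pinf_ratio b x * W z x * (Q ^ (k choose 2) * (a * Q * z / x) ^ k / pfin Q k)" for k
    proof -
      have "X l (n - int k) = x / Q ^ k" by (simp add: X_def x_def power_int_diff)
      hence "f n k = a ^ k / pfin Q k * pinf_ratio b x * (Q ^ (k choose 2) * (Q * z / x) ^ k * W z x)"
        using W_shift_back[OF x0 z, of k] by (simp add: f_def x_def)
      moreover have "(a * Q * z / x) ^ k = a ^ k * (Q * z / x) ^ k"
        by (simp flip: power_mult_distrib add: mult_ac)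
      ultimately show ?thesis by (simp add: mult_ac)
    qed
    hence "(\<Sum>\<^sub>\<infinity>k. f n k) = pinf_ratio b x * W z x * pinf (- (a * Q * z / x))"
      by (simp only: infsum_cmult_right' euler_infsum)
    thus ?thesis by (simp add: asym_term_def x_def mult_ac)
  qed
  show "asym_term l a b z summable_on UNIV"
    using summable_on_Sigma_banach[OF sm] unfolding inner .
  have outer: "(\<Sum>\<^sub>\<infinity>k. f (n + int k) k) = 1 / pinf a * (F a b (X l n) * W z (X l n))" for n
  proof -
    have x: "pinf (- X l n) \<noteq> 0" using l by (intro off_spiral_pinf_nz) (simp add: off_spiral_X)
    have "((\<lambda>k. a ^ k / pfin Q k * pinf_ratio b (X l (n + int k))) has_sum (F a b (X l n) / pinf a)) UNIV"
      using F_geometric_expansion[OF a x, of b] by (simp add: pinf_ratio_def X_add_nat)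
    hence "((\<lambda>k. a ^ k / pfin Q k * pinf_ratio b (X l (n + int k)) * W z (X l n)) has_sum (F a b (X l n) / pinf a * W z (X l n))) UNIV"
      by (rule has_sum_cmult_left)
    thus ?thesis by (simp add: f_def has_sum_iff)
  qed
  have "1 / pinf a * U l a b z = infsum (asym_term l a b z) UNIV"
    using infsum_double_shift[OF sm] unfolding inner outer infsum_cmult_right' U_def .
  thus "U l a b z = pinf a * infsum (asym_term l a b z) UNIV"
    using pinf_nz_small[OF a] by (simp add: field_simps)
qed

subsection \<open>Descent in the parameter\<close>

text \<open>
  The pointwise relation for \<open>F\<close>, with \<open>x f(qx)\<close> read as multiplication by \<open>z\<close> and \<open>f(qx)\<close> as the passage
  from \<open>z\<close> to \<open>qz\<close>.
\<close>

lemma U_contiguous: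
  assumes l: "off_spiral l" and z: "z \<noteq> 0"
  shows "U l a b z = (1 - a + a ^ 2 * Q * z) * U l (a * Q) b z + a * (1 - a * b * Q * z) * U l (a * Q) b (z * Q)"
proof -
  have nz: "l \<noteq> 0" using l by (simp add: off_spiral_def)
  define u where "u z n = F (a * Q) b (X l n) * W z (X l n)" for z n
  have u: "u w summable_on UNIV" "infsum (u w) UNIV = U l (a * Q) b w" if "w \<noteq> 0" for w
    unfolding u_def[abs_def] U_def using U_summable[OF l that] by auto
  have us: "(\<lambda>n. u w (n + m)) summable_on UNIV" "(\<Sum>\<^sub>\<infinity>n. u w (n + m)) = U l (a * Q) b w" if "w \<noteq> 0" for w m
    using u[OF that] summable_on_int_shift[of "u w" m] infsum_int_shift[of "u w" m] by auto
  have zQ: "z * Q \<noteq> 0" using z by simp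
  have "F a b (X l n) * W z (X l n) = (1 - a) * u z n + a * u (z * Q) (n + 1)
      + a ^ 2 * Q * z * u z (n + 1) + (- (a ^ 2 * b * Q * z)) * u (z * Q) (n + 2)" for n
  proof -
    define x where "x = X l n"
    have x: "off_spiral x" using l by (simp add: x_def off_spiral_X)
    have x0: "x \<noteq> 0" using off_spiral_nz[OF x] .
    have X1: "X l (n + 1) = x * Q" "X l (n + 2) = x * Q ^ 2"
      using X_add_nat[of l n 1] X_add_nat[of l n 2] by (simp_all add: x_def)
    have w1: "x * W z x = z * W z (x * Q)" using W_shift[OF x0 z] z by simp
    have w2: "W z (x * Q) = W (z * Q) (x * Q ^ 2)"
      using W_scale[of z "x * Q"] by (simp add: power2_eq_square mult_ac)
    have w3: "W z x = W (z * Q) (x * Q)" by (rule W_scale[symmetric])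
    have "F a b x * W z x = (1 - a) * F (a * Q) b x * W z x + a * F (a * Q) b (x * Q) * W z x
        + a ^ 2 * Q * F (a * Q) b (x * Q) * (x * W z x) - a ^ 2 * b * Q * F (a * Q) b (x * Q ^ 2) * (x * W z x)"
      by (subst F_contiguous[OF off_spiral_pinf_nz[OF x]]) (simp add: algebra_simps power2_eq_square)
    also have "\<dots> = (1 - a) * F (a * Q) b x * W z x + a * F (a * Q) b (x * Q) * W (z * Q) (x * Q)
        + a ^ 2 * Q * F (a * Q) b (x * Q) * (z * W z (x * Q)) - a ^ 2 * b * Q * F (a * Q) b (x * Q ^ 2) * (z * W (z * Q) (x * Q ^ 2))"
      unfolding w1 w2 by (simp only: w3[symmetric])
    finally show ?thesis unfolding u_def X1 x_def[symmetric] by (simp add: algebra_simps)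
  qed
  hence "U l a b z = (\<Sum>\<^sub>\<infinity>n. (1 - a) * u z n + a * u (z * Q) (n + 1)
      + a ^ 2 * Q * z * u z (n + 1) + (- (a ^ 2 * b * Q * z)) * u (z * Q) (n + 2))"
    unfolding U_def by simp
  also have "\<dots> = (1 - a) * U l (a * Q) b z + a * U l (a * Q) b (z * Q)
      + a ^ 2 * Q * z * U l (a * Q) b z + (- (a ^ 2 * b * Q * z)) * U l (a * Q) b (z * Q)"
  proof (intro infsumI has_sum_add has_sum_cmult_right)
    show "(u z has_sum U l (a * Q) b z) UNIV" using u[OF z] by (simp add: has_sum_iff)
    show "((\<lambda>n. u (z * Q) (n + 1)) has_sum U l (a * Q) b (z * Q)) UNIV"
         "((\<lambda>n. u z (n + 1)) has_sum U l (a * Q) b z) UNIV"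
         "((\<lambda>n. u (z * Q) (n + 2)) has_sum U l (a * Q) b (z * Q)) UNIV"
      using us[OF z] us[OF zQ] by (auto simp: has_sum_iff)
  qed
  finally show ?thesis by (simp add: algebra_simps power2_eq_square)
qed

text \<open>
  Here \<open>S, S1, S2\<close> are the values at \<open>z, qz, q\<^sup>2z\<close> of a series proposed for \<open>U(a)\<close>, and \<open>S', S1'\<close> those at
  \<open>z, qz\<close> of the corresponding series for \<open>aq\<close>. The three relations force \<open>S\<close> to satisfy the contiguous relation
  of \<open>U\<close>. The factor \<open>1 - a\<close> stays on the series side, because at
  \<open>a = 1\<close> it cannot be divided out.
\<close>

lemma U_descent:
  assumes l: "off_spiral l" and z: "z \<noteq> 0"
    and S: "S' = S - a * S1" "S1' = S1 - a * S2"
    and rec: "Q * z * (S' - b * S1') = S2 - S1"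
    and IH: "U l (a * Q) b z = K * S'" "U l (a * Q) b (z * Q) = K * S1'"
  shows "U l a b z = (1 - a) * K * S"
proof -
  have "U l a b z = K * ((1 - a) * S' + a * S1' + a ^ 2 * (Q * z * (S' - b * S1')))"
    using U_contiguous[OF l z, of a b] unfolding IH by (simp add: algebra_simps power2_eq_square)
  also have "\<dots> = (1 - a) * K * S"
    unfolding rec unfolding S by (simp add: algebra_simps power2_eq_square)
  finally show ?thesis .
qed

text \<open>
  Only \<open>1 \<le> |a| < 1/q\<close> is left, one step above the range already covered. With \<open>t a z n\<close> the
  term of the series, splitting off the first factor of \<open>(-aqz/x;q)\<^sub>\<infinity>\<close> gives
  \<open>t a z = t (aq) z + a t a (qz)\<close>; it transfers summability to \<open>qz\<close> and \<open>q\<^sup>2z\<close>. The first order equation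
  \<open>pinf_ratio_step\<close> supplies the remaining relation.
\<close>

theorem U_eq_asymmetric_series:
  assumes l: "off_spiral l" and z: "z \<noteq> 0" and a: "norm (a * Q) < 1"
    and sm: "asym_term l a b z summable_on UNIV"
  shows "U l a b z = pinf a * infsum (asym_term l a b z) UNIV"
proof (cases "norm a < 1")
  case True
  thus ?thesis by (rule U_eq_asymmetric_series_small[OF l z])
next
  case False
  hence a0: "a \<noteq> 0" by auto
  have nz: "l \<noteq> 0" using l by (simp add: off_spiral_def)
  let ?t = "\<lambda>a z. asym_term l a b z"
  have x0: "X l n \<noteq> 0" for n using nz by simp
  have i: "?t a z n = ?t (a * Q) z n + a * ?t a (z * Q) n" if "z \<noteq> 0" for z n
  proof -
    define P where "P = pinf (- (a * Q * Q * z / X l n))"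
    have P: "pinf (- (a * Q * z / X l n)) = (1 + a * Q * z / X l n) * P"
      unfolding P_def by (subst pinf_step) (simp add: mult_ac)
    have w: "a * Q * z / X l n * W z (X l n) = a * W (z * Q) (X l n)"
      using W_shift_base[OF x0[of n] that] nz by (simp add: field_simps)
    have "?t a z n = pinf_ratio b (X l n) * P * W z (X l n) + pinf_ratio b (X l n) * P * (a * Q * z / X l n * W z (X l n))"
      unfolding asym_term_def P by (simp add: algebra_simps)
    also have "\<dots> = pinf_ratio b (X l n) * P * W z (X l n) + pinf_ratio b (X l n) * P * (a * W (z * Q) (X l n))"
      unfolding w ..
    finally show ?thesis unfolding asym_term_def P_def by (simp add: mult_ac)
  qed
  have iii: "Q * z * ?t (a * Q) z n = X l n * ?t a (z * Q) n" if "z \<noteq> 0" for z n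
  proof -
    have "Q * z * ?t (a * Q) z n = pinf_ratio b (X l n) * pinf (- (a * Q * Q * z / X l n)) * (z * Q * W z (X l n))"
      by (simp add: asym_term_def mult_ac)
    also have "z * Q * W z (X l n) = X l n * W (z * Q) (X l n)"
      using W_shift_base[OF x0[of n] that] by simp
    finally show ?thesis by (simp add: asym_term_def mult_ac)
  qed
  have ii: "(1 + X l n) * ?t a (z * Q) n = (1 + b * X l n) * ?t a (z * Q * Q) (n + 1)" for n
  proof -
    define P where "P = pinf (- (a * Q * (z * Q) / X l n)) * W (z * Q) (X l n)"
    have "(1 + X l n) * pinf_ratio b (X l n) = (1 + b * X l n) * pinf_ratio b (X l n * Q)"
      using l by (intro pinf_ratio_step) (simp add: off_spiral_X)
    moreover have "?t a (z * Q * Q) (n + 1) = pinf_ratio b (X l n * Q) * P"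
    proof -
      have "a * Q * (z * Q * Q) / (X l n * Q) = a * Q * (z * Q) / X l n" by simp
      thus ?thesis unfolding asym_term_def X_Suc W_scale P_def by (simp only: mult.assoc)
    qed
    moreover have "?t a (z * Q) n = pinf_ratio b (X l n) * P"
      unfolding asym_term_def P_def by (rule mult.assoc)
    ultimately show ?thesis by (simp only: mult.assoc[symmetric])
  qed
  have zQ: "z * Q \<noteq> 0" "z * Q * Q \<noteq> 0" using z by auto
  note base = U_eq_asymmetric_series_small[OF l _ a, of _ b]
  have sm1: "?t a (z * Q) summable_on UNIV"
  proof -
    have "(\<lambda>n. 1 / a * (?t a z n - ?t (a * Q) z n)) summable_on UNIV"
      by (intro summable_on_cmult_right summable_on_diff_complex sm base z)
    thus ?thesis using a0 by (simp add: i[OF z])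
  qed
  have sm2: "?t a (z * Q * Q) summable_on UNIV"
  proof -
    have "(\<lambda>n. 1 / a * (?t a (z * Q) n - ?t (a * Q) (z * Q) n)) summable_on UNIV"
      by (intro summable_on_cmult_right summable_on_diff_complex sm1 base zQ)
    thus ?thesis using a0 by (simp add: i[OF zQ(1)])
  qed
  have S: "infsum (?t (a * Q) z) UNIV = infsum (?t a z) UNIV - a * infsum (?t a (z * Q)) UNIV"
    if "z \<noteq> 0" "?t a (z * Q) summable_on UNIV" for z
  proof -
    have "?t a z = (\<lambda>n. ?t (a * Q) z n + a * ?t a (z * Q) n)" by (intro ext i that)
    hence "infsum (?t a z) UNIV = (\<Sum>\<^sub>\<infinity>n. ?t (a * Q) z n + a * ?t a (z * Q) n)" by simp
    also have "\<dots> = infsum (?t (a * Q) z) UNIV + a * infsum (?t a (z * Q)) UNIV"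
      by (intro infsumI has_sum_add has_sum_cmult_right has_sum_infsum that base)
    finally show ?thesis by simp
  qed
  show ?thesis
  proof -
    let ?S1 = "infsum (?t a (z * Q)) UNIV" and ?S2 = "infsum (?t a (z * Q * Q)) UNIV"
    let ?S' = "infsum (?t (a * Q) z) UNIV" and ?S1' = "infsum (?t (a * Q) (z * Q)) UNIV"
    have smx: "(\<lambda>n. X l n * ?t a (z * Q) n) summable_on UNIV"
      unfolding iii[OF z, symmetric] by (intro summable_on_cmult_right base z)
    have smy: "(\<lambda>n. X l n * ?t a (z * Q * Q) (n + 1)) summable_on UNIV"
    proof -
      have "(\<lambda>n. z * ?t (a * Q) (z * Q) (n + 1)) summable_on UNIV"
        using summable_on_int_shift[of "?t (a * Q) (z * Q)" 1] base(1)[OF zQ(1)]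
        by (intro summable_on_cmult_right) simp
      hence "(\<lambda>n. Q * (z * ?t (a * Q) (z * Q) (n + 1))) summable_on UNIV"
        by (rule summable_on_cmult_right)
      moreover have "Q * (z * ?t (a * Q) (z * Q) (n + 1)) = X l n * ?t a (z * Q * Q) (n + 1)" for n
        using iii[OF zQ(1), of "n + 1"] by (simp add: X_Suc mult_ac)
      ultimately show ?thesis by simp
    qed
    have e1: "Q * z * ?S' = (\<Sum>\<^sub>\<infinity>n. X l n * ?t a (z * Q) n)"
      unfolding iii[OF z, symmetric] by (simp add: infsum_cmult_right')
    have e2: "Q * z * ?S1' = (\<Sum>\<^sub>\<infinity>n. X l n * ?t a (z * Q * Q) (n + 1))"
    proof -
      have "Q * z * ?S1' = (\<Sum>\<^sub>\<infinity>n. Q * z * ?t (a * Q) (z * Q) (n + 1))"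
        unfolding infsum_cmult_right' infsum_int_shift[of "?t (a * Q) (z * Q)" 1] ..
      moreover have "Q * z * ?t (a * Q) (z * Q) (n + 1) = X l n * ?t a (z * Q * Q) (n + 1)" for n
        using iii[OF zQ(1), of "n + 1"] by (simp add: X_Suc mult_ac)
      ultimately show ?thesis by simp
    qed
    have "Q * z * (?S' - b * ?S1') = (\<Sum>\<^sub>\<infinity>n. X l n * ?t a (z * Q) n) - b * (\<Sum>\<^sub>\<infinity>n. X l n * ?t a (z * Q * Q) (n + 1))"
      unfolding e1[symmetric] e2[symmetric] by (simp add: algebra_simps)
    also have "\<dots> = (\<Sum>\<^sub>\<infinity>n. X l n * ?t a (z * Q) n - b * (X l n * ?t a (z * Q * Q) (n + 1)))"
      by (subst infsum_diff_complex[OF smx summable_on_cmult_right[OF smy]]) (simp add: infsum_cmult_right')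
    also have "\<dots> = (\<Sum>\<^sub>\<infinity>n. ?t a (z * Q * Q) (n + 1) - ?t a (z * Q) n)"
      using ii by (intro infsum_cong) (simp add: algebra_simps)
    also have "\<dots> = ?S2 - ?S1"
      using sm1 sm2 summable_on_int_shift[of "?t a (z * Q * Q)" 1] infsum_int_shift[of "?t a (z * Q * Q)" 1]
      by (subst infsum_diff_complex) auto
    finally have rec: "Q * z * (?S' - b * ?S1') = ?S2 - ?S1" .
    have "U l a b z = (1 - a) * pinf (a * Q) * infsum (?t a z) UNIV"
      by (rule U_descent[OF l z S[OF z sm1] S[OF zQ(1) sm2] rec base(2)[OF z] base(2)[OF zQ(1)]])
    thus ?thesis by (simp add: pinf_step[of a])
  qed
qed

section \<open>Jacobi's triple product and the Appell--Lerch sum\<close>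

lemma off_spiral_ii: "off_spiral \<i>"
proof -
  have "\<i> \<noteq> - (Q powi n)" for n
  proof
    assume "\<i> = - (Q powi n)"
    hence "Im \<i> = - Im (Q powi n)" by (metis uminus_complex.simps(2))
    moreover have "Q powi n = of_real (q powi n)" by (simp add: of_real_power_int)
    hence "Im (Q powi n) = 0" by (metis Im_complex_of_real)
    ultimately have "Im \<i> = 0" by simp
    thus False by simp
  qed
  thus ?thesis by (simp add: off_spiral_def)
qed

lemma off_spiral_mult_Q: "off_spiral (s * Q) \<longleftrightarrow> off_spiral s"
  using off_spiral_X[of s 1] by (simp add: X_def mult.commute)

lemma off_spiral_div_Q: "off_spiral (s / Q) \<longleftrightarrow> off_spiral s"
  using off_spiral_mult_Q[of "s / Q"] by simp

lemma F_one:
  assumes "norm a < 1" "off_spiral x" shows "F a 1 x = 1"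
proof -
  have "((\<lambda>k. a ^ k / pfin Q k * pinf_ratio 1 (x * Q ^ k)) has_sum (F a 1 x / pinf a)) UNIV"
    using F_geometric_expansion[OF assms(1) off_spiral_pinf_nz[OF assms(2)], of 1] by (simp add: pinf_ratio_def)
  moreover have "pinf_ratio 1 (x * Q ^ k) = 1" for k
    using off_spiral_pinf_nz[of "X x (int k)"] assms(2) by (simp add: pinf_ratio_def off_spiral_X) (simp add: X_def mult.commute)
  ultimately have "F a 1 x / pinf a = (\<Sum>\<^sub>\<infinity>k. pfin 0 k / pfin Q k * a ^ k)"
    by (simp add: has_sum_iff)
  also have "\<dots> = 1 / pinf a" using binomial_infsum(2)[OF assms(1) assms(1), of 0] by simp
  finally show ?thesis using pinf_nz_small[OF assms(1)] by simp
qed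

text \<open>
  For \<open>b = 1\<close> the function \<open>F\<close> is \<open>1\<close>, so \<open>U\<close> is the theta series divided by \<open>\<theta>(s)\<close>, where \<open>s = \<lambda>/z\<close>. On the
  other side choose \<open>a = -s\<close>: then \<open>(-aqz/x\<^sub>n;q)\<^sub>\<infinity> = (q\<^sup>1\<^sup>-\<^sup>n;q)\<^sub>\<infinity>\<close> vanishes for \<open>n > 0\<close>, and the rest is an Euler
  series. The functional equation removes the restriction \<open>|s| < 1\<close>; the auxiliary \<open>\<lambda> = \<i>\<close> just has to
  avoid \<open>-q\<^sup>\<int>\<close>.
\<close>

theorem jacobi_triple_product:
  assumes "off_spiral s"
  shows "(\<Sum>\<^sub>\<infinity>n. of_real (theta_coeff n) * s powi n) = theta_q q s"
proof -
  have small: "(\<Sum>\<^sub>\<infinity>n. of_real (theta_coeff n) * s powi n) = theta_q q s" if s: "off_spiral s" "norm s < 1" for s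
  proof -
    \<comment> \<open>with \<open>\<lambda> = \<i>\<close>, this makes \<open>\<lambda>/z = s\<close>\<close>
    define z where "z = \<i> / s"
    have s0: "s \<noteq> 0" using off_spiral_nz[OF s(1)] .
    have z: "z \<noteq> 0" using s0 by (simp add: z_def)
    have th: "theta_q q s \<noteq> 0" using theta_nz[OF s(1)] .
    have Wz: "W z (X \<i> n) = of_real (theta_coeff n) * s powi n / theta_q q s" for n
      using W_X[of \<i> z n] z s0 by (simp add: W_def z_def)
    define T where "T = asym_term \<i> (- s) 1 z"
    have T: "T n = pinf (Q powi (1 - n)) * (of_real (theta_coeff n) * s powi n / theta_q q s)" for n
    proof -
      have "pinf_ratio 1 (X \<i> n) = 1"
        using off_spiral_pinf_nz[of "X \<i> n"] off_spiral_ii by (simp add: pinf_ratio_def off_spiral_X)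
      moreover have "- (- s * Q * z / X \<i> n) = Q powi (1 - n)"
        using s0 by (simp add: z_def X_def power_int_diff)
      ultimately show ?thesis unfolding T_def asym_term_def Wz by simp
    qed
    have "((\<lambda>N. T (- int N)) has_sum (pinf Q * pinf (- Q / s) / theta_q q s)) UNIV"
    proof -
      have "((\<lambda>N. Q ^ (N choose 2) * (Q / s) ^ N / pfin Q N) has_sum pinf (- (Q / s))) UNIV"
        using euler_infsum[of "Q / s"] by (simp add: has_sum_iff)
      hence "((\<lambda>N. pinf Q / theta_q q s * (Q ^ (N choose 2) * (Q / s) ^ N / pfin Q N)) has_sum
          (pinf Q / theta_q q s * pinf (- (Q / s)))) UNIV"
        by (rule has_sum_cmult_right)
      moreover have "pinf Q / theta_q q s * (Q ^ (N choose 2) * (Q / s) ^ N / pfin Q N) = T (- int N)" for N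
      proof -
        have P: "pinf Q = pfin Q N * pinf (Q powi (1 + int N))"
          using pinf_split[of Q N] by (simp add: power_int_add)
        show ?thesis
          unfolding T theta_coeff_neg_nat P by (simp add: power_int_minus power_divide power_mult_distrib field_simps)
      qed
      ultimately show ?thesis by (simp add: mult_ac)
    qed
    hence "(T has_sum (pinf Q * pinf (- Q / s) / theta_q q s)) (range (\<lambda>N. - int N))"
      by (subst has_sum_reindex) (auto simp: o_def inj_on_def)
    moreover have "T n = 0" if "n \<in> UNIV - range (\<lambda>N. - int N)" for n
    proof -
      have "n > 0"
      proof (rule ccontr)
        assume "\<not> n > 0"
        hence "n = - int (nat (- n))" by simp
        thus False using that by blast
      qed
      hence "Q powi (1 - n) * Q ^ nat (n - 1) = 1"
        by (simp add: power_int_diff power_int_def field_simps flip: power_Suc)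
      hence "pinf (Q powi (1 - n)) = 0" by (auto simp: pinf_eq_0_iff)
      thus ?thesis by (simp add: T)
    qed
    ultimately have "(T has_sum (pinf Q * pinf (- Q / s) / theta_q q s)) UNIV"
      by (subst has_sum_cong_neutral[where S = UNIV and T = "range (\<lambda>N. - int N)" and g = T]) auto
    hence "infsum T UNIV = pinf Q * pinf (- Q / s) / theta_q q s" by (rule infsumI)
    moreover have "U \<i> (- s) 1 z = pinf (- s) * infsum T UNIV"
      unfolding T_def using s by (intro U_eq_asymmetric_series_small off_spiral_ii z) simp
    moreover have "U \<i> (- s) 1 z = (\<Sum>\<^sub>\<infinity>n. of_real (theta_coeff n) * s powi n) / theta_q q s"
    proof -
      have "F (- s) 1 (X \<i> n) = 1" for n
        using s off_spiral_ii by (intro F_one) (auto simp: off_spiral_X)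
      hence "U \<i> (- s) 1 z = (\<Sum>\<^sub>\<infinity>n. 1 / theta_q q s * (of_real (theta_coeff n) * s powi n))"
        unfolding U_def Wz by simp
      thus ?thesis unfolding infsum_cmult_right' by simp
    qed
    ultimately have "(\<Sum>\<^sub>\<infinity>n. of_real (theta_coeff n) * s powi n) = pinf Q * pinf (- s) * pinf (- Q / s)"
      using th by simp
    thus ?thesis by (simp add: theta_q_def)
  qed
  have "off_spiral s \<Longrightarrow> norm (s * Q ^ N) < 1 \<Longrightarrow> (\<Sum>\<^sub>\<infinity>n. of_real (theta_coeff n) * s powi n) = theta_q q s" for N s
  proof (induction N arbitrary: s)
    case (Suc N)
    have s0: "s \<noteq> 0" using off_spiral_nz[OF Suc.prems(1)] .
    have "(\<Sum>\<^sub>\<infinity>n. of_real (theta_coeff n) * s powi n) = (\<Sum>\<^sub>\<infinity>n. of_real (theta_coeff (n + 1)) * s powi (n + 1))"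
      using infsum_int_shift[of "\<lambda>n. of_real (theta_coeff n) * s powi n" 1] by simp
    also have "\<dots> = (\<Sum>\<^sub>\<infinity>n. s * (of_real (theta_coeff n) * (s * Q) powi n))"
      using s0 by (intro infsum_cong) (simp add: theta_coeff_Suc power_int_add power_int_mult_distrib of_real_power_int mult_ac)
    also have "\<dots> = s * theta_q q (s * Q)"
    proof -
      have "norm (s * Q * Q ^ N) < 1" using Suc.prems(2) by (simp add: mult.assoc)
      from Suc.IH[OF _ this] show ?thesis
        unfolding infsum_cmult_right' using Suc.prems(1) by (simp add: off_spiral_mult_Q)
    qed
    also have "\<dots> = theta_q q s" using theta_shift[OF s0] by (simp add: mult.commute)
    finally show ?case .
  qed (use small in simp)
  with exists_small_power[of s] show ?thesis using assms by blast
qed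

subsection \<open>Partial theta coefficients\<close>

definition partial_theta :: "nat \<Rightarrow> real" where
  "partial_theta m = (\<Sum>j. (- 1) ^ j * q ^ ((m + 1 + j) choose 2))"

text \<open>
  The Laurent coefficients of \<open>\<theta>(t)/(1 + t)\<close>. Written with \<open>|k|\<close> they are visibly even in \<open>k\<close>, and that
  evenness is the source of the symmetry of the Appell--Lerch sum.
\<close>

definition quotient_coeff :: "int \<Rightarrow> real" where "quotient_coeff k = partial_theta (nat \<bar>k\<bar>)"

lemma partial_theta_term_bound: "norm ((- 1) ^ j * q ^ ((m + 1 + j) choose 2)) \<le> q ^ ((m + 1) choose 2) * q ^ j"
proof -
  have "(m + 1 choose 2) + j \<le> (m + 1 + j) choose 2" unfolding choose_two_add by simp
  hence "q ^ ((m + 1 + j) choose 2) \<le> q ^ ((m + 1 choose 2) + j)"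
    using q_pos q_lt_1 by (intro power_decreasing) auto
  thus ?thesis using q_pos by (simp add: abs_mult power_abs power_add)
qed

lemma partial_theta_summable: "summable (\<lambda>j. (- 1) ^ j * q ^ ((m + 1 + j) choose 2))"
proof (rule summable_comparison_test')
  show "summable (\<lambda>j. q ^ ((m + 1) choose 2) * q ^ j)"
    using q_pos q_lt_1 by (intro summable_mult summable_geometric) auto
qed (rule partial_theta_term_bound)

lemma partial_theta_bound: "\<bar>partial_theta m\<bar> \<le> 1 / (1 - q) * q ^ ((m + 1) choose 2)"
proof -
  have g: "(\<lambda>j. q ^ ((m + 1) choose 2) * q ^ j) sums (q ^ ((m + 1) choose 2) * (1 / (1 - q)))"
    using q_pos q_lt_1 by (intro sums_mult geometric_sums) auto
  have "norm (partial_theta m) \<le> (\<Sum>j. q ^ ((m + 1) choose 2) * q ^ j)"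
    unfolding partial_theta_def
    by (rule norm_suminf_le[OF partial_theta_term_bound sums_summable[OF g]])
  also have "\<dots> = q ^ ((m + 1) choose 2) * (1 / (1 - q))" using sums_unique[OF g] by simp
  finally show ?thesis by (simp add: mult_ac)
qed

lemma partial_theta_step: "partial_theta m + partial_theta (Suc m) = q ^ (Suc m choose 2)"
proof -
  have "partial_theta m = (\<Sum>j. (- 1) ^ Suc j * q ^ ((m + 1 + Suc j) choose 2)) + q ^ (Suc m choose 2)"
    using suminf_split_head[OF partial_theta_summable[of m]] by (simp add: partial_theta_def)
  also have "(\<Sum>j. (- 1) ^ Suc j * q ^ ((m + 1 + Suc j) choose 2)) = (\<Sum>j. - ((- 1) ^ j * q ^ ((Suc m + 1 + j) choose 2)))"
    by simp
  also have "\<dots> = - partial_theta (Suc m)"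
    unfolding partial_theta_def by (rule suminf_minus[OF partial_theta_summable])
  finally show ?thesis by simp
qed

lemma quotient_coeff_minus [simp]: "quotient_coeff (- k) = quotient_coeff k" by (simp add: quotient_coeff_def)

lemma quotient_coeff_step: "quotient_coeff k + quotient_coeff (k - 1) = theta_coeff k"
proof (cases "k \<ge> 1")
  case True
  then obtain m where "k - 1 = int m" using zero_le_imp_eq_int[of "k - 1"] by auto
  hence m: "k = int (Suc m)" by simp
  have "nat \<bar>k\<bar> = Suc m" "nat \<bar>k - 1\<bar> = m" by (simp_all add: m)
  thus ?thesis using partial_theta_step[of m] theta_coeff_nat[of "Suc m"] by (simp add: quotient_coeff_def m add.commute)
next
  case False
  then obtain m where "- k = int m" using zero_le_imp_eq_int[of "- k"] by auto
  hence m: "k = - int m" by simp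
  have "nat \<bar>k\<bar> = m" "nat \<bar>k - 1\<bar> = Suc m" by (simp_all add: m)
  thus ?thesis using partial_theta_step[of m] theta_coeff_neg_nat[of m] by (simp add: quotient_coeff_def m choose_two_Suc power_add)
qed

lemma quotient_coeff_bound: "\<bar>quotient_coeff k\<bar> \<le> 1 / (1 - q) * theta_coeff k"
proof -
  have "q ^ ((nat \<bar>k\<bar> + 1) choose 2) \<le> theta_coeff k"
  proof (cases k rule: int_cases2)
    case (nonneg m)
    have "q ^ (Suc m choose 2) \<le> q ^ (m choose 2)"
      using q_pos q_lt_1 by (intro power_decreasing) (auto simp: choose_two_Suc)
    thus ?thesis using theta_coeff_nat[of m] by (simp add: nonneg)
  next
    case (nonpos m)
    thus ?thesis using theta_coeff_neg_nat[of m] by (simp add: choose_two_Suc power_add)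
  qed
  hence "1 / (1 - q) * q ^ ((nat \<bar>k\<bar> + 1) choose 2) \<le> 1 / (1 - q) * theta_coeff k"
    using q_lt_1 by (intro mult_left_mono) auto
  thus ?thesis using partial_theta_bound[of "nat \<bar>k\<bar>"] by (simp add: quotient_coeff_def)
qed

text \<open>
  Multiplying the series by \<open>1 + t\<close> gives the theta series, by \<open>quotient_coeff_step\<close>.
\<close>

lemma theta_divided:
  assumes t: "off_spiral t"
  shows "((\<lambda>k. of_real (quotient_coeff k) * t powi k) has_sum (theta_q q t / (1 + t))) UNIV"
proof -
  have t0: "t \<noteq> 0" using off_spiral_nz[OF t] .
  let ?f = "\<lambda>k. of_real (quotient_coeff k) * t powi k"
  have sm: "?f summable_on UNIV"
  proof (rule summable_on_dominated)
    show "(\<lambda>n. 1 / (1 - q) * (theta_coeff n * norm t powi n * 1 ^ nat (- n))) summable_on UNIV"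
      using t0 by (intro summable_on_cmult_right theta_coeff_summable) auto
    show "norm (?f n) \<le> 1 / (1 - q) * (theta_coeff n * norm t powi n * 1 ^ nat (- n))" for n
      using mult_right_mono[OF quotient_coeff_bound[of n], of "norm t powi n"] by (simp add: norm_mult norm_power_int)
  qed
  define S where "S = infsum ?f UNIV"
  have 1: "(?f has_sum S) UNIV" using sm by (simp add: S_def)
  have "((\<lambda>k. ?f (k + (- 1))) has_sum S) UNIV"
    using summable_on_int_shift[of ?f "- 1"] infsum_int_shift[of ?f "- 1"] sm by (simp add: has_sum_iff S_def)
  hence "((\<lambda>k. t * ?f (k + (- 1))) has_sum (t * S)) UNIV" by (rule has_sum_cmult_right)
  from has_sum_add[OF 1 this] have "((\<lambda>k. ?f k + t * ?f (k + (- 1))) has_sum (S + t * S)) UNIV" .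
  moreover have "?f k + t * ?f (k + (- 1)) = of_real (theta_coeff k) * t powi k" for k
    unfolding quotient_coeff_step[symmetric] using t0 by (simp add: power_int_diff algebra_simps)
  ultimately have "((\<lambda>k. of_real (theta_coeff k) * t powi k) has_sum (S + t * S)) UNIV" by simp
  hence "theta_q q t = S + t * S" using jacobi_triple_product[OF t] by (simp add: has_sum_iff)
  hence "S = theta_q q t / (1 + t)" using off_spiral_one_plus[OF t] by (simp add: field_simps)
  thus ?thesis using 1 by simp
qed

definition lerch :: "complex \<Rightarrow> complex \<Rightarrow> complex" where
  "lerch l s = (\<Sum>\<^sub>\<infinity>n. of_real (theta_coeff n) * s powi n / (1 + X l n))"

lemma inverse_theta_X:
  assumes "l \<noteq> 0" shows "1 / theta_q q (X l n) = of_real (theta_coeff n) * l powi n / theta_q q l"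
  using W_X[OF assms, of 1 n] by (simp add: W_def)

definition lerch_kernel where
  "lerch_kernel l s n m = of_real (quotient_coeff (m - n)) * l powi m * s powi n * Q powi (n * m)"

lemma lerch_kernel_swap: "lerch_kernel l s n m = lerch_kernel s l m n"
  using quotient_coeff_minus[of "m - n"] by (simp add: lerch_kernel_def mult_ac)

lemma lerch_kernel_summable:
  assumes "l \<noteq> 0" "s \<noteq> 0"
  shows "(\<lambda>(n, m). lerch_kernel l s n m) summable_on UNIV \<times> UNIV"
proof (rule summable_on_product_dominated)
  show "(\<lambda>n. 1 / (1 - q) * (theta_coeff n * (q * norm s) powi n * 1 ^ nat (- n))) summable_on UNIV"
    using assms q_pos by (intro summable_on_cmult_right theta_coeff_summable) auto
  show "(\<lambda>m. theta_coeff m * norm l powi m * 1 ^ nat (- m)) summable_on UNIV"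
    using assms by (intro theta_coeff_summable) auto
  show "norm (lerch_kernel l s n m) \<le> (1 / (1 - q) * (theta_coeff n * (q * norm s) powi n * 1 ^ nat (- n))) *
      (theta_coeff m * norm l powi m * 1 ^ nat (- m))" for n m
  proof -
    have g: "theta_coeff (m - n) * q powi (n * m) = theta_coeff m * (theta_coeff n * q powi n)"
    proof -
      have "theta_coeff (m - n) = theta_coeff m * (theta_coeff n * q powi n) * q powi (m * (- n))"
        using theta_coeff_add[of m "- n"] by (simp add: theta_coeff_uminus)
      moreover have "q powi (m * (- n)) * q powi (n * m) = 1"
        by (simp flip: power_int_add add: mult.commute)
      ultimately show ?thesis by (simp add: mult.assoc)
    qed
    have "norm (lerch_kernel l s n m) = \<bar>quotient_coeff (m - n)\<bar> * (norm l powi m * norm s powi n * q powi (n * m))"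
      using q_pos by (simp add: lerch_kernel_def norm_mult norm_power_int)
    also have "\<dots> \<le> (1 / (1 - q) * theta_coeff (m - n)) * (norm l powi m * norm s powi n * q powi (n * m))"
      using q_pos by (intro mult_right_mono quotient_coeff_bound) auto
    also have "\<dots> = 1 / (1 - q) * (theta_coeff (m - n) * q powi (n * m)) * norm l powi m * norm s powi n"
      by (simp only: mult_ac)
    finally show ?thesis unfolding g by (simp add: power_int_mult_distrib mult_ac)
  qed
qed (use q_pos q_lt_1 in \<open>auto intro!: divide_nonneg_nonneg mult_nonneg_nonneg zero_le_power_int\<close>)

text \<open>
  Move \<open>\<theta>(l)\<close> to \<open>\<theta>(q\<^sup>n l)\<close> by quasi-periodicity, divide by \<open>1 + q\<^sup>n l\<close>, and collect the powers of \<open>l\<close>.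
  All exponents of \<open>q\<close> combine to \<open>nm\<close>.
\<close>

lemma theta_times_lerch:
  assumes l: "off_spiral l" and s: "s \<noteq> 0"
  shows "theta_q q l * lerch l (Q * s) = (\<Sum>\<^sub>\<infinity>n. \<Sum>\<^sub>\<infinity>m. lerch_kernel l s n m)"
proof -
  have l0: "l \<noteq> 0" using off_spiral_nz[OF l] .
  have "theta_q q l * (of_real (theta_coeff n) * (Q * s) powi n / (1 + X l n)) = (\<Sum>\<^sub>\<infinity>m. lerch_kernel l s n m)" for n
  proof -
    have x: "off_spiral (X l n)" using l by (simp add: off_spiral_X)
    have 1: "theta_q q l = of_real (theta_coeff n) * l powi n * theta_q q (X l n)"
      using inverse_theta_X[OF l0, of n] theta_nz[OF x] theta_nz[OF l] by (simp add: field_simps)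
    let ?c = "of_real (theta_coeff n) * l powi n * (of_real (theta_coeff n) * (Q * s) powi n)"
    have "theta_q q l * (of_real (theta_coeff n) * (Q * s) powi n / (1 + X l n)) = ?c * (theta_q q (X l n) / (1 + X l n))"
      unfolding 1 by simp
    also have "theta_q q (X l n) / (1 + X l n) = (\<Sum>\<^sub>\<infinity>k. of_real (quotient_coeff k) * X l n powi k)"
      using theta_divided[OF x] by (simp add: has_sum_iff)
    also have "\<dots> = (\<Sum>\<^sub>\<infinity>m. of_real (quotient_coeff (m + (- n))) * X l n powi (m + (- n)))"
      by (rule infsum_int_shift[symmetric, of "\<lambda>k. of_real (quotient_coeff k) * X l n powi k"])
    also have "?c * \<dots> = (\<Sum>\<^sub>\<infinity>m. ?c * (of_real (quotient_coeff (m + (- n))) * X l n powi (m + (- n))))"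
      by (rule infsum_cmult_right'[symmetric])
    also have "\<dots> = (\<Sum>\<^sub>\<infinity>m. lerch_kernel l s n m)"
    proof (rule infsum_cong)
      fix m :: int
      have "theta_coeff n * theta_coeff n * q powi n * q powi (- (n * n)) = 1"
        using theta_coeff_add[of n "- n"] by (simp add: theta_coeff_uminus mult_ac)
      hence g: "of_real (theta_coeff n) * of_real (theta_coeff n) * Q powi n * Q powi (- (n * n)) = 1"
        by (metis of_real_1 of_real_mult of_real_power_int)
      have "X l n powi (m + (- n)) = Q powi (n * m) * Q powi (- (n * n)) * l powi m * l powi (- n)"
        using l0 by (simp add: X_def power_int_mult_distrib power_int_add power_int_mult[symmetric]
           right_diff_distrib power_int_diff power_int_minus divide_inverse)
      moreover have "l powi n * l powi (- n) = 1" using l0 by (simp add: power_int_minus)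
      ultimately have "?c * (of_real (quotient_coeff (m + (- n))) * X l n powi (m + (- n))) =
         (of_real (theta_coeff n) * of_real (theta_coeff n) * Q powi n * Q powi (- (n * n))) * (l powi n * l powi (- n)) *
           (of_real (quotient_coeff (m - n)) * l powi m * s powi n * Q powi (n * m))"
        by (simp add: power_int_mult_distrib mult_ac)
      also have "\<dots> = lerch_kernel l s n m"
        unfolding g \<open>l powi n * l powi (- n) = 1\<close> by (simp add: lerch_kernel_def)
      finally show "?c * (of_real (quotient_coeff (m + (- n))) * X l n powi (m + (- n))) = lerch_kernel l s n m" .
    qed
    finally show ?thesis .
  qed
  thus ?thesis unfolding lerch_def infsum_cmult_right'[symmetric] by simp
qed

lemma lerch_symmetric:
  assumes l: "off_spiral l" and s: "off_spiral s"
  shows "theta_q q l * lerch l (Q * s) = theta_q q s * lerch s (Q * l)"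
proof -
  have "theta_q q l * lerch l (Q * s) = (\<Sum>\<^sub>\<infinity>n. \<Sum>\<^sub>\<infinity>m. lerch_kernel l s n m)"
    by (rule theta_times_lerch[OF l off_spiral_nz[OF s]])
  also have "\<dots> = (\<Sum>\<^sub>\<infinity>m. \<Sum>\<^sub>\<infinity>n. lerch_kernel l s n m)"
    by (rule infsum_swap_banach[OF lerch_kernel_summable[OF off_spiral_nz[OF l] off_spiral_nz[OF s]]])
  also have "\<dots> = theta_q q s * lerch s (Q * l)"
    unfolding lerch_kernel_swap[of l s] theta_times_lerch[OF s off_spiral_nz[OF l]] ..
  finally show ?thesis .
qed

text \<open>
  Both sides are Appell--Lerch sums, with the roles of \<open>\<lambda>\<close> and \<open>\<lambda>/z\<close> exchanged up to a shift by \<open>q\<close>.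
\<close>

theorem lerch_partial_fractions:
  assumes l: "off_spiral l" and z: "z \<noteq> 0" and lz: "off_spiral (l / z)"
  shows "(\<Sum>\<^sub>\<infinity>n. W z (X l n) / (1 + X l n)) = (\<Sum>\<^sub>\<infinity>p. X l p / (X l p + z) / theta_q q (X l p * Q))"
proof -
  define s where "s = l / z"
  have l0: "l \<noteq> 0" using off_spiral_nz[OF l] .
  have s0: "s \<noteq> 0" using l0 z by (simp add: s_def)
  have s: "off_spiral s" using lz by (simp add: s_def)
  have thl: "theta_q q l \<noteq> 0" and ths: "theta_q q s \<noteq> 0" using theta_nz l s by auto
  have "(\<Sum>\<^sub>\<infinity>n. W z (X l n) / (1 + X l n)) = (\<Sum>\<^sub>\<infinity>n. 1 / theta_q q s * (of_real (theta_coeff n) * s powi n / (1 + X l n)))"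
    using W_X[OF l0 z] by (intro infsum_cong) (simp add: W_def s_def)
  also have "\<dots> = lerch l s / theta_q q s"
    unfolding infsum_cmult_right' lerch_def by simp
  finally have A: "(\<Sum>\<^sub>\<infinity>n. W z (X l n) / (1 + X l n)) = lerch l s / theta_q q s" .
  have "(\<Sum>\<^sub>\<infinity>p. X l p / (X l p + z) / theta_q q (X l p * Q)) =
      (\<Sum>\<^sub>\<infinity>n. X l (n - 1) / (X l (n - 1) + z) / theta_q q (X l n))"
    using infsum_int_shift[of "\<lambda>p. X l p / (X l p + z) / theta_q q (X l p * Q)" "- 1"]
    by (simp add: X_pred)
  also have "\<dots> = (\<Sum>\<^sub>\<infinity>n. s / Q / theta_q q l * (of_real (theta_coeff n) * (Q * l) powi n / (1 + X (s / Q) n)))"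
  proof (rule infsum_cong)
    fix n
    have "X l (n - 1) = z * X (s / Q) n" using z by (simp add: X_def s_def power_int_diff)
    hence "X l (n - 1) / (X l (n - 1) + z) = (z * X (s / Q) n) / (z * (1 + X (s / Q) n))"
      by (simp add: algebra_simps)
    also have "\<dots> = X (s / Q) n / (1 + X (s / Q) n)" using z by simp
    finally have 1: "X l (n - 1) / (X l (n - 1) + z) = s / Q * Q powi n / (1 + X (s / Q) n)"
      by (simp add: X_def mult_ac)
    have 2: "1 / theta_q q (X l n) = of_real (theta_coeff n) * l powi n / theta_q q l"
      by (rule inverse_theta_X[OF l0])
    have "X l (n - 1) / (X l (n - 1) + z) / theta_q q (X l n) =
       s / Q * Q powi n / (1 + X (s / Q) n) * (1 / theta_q q (X l n))" unfolding 1 by simp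
    thus "X l (n - 1) / (X l (n - 1) + z) / theta_q q (X l n) =
       s / Q / theta_q q l * (of_real (theta_coeff n) * (Q * l) powi n / (1 + X (s / Q) n))"
      unfolding 2 by (simp add: power_int_mult_distrib mult_ac)
  qed
  also have "\<dots> = s / Q / theta_q q l * lerch (s / Q) (Q * l)"
    unfolding infsum_cmult_right' lerch_def ..
  also have "\<dots> = lerch l s / theta_q q s"
  proof -
    have "theta_q q l * lerch l (Q * (s / Q)) = theta_q q (s / Q) * lerch (s / Q) (Q * l)"
      using s by (intro lerch_symmetric l) (simp add: off_spiral_div_Q)
    moreover have "theta_q q s * (s / Q) = theta_q q (s / Q)"
      using theta_shift[of "s / Q"] s0 by simp
    ultimately have "theta_q q l * lerch l s = theta_q q s * (s / Q) * lerch (s / Q) (Q * l)" by simp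
    hence "lerch l s = theta_q q s * (s / Q * lerch (s / Q) (Q * l) / theta_q q l)"
      using thl by (simp add: field_simps)
    thus ?thesis using ths by simp
  qed
  finally show ?thesis using A by simp
qed

section \<open>Partial fractions in z\<close>

text \<open>
  For \<open>a \<noteq> 0\<close> this is \<open>(q/a;q)\<^sub>j a\<^sup>j/(q;q)\<^sub>j\<close>. The product form is polynomial in \<open>a\<close> and so includes \<open>a = 0\<close>; the
  generating function is \<open>(qt;q)\<^sub>\<infinity>/(at;q)\<^sub>\<infinity>\<close>.
\<close>

definition ratio_coeff :: "complex \<Rightarrow> nat \<Rightarrow> complex" where
  "ratio_coeff a j = (\<Prod>i<j. a - Q ^ Suc i) / pfin Q j"

lemma ratio_coeff_0 [simp]: "ratio_coeff a 0 = 1" by (simp add: ratio_coeff_def)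

lemma ratio_coeff_Suc: "ratio_coeff a (Suc j) * (1 - Q ^ Suc j) = ratio_coeff a j * (a - Q ^ Suc j)"
  using Q_pow_ne_1[of j] by (simp add: ratio_coeff_def pfin_Suc)

lemma ratio_coeff_mult_Q_aux: "ratio_coeff (a * Q) (Suc j) * (1 - Q ^ Suc j) = Q ^ Suc j * (a - 1) * ratio_coeff a j"
proof -
  have "(\<Prod>i<Suc j. a * Q - Q ^ Suc i) = (\<Prod>i<Suc j. Q * (a - Q ^ i))"
    by (intro prod.cong) (simp_all add: algebra_simps)
  also have "\<dots> = Q ^ Suc j * ((a - 1) * (\<Prod>i<j. a - Q ^ Suc i))"
    unfolding prod.distrib by (subst (2) prod.lessThan_Suc_shift) simp
  finally show ?thesis using Q_pow_ne_1[of j] by (simp add: ratio_coeff_def pfin_Suc)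
qed

lemma ratio_coeff_mult_Q: "ratio_coeff (a * Q) (Suc j) = ratio_coeff a (Suc j) - a * ratio_coeff a j"
proof -
  have "ratio_coeff (a * Q) (Suc j) * (1 - Q ^ Suc j) = (ratio_coeff a (Suc j) - a * ratio_coeff a j) * (1 - Q ^ Suc j)"
    unfolding ratio_coeff_mult_Q_aux left_diff_distrib ratio_coeff_Suc[of a] mult.assoc[of a] by (simp add: algebra_simps)
  thus ?thesis using Q_pow_ne_1[of j] by simp
qed

lemma ratio_coeff_mult_Q': "ratio_coeff (a * Q) (Suc j) = Q ^ Suc j * (ratio_coeff a (Suc j) - ratio_coeff a j)"
proof -
  have "(ratio_coeff a (Suc j) - ratio_coeff a j) * (1 - Q ^ Suc j) = (a - 1) * ratio_coeff a j"
    unfolding left_diff_distrib ratio_coeff_Suc[of a] by (simp add: algebra_simps)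
  hence "ratio_coeff (a * Q) (Suc j) * (1 - Q ^ Suc j) = Q ^ Suc j * (ratio_coeff a (Suc j) - ratio_coeff a j) * (1 - Q ^ Suc j)"
    unfolding ratio_coeff_mult_Q_aux by (simp only: mult.assoc)
  thus ?thesis using Q_pow_ne_1[of j] by simp
qed

lemma ratio_coeff_bound: "\<exists>C>0. \<forall>j. norm (ratio_coeff a j) \<le> C * (norm a + 1) ^ j"
proof -
  obtain C where C: "C > 0" "\<And>n. norm (1 / pfin Q n) \<le> C" using pfin_Q_inverse_bounded by blast
  have "norm (ratio_coeff a j) \<le> C * (norm a + 1) ^ j" for j
  proof -
    have "norm (\<Prod>i<j. a - Q ^ Suc i) \<le> (\<Prod>i<j. norm a + 1)"
      unfolding prod_norm[symmetric]
    proof (intro prod_mono conjI)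
      fix i
      have "norm (Q ^ Suc i) \<le> 1" using q_pow_le_1[of "Suc i"] by (metis norm_Q norm_power)
      thus "norm (a - Q ^ Suc i) \<le> norm a + 1" using norm_triangle_ineq4[of a "Q ^ Suc i"] by linarith
    qed auto
    hence "norm (1 / pfin Q j) * norm (\<Prod>i<j. a - Q ^ Suc i) \<le> C * (norm a + 1) ^ j"
      using C by (intro mult_mono) auto
    thus ?thesis by (simp add: ratio_coeff_def norm_divide)
  qed
  thus ?thesis using C(1) by blast
qed

lemma ratio_coeff_summable:
  assumes a: "norm a < 1" shows "summable (\<lambda>j. norm (ratio_coeff a j))"
proof -
  obtain c where c: "norm a < c" "c < 1" using dense a by blast
  have qs: "(\<lambda>j. Q ^ Suc j) \<longlonglongrightarrow> 0" by (rule LIMSEQ_Suc[OF q_pow_LIMSEQ])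
  have "(\<lambda>j. norm ((a - Q ^ Suc j) / (1 - Q ^ Suc j))) \<longlonglongrightarrow> norm ((a - 0) / (1 - 0))"
    by (intro tendsto_norm tendsto_divide tendsto_diff tendsto_const qs) simp
  hence "eventually (\<lambda>j. norm ((a - Q ^ Suc j) / (1 - Q ^ Suc j)) < c) sequentially"
    using c by (intro order_tendstoD) auto
  then obtain N where N: "\<And>j. j \<ge> N \<Longrightarrow> norm ((a - Q ^ Suc j) / (1 - Q ^ Suc j)) < c"
    by (auto simp: eventually_sequentially)
  show ?thesis
  proof (rule summable_ratio_test[of c N])
    fix j assume "j \<ge> N"
    have "ratio_coeff a (Suc j) = (a - Q ^ Suc j) / (1 - Q ^ Suc j) * ratio_coeff a j"
      using ratio_coeff_Suc[of a j] Q_pow_ne_1[of j] by (simp add: nonzero_eq_divide_eq mult.commute)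
    hence "norm (ratio_coeff a (Suc j)) = norm ((a - Q ^ Suc j) / (1 - Q ^ Suc j)) * norm (ratio_coeff a j)"
      by (metis norm_mult)
    also have "\<dots> \<le> c * norm (ratio_coeff a j)" using N[OF \<open>j \<ge> N\<close>] by (intro mult_right_mono) auto
    finally show "norm (norm (ratio_coeff a (Suc j))) \<le> c * norm (norm (ratio_coeff a j))" by simp
  qed (use c in simp)
qed

lemma ratio_coeff_sums:
  assumes a: "norm a < 1" shows "ratio_coeff a sums (pinf Q / pinf a)"
proof -
  have sm: "summable (\<lambda>j. norm (ratio_coeff a j * 1 ^ j))" using ratio_coeff_summable[OF a] by simp
  have "pinf (a * 1) * (\<Sum>j. ratio_coeff a j * 1 ^ j) = pinf (Q * 1) * ratio_coeff a 0"
    by (rule q_difference_power_series[OF _ sm]) (use ratio_coeff_Suc in simp)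
  hence "suminf (ratio_coeff a) = pinf Q / pinf a" using pinf_nz_small[OF a] by (simp add: field_simps)
  with summable_sums[OF summable_norm_cancel[OF ratio_coeff_summable[OF a]]] show ?thesis by simp
qed

lemma ratio_coeff_norm_summable_on:
  assumes "norm a < 1" shows "(\<lambda>j. norm (ratio_coeff a j)) summable_on UNIV"
  using ratio_coeff_summable[OF assms] by (subst summable_on_UNIV_nonneg_real_iff) auto

text \<open>
  The series satisfies the same first order \<open>q\<close>-difference equation as \<open>pinf_ratio a\<close>: with \<open>y\<close> the point in question,
  subtracting \<open>\<Sum> ratio_coeff a j\<close> from both sides leaves the same sum \<open>\<Sum> r j\<close>, once started at \<open>j = 0\<close>, where
  \<open>r\<close> vanishes, and once at \<open>j = 1\<close>. The value at the origin is \<open>ratio_coeff_sums\<close>.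
\<close>

lemma pinf_ratio_partial_fractions:
  assumes a: "norm a < 1" and x: "off_spiral x"
  shows "((\<lambda>j. ratio_coeff a j / (1 + x * Q ^ j)) has_sum (pinf_ratio a x * pinf Q / pinf a)) UNIV"
proof -
  obtain C where C: "C > 0" "\<And>n. norm (1 / (1 + X x n)) \<le> C"
    using one_plus_X_bounded_below[OF x] by blast
  have C': "norm (1 / (1 + x * Q ^ n)) \<le> C" for n
    using C(2)[of "int n"] by (simp add: X_def mult.commute)
  have nz: "1 + x * Q ^ n \<noteq> 0" for n
    using off_spiral_one_plus[of "X x (int n)"] x by (simp add: off_spiral_X) (simp add: X_def mult.commute)
  define p where "p n = (\<Sum>j. ratio_coeff a j / (1 + x * Q ^ n * Q ^ j))" for n
  have nsm: "summable (\<lambda>j. norm (ratio_coeff a j / (1 + x * Q ^ n * Q ^ j)))" for n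
  proof (rule summable_comparison_test'[OF summable_mult[OF ratio_coeff_summable[OF a], of C]])
    fix j
    have "norm (1 / (1 + x * Q ^ (n + j))) * norm (ratio_coeff a j) \<le> C * norm (ratio_coeff a j)"
      by (intro mult_right_mono C') auto
    thus "norm (norm (ratio_coeff a j / (1 + x * Q ^ n * Q ^ j))) \<le> C * norm (ratio_coeff a j)"
      by (simp add: norm_divide power_add mult_ac)
  qed
  have sp: "(\<lambda>j. ratio_coeff a j / (1 + x * Q ^ n * Q ^ j)) sums p n" for n
    unfolding p_def by (rule summable_sums[OF summable_norm_cancel[OF nsm]])
  have rec: "(1 - - x * Q ^ n) * p n = (1 - - a * x * Q ^ n) * p (Suc n)" for n
  proof -
    define y where "y = x * Q ^ n"
    \<comment> \<open>what remains of the terms of both sides after splitting off \<open>ratio_coeff a j\<close>\<close>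
    define r where "r j = y * (1 - Q ^ j) * ratio_coeff a j / (1 + y * Q ^ j)" for j
    have y: "1 + y * Q ^ j \<noteq> 0" for j using nz[of "n + j"] by (simp add: y_def power_add mult_ac)
    have r1: "(1 + y) * (ratio_coeff a j / (1 + y * Q ^ j)) - ratio_coeff a j = r j" for j
    proof -
      have "1 + y = (1 + y * Q ^ j) + y * (1 - Q ^ j)" by (simp add: algebra_simps)
      hence "(1 + y) * (ratio_coeff a j / (1 + y * Q ^ j)) = ((1 + y * Q ^ j) + y * (1 - Q ^ j)) * (ratio_coeff a j / (1 + y * Q ^ j))"
        by simp
      also have "\<dots> = (1 + y * Q ^ j) * (ratio_coeff a j / (1 + y * Q ^ j)) + r j"
        unfolding distrib_right r_def by simp
      finally show ?thesis using y[of j] by simp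
    qed
    have r2: "(1 + a * y) * (ratio_coeff a j / (1 + y * Q ^ Suc j)) - ratio_coeff a j = r (Suc j)" for j
    proof -
      have "1 + a * y = (1 + y * Q ^ Suc j) + y * (a - Q ^ Suc j)" by (simp add: algebra_simps)
      hence "(1 + a * y) * (ratio_coeff a j / (1 + y * Q ^ Suc j)) =
          ((1 + y * Q ^ Suc j) + y * (a - Q ^ Suc j)) * (ratio_coeff a j / (1 + y * Q ^ Suc j))"
        by simp
      also have "\<dots> = (1 + y * Q ^ Suc j) * (ratio_coeff a j / (1 + y * Q ^ Suc j)) + y * (ratio_coeff a j * (a - Q ^ Suc j)) / (1 + y * Q ^ Suc j)"
        unfolding distrib_right by simp
      also have "y * (ratio_coeff a j * (a - Q ^ Suc j)) / (1 + y * Q ^ Suc j) = r (Suc j)"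
        unfolding ratio_coeff_Suc[symmetric] r_def by (simp only: mult_ac)
      also have "(1 + y * Q ^ Suc j) * (ratio_coeff a j / (1 + y * Q ^ Suc j)) = ratio_coeff a j" using y[of "Suc j"] by simp
      finally show ?thesis by simp
    qed
    have s1: "(\<lambda>j. r j) sums ((1 + y) * p n - pinf Q / pinf a)"
      unfolding r1[symmetric] using sp[of n] by (intro sums_diff sums_mult ratio_coeff_sums a) (simp add: y_def)
    have s2: "(\<lambda>j. r (Suc j)) sums ((1 + a * y) * p (Suc n) - pinf Q / pinf a)"
      unfolding r2[symmetric] using sp[of "Suc n"]
      by (intro sums_diff sums_mult ratio_coeff_sums a) (simp add: y_def mult_ac)
    have "r 0 = 0" by (simp add: r_def)
    hence "(\<lambda>j. r j) sums ((1 + a * y) * p (Suc n) - pinf Q / pinf a)"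
      using s2 sums_Suc_iff[of r] by simp
    from sums_unique2[OF s1 this] show ?thesis by (simp add: y_def mult_ac)
  qed
  have lim: "p \<longlonglongrightarrow> pinf Q / pinf a"
  proof -
    define D where "D = (\<Sum>j. norm (ratio_coeff a j))"
    have dist: "norm (p n - pinf Q / pinf a) \<le> norm (x * Q ^ n) * (C * D)" for n
    proof -
      have "(\<lambda>j. ratio_coeff a j / (1 + x * Q ^ n * Q ^ j) - ratio_coeff a j) sums (p n - pinf Q / pinf a)"
        by (intro sums_diff sp ratio_coeff_sums a)
      hence "p n - pinf Q / pinf a = (\<Sum>j. ratio_coeff a j / (1 + x * Q ^ n * Q ^ j) - ratio_coeff a j)"
        by (rule sums_unique)
      also have "norm \<dots> \<le> (\<Sum>j. norm (x * Q ^ n) * C * norm (ratio_coeff a j))"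
      proof (rule norm_suminf_le)
        fix j
        have nz': "1 + x * Q ^ n * Q ^ j \<noteq> 0" using nz[of "n + j"] by (simp add: power_add mult_ac)
        have "ratio_coeff a j / (1 + x * Q ^ n * Q ^ j) - ratio_coeff a j = - (x * Q ^ n) * (1 / (1 + x * Q ^ (n + j))) * (Q ^ j * ratio_coeff a j)"
          using nz' by (simp add: power_add mult_ac) (simp add: field_simps)
        hence "norm (ratio_coeff a j / (1 + x * Q ^ n * Q ^ j) - ratio_coeff a j) =
            norm (x * Q ^ n) * norm (1 / (1 + x * Q ^ (n + j))) * (norm (Q ^ j) * norm (ratio_coeff a j))"
          by (simp only: norm_mult norm_minus_cancel)
        also have "\<dots> \<le> norm (x * Q ^ n) * C * (1 * norm (ratio_coeff a j))"
          using C' C(1) q_pow_le_1[of j] q_pos by (intro mult_mono mult_left_mono) (auto simp: norm_power)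
        finally show "norm (ratio_coeff a j / (1 + x * Q ^ n * Q ^ j) - ratio_coeff a j) \<le> norm (x * Q ^ n) * C * norm (ratio_coeff a j)" by simp
      qed (intro summable_mult ratio_coeff_summable a)
      also have "\<dots> = norm (x * Q ^ n) * (C * D)"
        unfolding D_def by (subst suminf_mult[OF ratio_coeff_summable[OF a]]) (simp add: mult_ac)
      finally show ?thesis .
    qed
    have "(\<lambda>n. norm (x * Q ^ n) * (C * D)) \<longlonglongrightarrow> norm (x * 0) * (C * D)"
      by (intro tendsto_intros q_pow_LIMSEQ)
    hence "(\<lambda>n. norm (x * Q ^ n) * (C * D)) \<longlonglongrightarrow> 0" by simp
    hence "(\<lambda>n. p n - pinf Q / pinf a) \<longlonglongrightarrow> 0"
      by (rule Lim_null_comparison[rotated]) (use dist in auto)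
    thus ?thesis by (simp add: LIM_zero_iff)
  qed
  have "pinf (- x) * p 0 = pinf (- a * x) * (pinf Q / pinf a)"
    by (rule first_order_q_difference[OF rec lim])
  hence "p 0 = pinf_ratio a x * pinf Q / pinf a"
    using off_spiral_pinf_nz[OF x] pinf_nz_small[OF a] by (simp add: pinf_ratio_def field_simps)
  thus ?thesis using norm_summable_imp_has_sum[OF nsm[of 0] sp[of 0]] by simp
qed

text \<open>
  The pair \<open>(k,j)\<close> carries the coefficient of \<open>1/(1 + q\<^sup>k\<^sup>+\<^sup>j x)\<close>; the pairs are not collected by \<open>k + j\<close>, which
  would only obscure the product structure.
\<close>

definition pf_coeff :: "complex \<Rightarrow> complex \<Rightarrow> nat \<times> nat \<Rightarrow> complex" where
  "pf_coeff a b = (\<lambda>(k, j). b ^ k / pfin Q k * ratio_coeff a j)"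

lemma pf_coeff_summable:
  assumes "norm a < 1" "norm b < 1"
  shows "(\<lambda>i. norm (pf_coeff a b i)) summable_on UNIV"
proof -
  obtain C where C: "C > 0" "\<And>n. norm (1 / pfin Q n) \<le> C" using pfin_Q_inverse_bounded by blast
  have "(\<lambda>(k, j). b ^ k / pfin Q k * ratio_coeff a j) summable_on UNIV \<times> UNIV"
  proof (rule summable_on_product_dominated)
    show "(\<lambda>k. C * norm b ^ k) summable_on UNIV"
      using assms by (intro summable_on_cmult_right summable_geometric_on) auto
    show "(\<lambda>j. norm (ratio_coeff a j)) summable_on UNIV" by (rule ratio_coeff_norm_summable_on[OF assms(1)])
    show "norm (b ^ k / pfin Q k * ratio_coeff a j) \<le> C * norm b ^ k * norm (ratio_coeff a j)" for k j
    proof -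
      have "norm (1 / pfin Q k) * (norm b ^ k * norm (ratio_coeff a j)) \<le> C * (norm b ^ k * norm (ratio_coeff a j))"
        using C by (intro mult_right_mono) auto
      thus ?thesis by (simp add: norm_mult norm_divide norm_power mult_ac)
    qed
  qed (use C in auto)
  hence "pf_coeff a b summable_on UNIV" by (simp add: pf_coeff_def)
  thus ?thesis by (rule summable_on_norm_complex)
qed

lemma F_partial_fractions:
  assumes a: "norm a < 1" and b: "norm b < 1" and x: "off_spiral x"
  shows "F a b x = pinf a * pinf b / pinf Q * (\<Sum>\<^sub>\<infinity>i. pf_coeff a b i / (1 + x * Q ^ (fst i + snd i)))"
proof -
  obtain C where C: "C > 0" "\<And>n. norm (1 / (1 + X x n)) \<le> C"
    using one_plus_X_bounded_below[OF x] by blast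
  have C': "norm (1 / (1 + x * Q ^ n)) \<le> C" for n
    using C(2)[of "int n"] by (simp add: X_def mult.commute)
  have "(\<lambda>i. pf_coeff a b i / (1 + x * Q ^ (fst i + snd i))) summable_on UNIV"
  proof (rule summable_on_dominated)
    show "(\<lambda>i. C * norm (pf_coeff a b i)) summable_on UNIV"
      by (intro summable_on_cmult_right pf_coeff_summable a b)
    fix i
    have "norm (1 / (1 + x * Q ^ (fst i + snd i))) * norm (pf_coeff a b i) \<le> C * norm (pf_coeff a b i)"
      by (intro mult_right_mono C') auto
    thus "norm (pf_coeff a b i / (1 + x * Q ^ (fst i + snd i))) \<le> C * norm (pf_coeff a b i)"
      by (simp add: norm_divide)
  qed
  hence sm: "(\<lambda>(k, j). b ^ k / pfin Q k * ratio_coeff a j / (1 + x * Q ^ (k + j))) summable_on UNIV \<times> UNIV"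
    by (simp add: pf_coeff_def case_prod_unfold)
  have inner: "(\<Sum>\<^sub>\<infinity>j. b ^ k / pfin Q k * ratio_coeff a j / (1 + x * Q ^ (k + j))) =
      pinf Q / pinf a * (b ^ k / pfin Q k * pinf_ratio a (x * Q ^ k))" for k
  proof -
    have "off_spiral (x * Q ^ k)" using off_spiral_X[of x "int k"] x by (simp add: X_def mult.commute)
    from pinf_ratio_partial_fractions[OF a this] 
    have "(\<Sum>\<^sub>\<infinity>j. ratio_coeff a j / (1 + x * Q ^ k * Q ^ j)) = pinf_ratio a (x * Q ^ k) * pinf Q / pinf a"
      by (simp add: has_sum_iff)
    moreover have "(\<Sum>\<^sub>\<infinity>j. b ^ k / pfin Q k * ratio_coeff a j / (1 + x * Q ^ (k + j))) =
       b ^ k / pfin Q k * (\<Sum>\<^sub>\<infinity>j. ratio_coeff a j / (1 + x * Q ^ k * Q ^ j))"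
      unfolding infsum_cmult_right'[symmetric] by (simp add: power_add mult_ac)
    ultimately show ?thesis by (simp add: mult_ac)
  qed
  have "(\<Sum>\<^sub>\<infinity>i. pf_coeff a b i / (1 + x * Q ^ (fst i + snd i))) =
      (\<Sum>\<^sub>\<infinity>(k, j)\<in>UNIV \<times> UNIV. b ^ k / pfin Q k * ratio_coeff a j / (1 + x * Q ^ (k + j)))"
    by (simp add: pf_coeff_def case_prod_unfold)
  also have "\<dots> = (\<Sum>\<^sub>\<infinity>k. \<Sum>\<^sub>\<infinity>j. b ^ k / pfin Q k * ratio_coeff a j / (1 + x * Q ^ (k + j)))"
    by (rule infsum_Sigma'_banach[OF sm, symmetric])
  also have "\<dots> = pinf Q / pinf a * (\<Sum>\<^sub>\<infinity>k. b ^ k / pfin Q k * pinf_ratio a (x * Q ^ k))"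
    unfolding inner infsum_cmult_right' ..
  also have "(\<Sum>\<^sub>\<infinity>k. b ^ k / pfin Q k * pinf_ratio a (x * Q ^ k)) = F b a x / pinf b"
    using F_geometric_expansion[OF b off_spiral_pinf_nz[OF x], of a] by (simp add: pinf_ratio_def has_sum_iff)
  finally show ?thesis
    using pinf_nz_small[OF a] pinf_nz_small[OF b] by (simp add: F_commute[of a b])
qed

subsection \<open>The residue function\<close>

text \<open>
  The sum of these terms is \<open>(-by;q)\<^sub>\<infinity>\<close> times \<open>1phi1(q/a;-by;q;-ay)\<close>, an entire function of \<open>y\<close>.
\<close>

definition res_term :: "complex \<Rightarrow> complex \<Rightarrow> complex \<Rightarrow> nat \<Rightarrow> complex" where
  "res_term a b y j = ratio_coeff a j * Q ^ (j choose 2) * y ^ j * pinf (- b * Q ^ j * y)"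

definition res_num :: "complex \<Rightarrow> complex \<Rightarrow> complex \<Rightarrow> complex" where
  "res_num a b y = infsum (res_term a b y) UNIV"

text \<open>
  Up to the factor \<open>K\<^sub>0\<close>, the number \<open>x res a b x\<close> is the residue at \<open>z = -x\<close> of the last expansion of \<open>U\<close>.
\<close>

definition res :: "complex \<Rightarrow> complex \<Rightarrow> complex \<Rightarrow> complex" where
  "res a b x = res_num a b (x * Q) / theta_q q (x * Q)"

lemma res_term_bound:
  "\<exists>C>0. \<forall>y j. norm y \<le> R \<longrightarrow> norm (res_term a b y j) \<le> C * (q ^ (j choose 2) * ((norm a + 1) * \<bar>R\<bar>) ^ j)"
proof -
  obtain C where C: "C > 0" "\<And>j. norm (ratio_coeff a j) \<le> C * (norm a + 1) ^ j" using ratio_coeff_bound by blast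
  obtain E where E: "E > 0" "\<And>w. norm w \<le> norm b * \<bar>R\<bar> \<Longrightarrow> norm (pinf w) \<le> E"
    using pinf_bounded by blast
  have "norm (res_term a b y j) \<le> C * E * (q ^ (j choose 2) * ((norm a + 1) * \<bar>R\<bar>) ^ j)" if y: "norm y \<le> R" for y j
  proof -
    have "norm (b * Q ^ j * y) \<le> norm b * 1 * \<bar>R\<bar>"
      unfolding norm_mult norm_power norm_Q
      using y q_pow_le_1[of j] q_pos by (intro mult_mono) auto
    hence e: "norm (pinf (- b * Q ^ j * y)) \<le> E" by (intro E) simp
    have p: "norm y ^ j \<le> \<bar>R\<bar> ^ j" using y by (intro power_mono) auto
    have "norm (res_term a b y j) = norm (ratio_coeff a j) * norm (pinf (- b * Q ^ j * y)) * (q ^ (j choose 2) * norm y ^ j)"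
      using q_pos by (simp add: res_term_def norm_mult norm_power)
    also have "\<dots> \<le> (C * (norm a + 1) ^ j) * E * (q ^ (j choose 2) * \<bar>R\<bar> ^ j)"
      using C e p q_pos E(1) by (intro mult_mono) auto
    finally show ?thesis by (simp add: power_mult_distrib mult_ac)
  qed
  thus ?thesis using C(1) E(1) by (intro exI[of _ "C * E"]) auto
qed

lemma res_term_summable: "res_term a b y summable_on UNIV"
proof -
  obtain C where C: "\<And>j. norm (res_term a b y j) \<le> C * (q ^ (j choose 2) * ((norm a + 1) * \<bar>norm y\<bar>) ^ j)"
    using res_term_bound[of "norm y" a b] by blast
  show ?thesis
    by (rule summable_on_dominated[OF summable_on_cmult_right[OF summable_gauss_on] C]) auto
qed

lemma res_num_has_sum: "(res_term a b y has_sum res_num a b y) UNIV"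
  unfolding res_num_def by (rule has_sum_infsum[OF res_term_summable])

lemma res_num_bounded: "\<exists>C. \<forall>y. norm y \<le> R \<longrightarrow> norm (res_num a b y) \<le> C"
proof -
  obtain C where C: "\<And>y j. norm y \<le> R \<Longrightarrow> norm (res_term a b y j) \<le> C * (q ^ (j choose 2) * ((norm a + 1) * \<bar>R\<bar>) ^ j)"
    using res_term_bound by blast
  have "norm (res_num a b y) \<le> (\<Sum>\<^sub>\<infinity>j. C * (q ^ (j choose 2) * ((norm a + 1) * \<bar>R\<bar>) ^ j))" if "norm y \<le> R" for y
    by (rule norm_infsum_le[OF res_num_has_sum has_sum_infsum C[OF that]])
       (intro summable_on_cmult_right summable_gauss_on, simp)
  thus ?thesis by blast
qed

lemma res_num_mult_Q_left: "res_num (a * Q) b y = res_num a b y - a * y * res_num a b (y * Q)"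
proof (rule has_sum_nat_Suc_shift[OF res_num_has_sum res_num_has_sum has_sum_cmult_right[OF res_num_has_sum]])
  fix j
  have "res_term (a * Q) b y (Suc j) = (ratio_coeff a (Suc j) - a * ratio_coeff a j) * Q ^ (Suc j choose 2) * y ^ Suc j * pinf (- b * Q ^ Suc j * y)"
    by (simp add: res_term_def ratio_coeff_mult_Q)
  also have "\<dots> = res_term a b y (Suc j) - a * y * res_term a b (y * Q) j"
    by (simp add: res_term_def choose_two_Suc power_add power_mult_distrib algebra_simps)
  finally show "res_term (a * Q) b y (Suc j) = res_term a b y (Suc j) - a * y * res_term a b (y * Q) j" .
qed (simp add: res_term_def)

lemma res_num_mult_Q_right: "res_num a (b * Q) y = res_num a b y - b * y * res_num a b (y * Q)"
proof -
  have "res_term a (b * Q) y j = res_term a b y j - b * y * res_term a b (y * Q) j" for j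
  proof -
    have "pinf (- b * Q ^ j * y) = (1 + b * Q ^ j * y) * pinf (- (b * Q) * Q ^ j * y)"
      by (subst pinf_step) (simp add: mult_ac)
    moreover have "- b * Q ^ j * (y * Q) = - (b * Q) * Q ^ j * y" by simp
    ultimately show ?thesis
      by (simp add: res_term_def power_mult_distrib algebra_simps)
  qed
  hence "(res_term a (b * Q) y has_sum (res_num a b y - b * y * res_num a b (y * Q))) UNIV"
    using has_sum_diff_complex[OF res_num_has_sum[of a b y]
            has_sum_cmult_right[OF res_num_has_sum[of a b "y * Q"], of "b * y"]]
    by (simp cong: has_sum_cong)
  thus ?thesis using res_num_has_sum has_sum_unique by blast
qed

text \<open>
  Together with the two preceding relations this encodes the second order \<open>q\<close>-difference equation of the
  numerator in \<open>y\<close>.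
\<close>

lemma res_num_mult_Q_both:
  "res_num (a * Q) (b * Q) y = res_num a b (y * Q) - y * Q * res_num a b (y * Q * Q)"
proof (rule has_sum_nat_Suc_shift[OF res_num_has_sum res_num_has_sum has_sum_cmult_right[OF res_num_has_sum]])
  fix j
  have "res_term (a * Q) (b * Q) y (Suc j) = (Q ^ Suc j * (ratio_coeff a (Suc j) - ratio_coeff a j)) * Q ^ (Suc j choose 2) * y ^ Suc j * pinf (- (b * Q) * Q ^ Suc j * y)"
    by (simp add: res_term_def ratio_coeff_mult_Q')
  also have "\<dots> = res_term a b (y * Q) (Suc j) - y * Q * res_term a b (y * Q * Q) j"
    by (simp add: res_term_def choose_two_Suc power_add power_mult_distrib algebra_simps)
  finally show "res_term (a * Q) (b * Q) y (Suc j) = res_term a b (y * Q) (Suc j) - y * Q * res_term a b (y * Q * Q) j" .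
qed (simp add: res_term_def mult_ac)

lemma inverse_theta_shift:
  assumes "y \<noteq> 0" shows "1 / theta_q q (y * Q) = y / theta_q q y"
  unfolding theta_shift[OF assms, symmetric] using assms by simp

lemma res_shift:
  assumes "x \<noteq> 0"
  shows "res a b (x * Q) = res_num a b (x * Q * Q) * (x * Q / theta_q q (x * Q))"
  using inverse_theta_shift[of "x * Q"] assms unfolding res_def
  by (metis Q_nz mult.right_neutral mult_eq_0_iff times_divide_eq_right)

lemma res_mult_Q_left:
  assumes "x \<noteq> 0" shows "res (a * Q) b x = res a b x - a * res a b (x * Q)"
  unfolding res_shift[OF assms] unfolding res_def res_num_mult_Q_left by (simp add: diff_divide_distrib)

lemma res_mult_Q_right:
  assumes "x \<noteq> 0" shows "res a (b * Q) x = res a b x - b * res a b (x * Q)"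
  unfolding res_shift[OF assms] unfolding res_def res_num_mult_Q_right by (simp add: diff_divide_distrib)

lemma res_mult_Q_both:
  assumes "x \<noteq> 0"
  shows "x * Q * res (a * Q) (b * Q) x = res a b (x * Q) - res a b (x * Q * Q)"
proof -
  define y where "y = x * Q"
  have y: "y \<noteq> 0" using assms by (simp add: y_def)
  have 1: "res a b (x * Q) = res_num a b (y * Q) * (y / theta_q q y)"
    unfolding y_def by (rule res_shift[OF assms])
  have 2: "res a b (x * Q * Q) = res_num a b (y * Q * Q) * (y * Q * (y / theta_q q y))"
    using res_shift[of "x * Q" a b] assms inverse_theta_shift[OF y] unfolding y_def
    by (metis Q_nz mult.right_neutral mult_eq_0_iff times_divide_eq_right)
  have "x * Q * res (a * Q) (b * Q) x = (res_num a b (y * Q) - y * Q * res_num a b (y * Q * Q)) * (y / theta_q q y)"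
    unfolding res_def y_def[symmetric] res_num_mult_Q_both by simp
  also have "\<dots> = res a b (x * Q) - res a b (x * Q * Q)"
    unfolding 1 2 by (simp add: algebra_simps)
  finally show ?thesis .
qed

text \<open>
  The coefficients of the partial fractions of \<open>F\<close>, weighted by theta coefficients, sum to the numerator of
  the residues.
\<close>

lemma res_num_expansion:
  assumes a: "norm a < 1" and b: "norm b < 1"
  shows "(\<Sum>\<^sub>\<infinity>i. pf_coeff a b i * (Q ^ ((fst i + snd i) choose 2) * y ^ (fst i + snd i))) = res_num a b y"
proof -
  obtain C where C: "C > 0" "\<And>n. norm (1 / pfin Q n) \<le> C" using pfin_Q_inverse_bounded by blast
  obtain D where D: "D > 0" "\<And>j. norm (ratio_coeff a j) \<le> D * (norm a + 1) ^ j" using ratio_coeff_bound by blast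
  let ?f = "\<lambda>k j. b ^ k / pfin Q k * ratio_coeff a j * (Q ^ ((k + j) choose 2) * y ^ (k + j))"
  have sm: "(\<lambda>(k, j). ?f k j) summable_on UNIV \<times> UNIV"
  proof (rule summable_on_product_dominated)
    show "(\<lambda>k. C * (q ^ (k choose 2) * norm (b * y) ^ k)) summable_on UNIV"
      by (intro summable_on_cmult_right summable_gauss_on) auto
    show "(\<lambda>j. D * (q ^ (j choose 2) * ((norm a + 1) * norm y) ^ j)) summable_on UNIV"
      by (intro summable_on_cmult_right summable_gauss_on) auto
    show "norm (?f k j) \<le> C * (q ^ (k choose 2) * norm (b * y) ^ k) * (D * (q ^ (j choose 2) * ((norm a + 1) * norm y) ^ j))" for k j
    proof -
      have "norm (?f k j) = norm (1 / pfin Q k) * norm (ratio_coeff a j) * q ^ ((k + j) choose 2) * (norm (b * y) ^ k * norm y ^ j)"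
        using q_pos by (simp add: norm_mult norm_divide norm_power power_add power_mult_distrib mult_ac)
      also have "\<dots> \<le> C * (D * (norm a + 1) ^ j) * (q ^ (k choose 2) * q ^ (j choose 2)) * (norm (b * y) ^ k * norm y ^ j)"
      proof (intro mult_right_mono mult_mono C D)
        have "q ^ ((k + j) choose 2) \<le> q ^ ((k choose 2) + (j choose 2))"
          using q_pos q_lt_1 by (intro power_decreasing) (auto simp: choose_two_add)
        thus "q ^ ((k + j) choose 2) \<le> q ^ (k choose 2) * q ^ (j choose 2)" by (simp add: power_add)
      qed (use C D q_pos in auto)
      finally show ?thesis by (simp add: power_mult_distrib mult_ac)
    qed
  qed (use C D q_pos in auto)
  have inner: "(\<Sum>\<^sub>\<infinity>k. ?f k j) = res_term a b y j" for j
  proof -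
    have "?f k j = ratio_coeff a j * Q ^ (j choose 2) * y ^ j * (Q ^ (k choose 2) * (b * Q ^ j * y) ^ k / pfin Q k)" for k
    proof -
      have "(Q ^ j) ^ k = Q ^ (k * j)" by (simp add: power_mult[symmetric] mult.commute)
      thus ?thesis by (simp add: choose_two_add power_add power_mult_distrib mult_ac)
    qed
    thus ?thesis
      by (simp only: infsum_cmult_right' euler_infsum) (simp add: res_term_def)
  qed
  have "(\<Sum>\<^sub>\<infinity>i. pf_coeff a b i * (Q ^ ((fst i + snd i) choose 2) * y ^ (fst i + snd i))) = (\<Sum>\<^sub>\<infinity>(k, j)\<in>UNIV \<times> UNIV. ?f k j)"
    by (simp add: pf_coeff_def case_prod_unfold)
  also have "\<dots> = (\<Sum>\<^sub>\<infinity>k. \<Sum>\<^sub>\<infinity>j. ?f k j)"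
    by (rule infsum_Sigma'_banach[OF sm, symmetric])
  also have "\<dots> = (\<Sum>\<^sub>\<infinity>j. \<Sum>\<^sub>\<infinity>k. ?f k j)"
    by (rule infsum_swap_banach[OF sm])
  finally show ?thesis unfolding inner res_num_def .
qed

section \<open>The residue series\<close>

definition pole_frac :: "complex \<Rightarrow> complex \<Rightarrow> int \<Rightarrow> complex" where
  "pole_frac l z p = X l p / (X l p + z)"

definition res_series :: "complex \<Rightarrow> (int \<Rightarrow> complex) \<Rightarrow> complex \<Rightarrow> complex" where
  "res_series l A z = (\<Sum>\<^sub>\<infinity>p. A p * pole_frac l z p)"

lemma off_spiral_X_add_nz:
  assumes "z \<noteq> 0" "off_spiral (l / z)"
  shows "X l p + z \<noteq> 0"
proof -
  have "X l p + z = z * (1 + X (l / z) p)" using assms by (simp add: X_def algebra_simps)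
  moreover have "1 + X (l / z) p \<noteq> 0" using assms by (intro off_spiral_one_plus) (simp add: off_spiral_X)
  ultimately show ?thesis using assms by simp
qed

lemma pole_frac_bounded:
  assumes z: "z \<noteq> 0" and lz: "off_spiral (l / z)"
  shows "\<exists>C>0. \<forall>p. norm (pole_frac l z p) \<le> C"
proof -
  have l0: "l \<noteq> 0" using off_spiral_nz[OF lz] by auto
  have "pole_frac l z p = 1 / (1 + X (z / l) (- p))" for p
  proof -
    have "1 + X (z / l) (- p) = (X l p + z) / X l p"
      using l0 by (simp add: X_def power_int_minus field_simps)
    thus ?thesis by (simp add: pole_frac_def)
  qed
  moreover obtain C where "C > 0" "\<And>n. norm (1 / (1 + X (z / l) n)) \<le> C"
    using one_plus_X_bounded_below[of "z / l"] lz off_spiral_inverse by blast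
  ultimately show ?thesis by (intro exI[of _ C]) auto
qed

lemma pole_frac_mult_Q: "pole_frac l (z * Q) (p + 1) = pole_frac l z p"
proof -
  have "pole_frac l (z * Q) (p + 1) = (X l p * Q) / ((X l p + z) * Q)"
    by (simp add: pole_frac_def X_Suc distrib_right)
  thus ?thesis by (simp add: pole_frac_def)
qed

lemma pole_frac_mult_Q_pow: "pole_frac l (z * Q ^ m) (p + int m) = pole_frac l z p"
proof -
  have "pole_frac l (z * Q ^ m) (p + int m) = (X l p * Q ^ m) / ((X l p + z) * Q ^ m)"
    by (simp add: pole_frac_def X_add_nat distrib_right)
  thus ?thesis by (simp add: pole_frac_def)
qed

lemma res_series_summable:
  assumes "z \<noteq> 0" "off_spiral (l / z)" "A summable_on UNIV"
  shows "(\<lambda>p. A p * pole_frac l z p) summable_on UNIV"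
proof -
  obtain C where C: "C > 0" "\<And>p. norm (pole_frac l z p) \<le> C" using pole_frac_bounded assms by blast
  show ?thesis
  proof (rule summable_on_dominated)
    show "(\<lambda>p. C * norm (A p)) summable_on UNIV"
      by (intro summable_on_cmult_right summable_on_norm_complex assms)
    show "norm (A p * pole_frac l z p) \<le> C * norm (A p)" for p
      using mult_left_mono[OF C(2)[of p], of "norm (A p)"] by (simp add: norm_mult mult.commute)
  qed
qed

lemma res_series_mult_Q: "res_series l A (z * Q) = res_series l (\<lambda>p. A (p + 1)) z"
  unfolding res_series_def
  using infsum_int_shift[of "\<lambda>p. A p * pole_frac l (z * Q) p" 1] by (simp add: pole_frac_mult_Q)

lemma res_series_diff:
  assumes z: "z \<noteq> 0" "off_spiral (l / z)" and "A summable_on UNIV" "B summable_on UNIV"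
  shows "res_series l (\<lambda>p. A p - c * B p) z = res_series l A z - c * res_series l B z"
proof -
  have "((\<lambda>p. A p * pole_frac l z p - c * (B p * pole_frac l z p)) has_sum (res_series l A z - c * res_series l B z)) UNIV"
    unfolding res_series_def
    by (intro has_sum_diff_complex has_sum_cmult_right has_sum_infsum res_series_summable assms)
  thus ?thesis by (simp add: res_series_def algebra_simps infsumI)
qed

lemma off_spiral_div_mult_Q: "off_spiral (l / (z * Q)) \<longleftrightarrow> off_spiral (l / z)"
  using off_spiral_div_Q[of "l / z"] by simp

text \<open>
  \<open>A\<close> and \<open>B\<close> are the residues for \<open>a\<close> and \<open>aq\<close>. The recurrence for \<open>U_descent\<close> comes from
  \<open>z/(x + z) = 1 - x/(x + z)\<close>: the constant part telescopes to \<open>0\<close> because \<open>A\<close> is summable.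
  The lemma speaks of abstract sequences so that it applies to descent in either parameter.
\<close>

lemma residue_descent:
  assumes l: "off_spiral l" and z: "z \<noteq> 0" "off_spiral (l / z)"
    and A: "A summable_on UNIV"
    and B: "\<And>p. B p = A p - a * A (p + 1)"
    and D: "\<And>p. X l p * Q * (B p - b * B (p + 1)) = A (p + 1) - A (p + 2)"
    and IH: "\<And>z. z \<noteq> 0 \<Longrightarrow> off_spiral (l / z) \<Longrightarrow> U l (a * Q) b z = K * res_series l B z"
  shows "U l a b z = (1 - a) * K * res_series l A z"
proof -
  let ?R = "res_series l"
  have A1: "(\<lambda>p. A (p + m)) summable_on UNIV" for m using A summable_on_int_shift[of A m] by simp
  have Beq: "B = (\<lambda>p. A p - a * A (p + 1))" by (rule ext) (rule B)
  have Bs: "B summable_on UNIV"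
    unfolding Beq by (intro summable_on_diff_complex summable_on_cmult_right A A1)
  have B1: "(\<lambda>p. B (p + m)) summable_on UNIV" for m using Bs summable_on_int_shift[of B m] by simp
  have zQ: "z * Q \<noteq> 0" "off_spiral (l / (z * Q))" using z by (auto simp: off_spiral_div_mult_Q)
  have RB: "?R B w = ?R A w - a * ?R A (w * Q)" if "w \<noteq> 0" "off_spiral (l / w)" for w
    unfolding res_series_mult_Q Beq by (rule res_series_diff[OF that A A1])
  have rec: "Q * z * (?R B z - b * ?R B (z * Q)) = ?R A (z * Q * Q) - ?R A (z * Q)"
  proof -
    have "?R B z - b * ?R B (z * Q) = ?R (\<lambda>p. B p - b * B (p + 1)) z"
      unfolding res_series_mult_Q by (rule res_series_diff[OF z Bs B1, symmetric])
    hence "Q * z * (?R B z - b * ?R B (z * Q)) = (\<Sum>\<^sub>\<infinity>p. Q * z * ((B p - b * B (p + 1)) * pole_frac l z p))"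
      unfolding res_series_def infsum_cmult_right' by simp
    also have "\<dots> = (\<Sum>\<^sub>\<infinity>p. (A (p + 1) - A (p + 2)) - (A (p + 1) * pole_frac l z p - A (p + 2) * pole_frac l z p))"
    proof (rule infsum_cong)
      fix p
      have nz: "X l p + z \<noteq> 0" by (rule off_spiral_X_add_nz[OF z])
      have "Q * z * ((B p - b * B (p + 1)) * pole_frac l z p) = (X l p * Q * (B p - b * B (p + 1))) * (z / (X l p + z))"
        by (simp add: pole_frac_def)
      also have "\<dots> = (A (p + 1) - A (p + 2)) * (z / (X l p + z))" unfolding D ..
      also have "z / (X l p + z) = 1 - pole_frac l z p" using nz by (simp add: pole_frac_def field_simps)
      finally show "Q * z * ((B p - b * B (p + 1)) * pole_frac l z p) =
          (A (p + 1) - A (p + 2)) - (A (p + 1) * pole_frac l z p - A (p + 2) * pole_frac l z p)"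
        by (simp add: algebra_simps)
    qed
    also have "\<dots> = (infsum A UNIV - infsum A UNIV) - (?R (\<lambda>p. A (p + 1)) z - ?R (\<lambda>p. A (p + 2)) z)"
    proof (intro infsumI has_sum_diff_complex)
      show "((\<lambda>p. A (p + 1)) has_sum infsum A UNIV) UNIV" "((\<lambda>p. A (p + 2)) has_sum infsum A UNIV) UNIV"
        using A1 infsum_int_shift[of A] by (auto simp: has_sum_iff)
      show "((\<lambda>p. A (p + 1) * pole_frac l z p) has_sum ?R (\<lambda>p. A (p + 1)) z) UNIV"
        "((\<lambda>p. A (p + 2) * pole_frac l z p) has_sum ?R (\<lambda>p. A (p + 2)) z) UNIV"
        unfolding res_series_def by (intro has_sum_infsum res_series_summable z A1)+
    qed
    also have "\<dots> = ?R A (z * Q * Q) - ?R A (z * Q)"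
      unfolding res_series_mult_Q by (simp add: add.assoc)
    finally show ?thesis .
  qed
  show ?thesis
    by (rule U_descent[OF l z(1) RB[OF z] RB[OF zQ] rec IH[OF z] IH[OF zQ]])
qed

abbreviation res_seq :: "complex \<Rightarrow> complex \<Rightarrow> complex \<Rightarrow> int \<Rightarrow> complex" where
  "res_seq l a b p \<equiv> res a b (X l p)"

text \<open>
  Insert the partial fractions of \<open>F\<close>. The fraction \<open>1/(1 + q\<^sup>m x)\<close> is resummed by
  \<open>lerch_partial_fractions\<close> with \<open>q\<^sup>m z\<close> in place of \<open>z\<close>, and the resulting double sum is absolutely convergent
  since shifting \<open>p\<close> by \<open>m\<close> makes the theta factor independent of \<open>m\<close>.
\<close>

lemma U_eq_residue_series_small:
  assumes l: "off_spiral l" and z: "z \<noteq> 0" "off_spiral (l / z)"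
    and a: "norm a < 1" and b: "norm b < 1"
  shows "(\<lambda>p. res_seq l a b p * pole_frac l z p) summable_on UNIV"
    and "U l a b z = pinf a * pinf b / pinf Q * res_series l (res_seq l a b) z"
proof -
  have l0: "l \<noteq> 0" using off_spiral_nz[OF l] .
  define m where "m i = fst i + snd i" for i :: "nat \<times> nat"
  let ?c = "pf_coeff a b"
  obtain C where C: "C > 0" "\<And>n. norm (1 / (1 + X l n)) \<le> C"
    using one_plus_X_bounded_below[OF l] by blast
  obtain E where E: "E > 0" "\<And>p. norm (pole_frac l z p) \<le> E" using pole_frac_bounded[OF z] by blast
  have cs: "(\<lambda>i. norm (?c i)) summable_on UNIV" by (rule pf_coeff_summable[OF a b])
  define f where "f n i = ?c i * (W z (X l n) / (1 + X l (n + int (m i))))" for n i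
  have smf: "(\<lambda>(n, i). f n i) summable_on UNIV \<times> UNIV"
  proof (rule summable_on_product_dominated[OF _ _ cs])
    show "(\<lambda>n. norm (W z (X l n)) * C ) summable_on UNIV"
      using W_norm_summable[OF l0 z(1), of 1] by (intro summable_on_cmult_left) simp
    fix n i
    have "norm (?c i) * norm (W z (X l n)) * norm (1 / (1 + X l (n + int (m i)))) \<le> norm (?c i) * norm (W z (X l n)) * C"
      by (intro mult_left_mono C) auto
    thus "norm (f n i) \<le> norm (W z (X l n)) * C * norm (?c i)"
      by (simp add: f_def norm_mult norm_divide mult_ac)
  qed (use C in auto)
  define g where "g i p = ?c i * (pole_frac l z p / theta_q q (X l (p + int (m i)) * Q))" for i p
  have smg: "(\<lambda>(i, p). g i p) summable_on UNIV \<times> UNIV"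
  proof -
    have "(\<lambda>(i, p). g i (p - int (m i))) summable_on UNIV \<times> UNIV"
    proof (rule summable_on_product_dominated[OF cs])
      have "(\<lambda>p. norm (W 1 (X l p))) summable_on UNIV"
        using W_norm_summable[OF l0, of 1 1] by simp
      hence "(\<lambda>p. of_real (norm (W 1 (X l p))) :: complex) summable_on UNIV"
        by (rule summable_on_of_real)
      hence "(\<lambda>p. of_real (norm (W 1 (X l (p + 1)))) :: complex) summable_on UNIV"
        by (subst summable_on_int_shift[of "\<lambda>p. of_real (norm (W 1 (X l p)))" 1])
      from summable_on_norm_complex[OF this]
      show "(\<lambda>p. E * norm (W 1 (X l (p + 1)))) summable_on UNIV"
        by (intro summable_on_cmult_right) simp
      fix i p
      have "norm (?c i) * norm (W 1 (X l (p + 1))) * norm (pole_frac l z (p - int (m i))) \<le> norm (?c i) * norm (W 1 (X l (p + 1))) * E"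
        by (intro mult_left_mono E) auto
      thus "norm (g i (p - int (m i))) \<le> norm (?c i) * (E * norm (W 1 (X l (p + 1))))"
        by (simp add: g_def W_def X_Suc norm_mult norm_divide mult_ac)
    qed (use E in auto)
    moreover have "(\<lambda>(i, p). g i (p - int (m i))) summable_on UNIV \<times> UNIV \<longleftrightarrow> (\<lambda>(i, p). g i p) summable_on UNIV \<times> UNIV"
      by (rule summable_on_reindex_bij_witness[of _ "\<lambda>(i, p). (i, p + int (m i))" "\<lambda>(i, p). (i, p - int (m i))"]) auto
    ultimately show ?thesis by simp
  qed
  have swap: "(\<Sum>\<^sub>\<infinity>n. f n i) = (\<Sum>\<^sub>\<infinity>p. g i p)" for i
  proof -
    define w where "w = z * Q ^ m i"
    have w: "w \<noteq> 0" "off_spiral (l / w)"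
    proof -
      have "l / w = X (l / z) (- int (m i))" by (simp add: w_def X_def power_int_minus field_simps)
      thus "w \<noteq> 0" "off_spiral (l / w)" using z by (auto simp: w_def off_spiral_X)
    qed
    have "(\<Sum>\<^sub>\<infinity>n. f n i) = ?c i * (\<Sum>\<^sub>\<infinity>n. W z (X l n) / (1 + X l (n + int (m i))))"
      unfolding f_def by (rule infsum_cmult_right')
    also have "(\<lambda>n. W z (X l n) / (1 + X l (n + int (m i)))) = (\<lambda>n. W w (X l (n + int (m i))) / (1 + X l (n + int (m i))))"
      by (simp add: W_def X_add_nat w_def)
    also have "(\<Sum>\<^sub>\<infinity>n. W w (X l (n + int (m i))) / (1 + X l (n + int (m i)))) = (\<Sum>\<^sub>\<infinity>n. W w (X l n) / (1 + X l n))"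
      by (rule infsum_int_shift)
    also have "\<dots> = (\<Sum>\<^sub>\<infinity>p. pole_frac l w p / theta_q q (X l p * Q))"
      unfolding pole_frac_def by (rule lerch_partial_fractions[OF l w])
    also have "\<dots> = (\<Sum>\<^sub>\<infinity>p. pole_frac l w (p + int (m i)) / theta_q q (X l (p + int (m i)) * Q))"
      by (rule infsum_int_shift[symmetric, of "\<lambda>p. pole_frac l w p / theta_q q (X l p * Q)"])
    also have "\<dots> = (\<Sum>\<^sub>\<infinity>p. pole_frac l z p / theta_q q (X l (p + int (m i)) * Q))"
      unfolding w_def pole_frac_mult_Q_pow ..
    also have "?c i * \<dots> = (\<Sum>\<^sub>\<infinity>p. g i p)"
      unfolding g_def by (rule infsum_cmult_right'[symmetric])
    finally show ?thesis .
  qed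
  have inner: "(\<Sum>\<^sub>\<infinity>i. g i p) = res_seq l a b p * pole_frac l z p" for p
  proof -
    define y where "y = X l p * Q"
    have y: "y \<noteq> 0" using l0 by (simp add: y_def)
    have "g i p = pole_frac l z p / theta_q q y * (?c i * (Q ^ (m i choose 2) * y ^ m i))" for i
    proof -
      have "1 / theta_q q (y * Q ^ m i) = Q ^ (m i choose 2) * y ^ m i / theta_q q y"
        using W_shift_pow[OF y, of 1 "m i"] by (simp add: W_def)
      moreover have "X l (p + int (m i)) * Q = y * Q ^ m i" by (simp add: X_add_nat y_def)
      moreover have "g i p = ?c i * pole_frac l z p * (1 / theta_q q (X l (p + int (m i)) * Q))"
        by (simp add: g_def)
      ultimately show ?thesis by simp
    qed
    hence "(\<Sum>\<^sub>\<infinity>i. g i p) = pole_frac l z p / theta_q q y * (\<Sum>\<^sub>\<infinity>i. ?c i * (Q ^ (m i choose 2) * y ^ m i))"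
      by (simp only: infsum_cmult_right')
    also have "(\<Sum>\<^sub>\<infinity>i. ?c i * (Q ^ (m i choose 2) * y ^ m i)) = res_num a b y"
      unfolding m_def by (rule res_num_expansion[OF a b])
    finally show ?thesis by (simp add: res_def y_def)
  qed
  have smg': "(\<lambda>(p, i). g i p) summable_on UNIV \<times> UNIV"
    using summable_on_swap[of "\<lambda>(i, p). g i p" UNIV UNIV] smg by (simp add: case_prod_unfold)
  show "(\<lambda>p. res_seq l a b p * pole_frac l z p) summable_on UNIV"
    using summable_on_Sigma_banach[OF smg'] unfolding inner .
  have "U l a b z = (\<Sum>\<^sub>\<infinity>n. pinf a * pinf b / pinf Q * (\<Sum>\<^sub>\<infinity>i. f n i))"
    unfolding U_def
  proof (rule infsum_cong)
    fix n
    have x: "off_spiral (X l n)" using l by (simp add: off_spiral_X)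
    have "(\<Sum>\<^sub>\<infinity>i. f n i) = (\<Sum>\<^sub>\<infinity>i. W z (X l n) * (?c i / (1 + X l n * Q ^ (fst i + snd i))))"
      by (simp add: f_def m_def X_add_nat[of l n "_ + _", simplified] mult_ac)
    also have "\<dots> = W z (X l n) * (\<Sum>\<^sub>\<infinity>i. ?c i / (1 + X l n * Q ^ (fst i + snd i)))"
      by (rule infsum_cmult_right')
    finally show "F a b (X l n) * W z (X l n) = pinf a * pinf b / pinf Q * (\<Sum>\<^sub>\<infinity>i. f n i)"
      unfolding F_partial_fractions[OF a b x] by (simp only: mult_ac)
  qed
  also have "\<dots> = pinf a * pinf b / pinf Q * (\<Sum>\<^sub>\<infinity>n. \<Sum>\<^sub>\<infinity>i. f n i)"
    by (rule infsum_cmult_right')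
  also have "(\<Sum>\<^sub>\<infinity>n. \<Sum>\<^sub>\<infinity>i. f n i) = (\<Sum>\<^sub>\<infinity>i. \<Sum>\<^sub>\<infinity>n. f n i)"
    by (rule infsum_swap_banach[OF smf])
  also have "\<dots> = (\<Sum>\<^sub>\<infinity>p. \<Sum>\<^sub>\<infinity>i. g i p)"
    unfolding swap by (rule infsum_swap_banach[OF smg])
  finally show "U l a b z = pinf a * pinf b / pinf Q * res_series l (res_seq l a b) z"
    unfolding inner res_series_def .
qed

text \<open>
  Summability of the residues is inherited by \<open>aq\<close> and by \<open>bq\<close>, so finitely many descents in each parameter
  reach \<open>|a|, |b| < 1\<close>.
\<close>

theorem U_eq_residue_series:
  assumes l: "off_spiral l" and z: "z \<noteq> 0" "off_spiral (l / z)"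
    and sm: "res_seq l a b summable_on UNIV"
  shows "U l a b z = pinf a * pinf b / pinf Q * res_series l (res_seq l a b) z"
proof -
  have x: "X l p \<noteq> 0" for p using off_spiral_nz[OF l] by simp
  have Xp: "X l (p + 1) = X l p * Q" "X l (p + 2) = X l p * Q * Q" for p
    using X_add_nat[of l p 2] by (simp_all add: X_Suc power2_eq_square mult_ac)
  let ?P = "\<lambda>a b. res_seq l a b summable_on UNIV \<longrightarrow> (\<forall>z. z \<noteq> 0 \<longrightarrow> off_spiral (l / z) \<longrightarrow>
      U l a b z = pinf a * pinf b / pinf Q * res_series l (res_seq l a b) z)"
  have sm_shift: "(\<lambda>p. res_seq l a b (p + 1)) summable_on UNIV" if "res_seq l a b summable_on UNIV" for a b
    using that summable_on_int_shift[of "res_seq l a b" 1] by simp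
  have step_a: "?P a b" if IH: "?P (a * Q) b" for a b
  proof (intro impI allI)
    fix z assume A: "res_seq l a b summable_on UNIV" and z: "z \<noteq> 0" "off_spiral (l / z)"
    have B: "res_seq l (a * Q) b p = res_seq l a b p - a * res_seq l a b (p + 1)" for p
      unfolding Xp by (rule res_mult_Q_left[OF x])
    have "res_seq l (a * Q) b summable_on UNIV"
      unfolding B by (intro summable_on_diff_complex summable_on_cmult_right A sm_shift)
    with IH have IH': "\<And>z. z \<noteq> 0 \<Longrightarrow> off_spiral (l / z) \<Longrightarrow>
       U l (a * Q) b z = pinf (a * Q) * pinf b / pinf Q * res_series l (res_seq l (a * Q) b) z" by blast
    have D: "X l p * Q * (res_seq l (a * Q) b p - b * res_seq l (a * Q) b (p + 1)) = res_seq l a b (p + 1) - res_seq l a b (p + 2)" for p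
      unfolding Xp res_mult_Q_right[OF x, symmetric] by (rule res_mult_Q_both[OF x])
    have "U l a b z = (1 - a) * (pinf (a * Q) * pinf b / pinf Q) * res_series l (res_seq l a b) z"
      by (rule residue_descent[OF l z A B D IH'])
    thus "U l a b z = pinf a * pinf b / pinf Q * res_series l (res_seq l a b) z"
      by (simp add: pinf_step[of a])
  qed
  have step_b: "?P a b" if IH: "?P a (b * Q)" for a b
  proof (intro impI allI)
    fix z assume A: "res_seq l a b summable_on UNIV" and z: "z \<noteq> 0" "off_spiral (l / z)"
    have B: "res_seq l a (b * Q) p = res_seq l a b p - b * res_seq l a b (p + 1)" for p
      unfolding Xp by (rule res_mult_Q_right[OF x])
    have "res_seq l a (b * Q) summable_on UNIV"
      unfolding B by (intro summable_on_diff_complex summable_on_cmult_right A sm_shift)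
    with IH have IH': "\<And>z. z \<noteq> 0 \<Longrightarrow> off_spiral (l / z) \<Longrightarrow>
       U l (b * Q) a z = pinf a * pinf (b * Q) / pinf Q * res_series l (res_seq l a (b * Q)) z"
      unfolding U_commute[of l "b * Q" a] by blast
    have D: "X l p * Q * (res_seq l a (b * Q) p - a * res_seq l a (b * Q) (p + 1)) = res_seq l a b (p + 1) - res_seq l a b (p + 2)" for p
      unfolding Xp res_mult_Q_left[OF x, symmetric] by (rule res_mult_Q_both[OF x])
    have "U l b a z = (1 - b) * (pinf a * pinf (b * Q) / pinf Q) * res_series l (res_seq l a b) z"
      by (rule residue_descent[OF l z A B D IH'])
    thus "U l a b z = pinf a * pinf b / pinf Q * res_series l (res_seq l a b) z"
      by (simp add: pinf_step[of b] U_commute[of l a b])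
  qed
  have Pa: "norm b < 1 \<Longrightarrow> norm (a * Q ^ N) < 1 \<Longrightarrow> ?P a b" for N a b
  proof (induction N arbitrary: a)
    case 0
    thus ?case using U_eq_residue_series_small(2)[OF l, of _ a b] by simp
  next
    case (Suc N)
    hence "?P (a * Q) b" by (intro Suc.IH) (simp_all add: mult_ac)
    thus ?case by (rule step_a)
  qed
  have "norm (b * Q ^ M) < 1 \<Longrightarrow> ?P a b" for M b
  proof (induction M arbitrary: b)
    case 0
    thus ?case using Pa[of b a] exists_small_power[of a] by auto
  next
    case (Suc M)
    hence "?P a (b * Q)" by (intro Suc.IH) (simp add: mult_ac)
    thus ?case by (rule step_b)
  qed
  thus ?thesis using exists_small_power[of b] sm z by blast
qed

text \<open>
  To the left the factor \<open>x/(x + z)\<close> tends to \<open>1\<close> and can be divided out; to the right the residues decay like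
  the theta coefficients in any case.
\<close>

lemma res_seq_summable:
  assumes l: "off_spiral l" and z: "z \<noteq> 0" "off_spiral (l / z)"
    and sm: "(\<lambda>p. res_seq l a b p * pole_frac l z p) summable_on UNIV"
  shows "res_seq l a b summable_on UNIV"
proof (rule summable_on_int)
  have l0: "l \<noteq> 0" using off_spiral_nz[OF l] .
  obtain C where C: "\<And>y. norm y \<le> norm l \<Longrightarrow> norm (res_num a b y) \<le> C" using res_num_bounded by blast
  have "(\<lambda>n. norm (W 1 (X l n))) summable_on UNIV" using W_norm_summable[OF l0, of 1 1] by simp
  hence "(\<lambda>n. norm (W 1 (X l n))) summable_on range (\<lambda>n. int (Suc n))"
    by (rule summable_on_subset_banach) auto
  hence sW: "(\<lambda>n. norm (W 1 (X l (int (Suc n))))) summable_on UNIV"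
    by (subst (asm) summable_on_reindex) (auto simp: o_def inj_on_def)
  show "(\<lambda>n. res_seq l a b (int n)) summable_on UNIV"
  proof (rule summable_on_dominated)
    show "(\<lambda>n. C * norm (W 1 (X l (int (Suc n))))) summable_on UNIV"
      by (intro summable_on_cmult_right sW)
    fix n :: nat
    have y: "X l (int n) * Q = X l (int (Suc n))" using X_Suc[of l "int n"] by (simp add: add.commute)
    have "X l (int (Suc n)) = l * Q ^ Suc n" unfolding X_def power_int_of_nat by (rule mult.commute)
    hence "norm (X l (int (Suc n))) \<le> norm l" using norm_mult_Q_pow_le[of l "Suc n"] by simp
    hence "norm (res_num a b (X l (int (Suc n)))) * norm (W 1 (X l (int (Suc n)))) \<le> C * norm (W 1 (X l (int (Suc n))))"
      by (intro mult_right_mono C) auto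
    thus "norm (res_seq l a b (int n)) \<le> C * norm (W 1 (X l (int (Suc n))))"
      unfolding res_def y by (simp add: W_def norm_divide)
  qed
  have "(\<lambda>p. norm (res_seq l a b p * pole_frac l z p)) summable_on range (\<lambda>n. - int n)"
    using summable_on_norm_complex[OF sm] by (rule summable_on_subset_banach) auto
  hence sT: "(\<lambda>n. norm (res_seq l a b (- int n) * pole_frac l z (- int n))) summable_on UNIV"
    by (subst (asm) summable_on_reindex) (auto simp: o_def inj_on_def)
  show "(\<lambda>n. res_seq l a b (- int n)) summable_on UNIV"
  proof (rule summable_on_dominated)
    show "(\<lambda>n. (1 + norm (z / l)) * norm (res_seq l a b (- int n) * pole_frac l z (- int n))) summable_on UNIV"
      by (intro summable_on_cmult_right sT)
    fix n :: nat
    define x where "x = X l (- int n)"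
    have x0: "x \<noteq> 0" "x + z \<noteq> 0" using l0 off_spiral_X_add_nz[OF z] by (auto simp: x_def)
    have "z / x = z / l * Q ^ n" using l0 by (simp add: x_def X_def power_int_minus field_simps)
    hence "norm (z / x) \<le> norm (z / l)" using norm_mult_Q_pow_le[of "z / l" n] by simp
    hence b: "norm (1 + z / x) \<le> 1 + norm (z / l)"
      using norm_triangle_ineq[of 1 "z / x"] by simp
    have "res a b x = (1 + z / x) * (res a b x * (x / (x + z)))"
    proof -
      have "1 + z / x = (x + z) / x" using x0 by (simp add: field_simps)
      hence "(1 + z / x) * (x / (x + z)) = 1" using x0 by simp
      thus ?thesis by (metis mult.commute mult.left_commute mult.right_neutral)
    qed
    hence "norm (res a b x) = norm (1 + z / x) * norm (res a b x * (x / (x + z)))"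
      by (metis norm_mult)
    also have "\<dots> \<le> (1 + norm (z / l)) * norm (res a b x * (x / (x + z)))"
      by (intro mult_right_mono b) auto
    finally show "norm (res_seq l a b (- int n)) \<le> (1 + norm (z / l)) * norm (res_seq l a b (- int n) * pole_frac l z (- int n))"
      by (simp add: pole_frac_def x_def)
  qed
qed

lemma pinf_times_1phi1_eq_res_num:
  assumes a: "a \<noteq> 0" and b: "\<And>k. - b * y * Q ^ k \<noteq> 1"
  shows "pinf (- b * y) * basic_hyp [Q / a] [- b * y] q (- a * y) = res_num a b y"
proof (rule pinf_times_1phi1)
  show "- b * y * Q ^ k \<noteq> 1" for k by (rule b)
  have "pfin (Q / a) n / pfin Q n * Q ^ (n choose 2) * (- (- a * y)) ^ n * pinf (- b * y * Q ^ n) = res_term a b y n" for n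
  proof -
    have "pfin (Q / a) n * a ^ n = (\<Prod>i<n. a - Q ^ Suc i)"
    proof -
      have "a ^ n = (\<Prod>i<n. a)" by simp
      thus ?thesis unfolding qpoch_def using a
        by (simp only: prod.distrib[symmetric]) (intro prod.cong, auto simp: field_simps)
    qed
    hence "ratio_coeff a n = pfin (Q / a) n / pfin Q n * a ^ n" by (simp add: ratio_coeff_def)
    thus ?thesis by (simp add: res_term_def power_mult_distrib mult_ac)
  qed
  thus "((\<lambda>n. pfin (Q / a) n / pfin Q n * Q ^ (n choose 2) * (- (- a * y)) ^ n * pinf (- b * y * Q ^ n)) has_sum res_num a b y) UNIV"
    using res_num_has_sum[of a b y] by simp
qed

end

section \<open>Four expansions of the resummed function\<close>

theorem theorem5p2:
  fixes q :: real and l z a b :: complex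
  assumes q: "0 < q" "q < 1"
    and l: "l \<noteq> 0" "\<forall>n::int. l \<noteq> - (of_real q powi n)"
    and z: "z \<noteq> 0" "\<forall>n::int. z \<noteq> - (of_real q powi n) * l"
  shows
    "U_term q l a b z summable_on UNIV
     \<and>
     ((\<forall>n::int. - b * of_real q powi n * l \<noteq> 1) \<longrightarrow>
       (let T = (\<lambda>n::int.
              qpoch_inf (- b * of_real q powi n * l) q
              * basic_hyp [b] [- b * of_real q powi n * l] q (- a * of_real q powi n * l)
              / (qpoch_inf (- (of_real q powi n) * l) q * theta_q q (of_real q powi n * l / z)))
        in T summable_on UNIV \<and> U_q q l a b z = (\<Sum>\<^sub>\<infinity>n\<in>UNIV. T n)))
     \<and>
     (norm (a * of_real q) < 1 \<longrightarrow>
       (let T = (\<lambda>n::int.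
              qpoch_inf (- b * of_real q powi n * l) q
              * qpoch_inf (- (a * of_real q * z / (of_real q powi n * l))) q
              / (qpoch_inf (- (of_real q powi n) * l) q * theta_q q (of_real q powi n * l / z)))
        in (norm a < 1 \<longrightarrow> T summable_on UNIV) \<and>
           (T summable_on UNIV \<longrightarrow>
              U_q q l a b z = qpoch_inf a q * (\<Sum>\<^sub>\<infinity>n\<in>UNIV. T n))))
     \<and>
     (norm (a * b * z) < 1 \<longrightarrow>
       (let T = (\<lambda>n::int.
              qpoch_inf (- a * of_real q powi n * l) q * qpoch_inf (- b * of_real q powi n * l) q
              / (qpoch_inf (- (of_real q powi n) * l) q * theta_q q (of_real q powi n * l / z)))
        in T summable_on UNIV \<and>
           U_q q l a b z = qpoch_inf (a * b * z) q * (\<Sum>\<^sub>\<infinity>n\<in>UNIV. T n)))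
     \<and>
     (a \<noteq> 0 \<and> (\<forall>n::int. - b * of_real q powi n * l \<noteq> 1) \<longrightarrow>
       (let K0 = qpoch_inf a q * qpoch_inf b q / qpoch_inf (of_real q) q;
            T = (\<lambda>n::int.
              qpoch_inf (- b * of_real q powi (n + 1) * l) q
              * basic_hyp [of_real q / a] [- b * of_real q powi (n + 1) * l] q
                  (- a * of_real q powi (n + 1) * l)
              / theta_q q (of_real q powi (n + 1) * l)
              * (of_real q powi n * l / (of_real q powi n * l + z)))
        in (norm a < 1 \<and> norm b < 1 \<longrightarrow> T summable_on UNIV) \<and>
           (T summable_on UNIV \<longrightarrow>
              U_q q l a b z = K0 * (\<Sum>\<^sub>\<infinity>n\<in>UNIV. T n))))"
proof -
  interpret q_base q by standard (use q in auto)
  have ls: "off_spiral l" using l by (simp add: off_spiral_def)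
  have "off_spiral (z / l)" using z l by (simp add: off_spiral_def field_simps)
  hence lz: "off_spiral (l / z)" using off_spiral_inverse by blast
  have Uq: "U_q q l a b z = U l a b z" by (rule U_q_eq[OF ls])
  have orbit: "- b * X l n * Q ^ k \<noteq> 1" if "\<forall>n::int. - b * Q powi n * l \<noteq> 1" for n k
    using that[rule_format, of "n + int k"] by (simp add: X_def power_int_add mult_ac)
  have terms: "U_term q l a b z summable_on UNIV"
    using U_summable[OF ls z(1), of a b] by (simp add: U_term_eq[OF ls] cong: summable_on_cong)
  show ?thesis
  proof (intro conjI impI, goal_cases)
    case 1
    show ?case by (rule terms)
  next
    case nb: 2
    have eq: "qpoch_inf (- b * of_real q powi n * l) q
              * basic_hyp [b] [- b * of_real q powi n * l] q (- a * of_real q powi n * l)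
              / (qpoch_inf (- (of_real q powi n) * l) q * theta_q q (of_real q powi n * l / z)) = U_term q l a b z n" for n
    proof -
      have "pinf (- b * X l n) * basic_hyp [b] [- b * X l n] q (- a * X l n) = G a b (X l n)"
        by (rule pinf_times_1phi1_eq_G) (rule orbit[OF nb])
      thus ?thesis unfolding U_term_eq[OF ls] F_def W_def X_def by (simp add: mult.assoc)
    qed
    show ?case unfolding Let_def eq using terms by (simp add: U_q_def)
  next
    case aq: 3
    have eq: "qpoch_inf (- b * of_real q powi n * l) q
              * qpoch_inf (- (a * of_real q * z / (of_real q powi n * l))) q
              / (qpoch_inf (- (of_real q powi n) * l) q * theta_q q (of_real q powi n * l / z)) = asym_term l a b z n" for n
      by (simp add: asym_term_def pinf_ratio_def W_def X_def mult.assoc)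
    show ?case unfolding Let_def eq Uq
      using U_eq_asymmetric_series_small(1)[OF ls z(1), of a b] U_eq_asymmetric_series[OF ls z(1) aq] by blast
  next
    case abz: 4
    have eq: "qpoch_inf (- a * of_real q powi n * l) q * qpoch_inf (- b * of_real q powi n * l) q
              / (qpoch_inf (- (of_real q powi n) * l) q * theta_q q (of_real q powi n * l / z)) = sym_term l a b z n" for n
      by (simp add: sym_term_def X_def mult.assoc)
    show ?case unfolding Let_def eq Uq
      using sym_term_summable[OF ls z(1) abz] U_eq_symmetric_series[OF ls z(1) abz] by blast
  next
    case 5
    hence a0: "a \<noteq> 0" and nb: "\<forall>n::int. - b * of_real q powi n * l \<noteq> 1" by auto
    have eq: "qpoch_inf (- b * of_real q powi (n + 1) * l) q
              * basic_hyp [of_real q / a] [- b * of_real q powi (n + 1) * l] q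
                  (- a * of_real q powi (n + 1) * l)
              / theta_q q (of_real q powi (n + 1) * l)
              * (of_real q powi n * l / (of_real q powi n * l + z)) = res_seq l a b n * pole_frac l z n" for n
    proof -
      have "pinf (- b * X l (n + 1)) * basic_hyp [Q / a] [- b * X l (n + 1)] q (- a * X l (n + 1)) = res_num a b (X l (n + 1))"
        by (rule pinf_times_1phi1_eq_res_num[OF a0]) (rule orbit[OF nb])
      thus ?thesis unfolding res_def pole_frac_def X_Suc[symmetric] unfolding X_def by (simp only: mult.assoc)
    qed
    have "U l a b z = pinf a * pinf b / pinf Q * (\<Sum>\<^sub>\<infinity>n. res_seq l a b n * pole_frac l z n)"
      if "(\<lambda>n. res_seq l a b n * pole_frac l z n) summable_on UNIV"
      using U_eq_residue_series[OF ls z(1) lz res_seq_summable[OF ls z(1) lz that]]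
      unfolding res_series_def .
    thus ?case unfolding Let_def eq Uq
      using U_eq_residue_series_small(1)[OF ls z(1) lz, of a b] by blast
  qed
qed

end
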